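(* Let $\omega\in S_n$ be a vexillary permutation and let $P\in Pipes(\omega)$ be a bumpless pipe dream for $\omega$. Then for each $i\in\{1,\dots,n\}$, the $i^{th}$ pipe of $P$ contains at most $r_{\omega^{-1}(i)}-c_{\omega^{-1}(i)}$ up-elbow tiles. In particular, if the marked bumpless pipe dream $(P,U(P))$ corresponds to a maximal degree term of $\mathfrak{G}_{\omega}$ (i.e. $|D(P)|+|U(P)|=\deg \mathfrak{G}_\omega$), then for every $i$ the $i^{th}$ pipe of $P$ contains exactly $r_{\omega^{-1}(i)}-c_{\omega^{-1}(i)}$ up-elbows.
   Context: Permutations $\omega\in S_n$ are written in one-line notation $\omega(1)\cdots\omega(n)$. $\omega$ is vexillary if it is $2143$-avoiding (there are no $a<b<c<d$ with $\omega(b)<\omega(a)<\omega(d)<\omega(c)$). The Lehmer code is $(c_1,\dots,c_n)$ with $c_i=|\{j>i:\omega(j)<\omega(i)\}|$, and $\ell(\omega)=\sum_i c_i$. The Rajchgot code is $(r_1,\dots,r_n)$ where $r_i$ is the minimum number of elements that must be removed from the sequence $\omega(i),\omega(i+1),\dots,\omega(n)$ to obtain an increasing sequence beginning with $\omega(i)$. A bumpless pipe dream (BPD) is a tiling of the $n\times n$ grid (square $(i,j)$ in row $i$ from the top, column $j$ from the left) by six tiles: a crossing (vertical and horizontal segment), a vertical segment, a horizontal segment, an up-elbow (a curve joining the midpoint of the left edge to the midpoint of the top edge), a down-elbow (a curve joining the midpoint of the bottom edge to the midpoint of the right edge), and a blank tile, such that the tiles form $n$ pipes each entering through the bottom edge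 of the grid and exiting through the right edge. The pipe entering at the bottom of column $i$ is called the $i^{th}$ pipe. The associated permutation $\omega$ is obtained by replacing every crossing between two pipes other than their first crossing by a bump tile (an up-elbow and a down-elbow in the same square) and letting $\omega(r)$ be the label of the pipe exiting at the right end of row $r$; thus pipe $i$ exits in row $\omega^{-1}(i)$. $Pipes(\omega)$ is the set of BPDs with associated permutation $\omega$. For a BPD $P$, $U(P)$ is its set of up-elbow tiles and $D(P)$ its set of blank tiles. A marked BPD is a pair $(P,S)$ with $S\subseteq U(P)$; it corresponds to the monomial $\prod_{(i,j)\in D(P)\cup S}x_i$. The Grothendieck polynomial is defined by $\mathfrak{G}_{\omega_0}=x_1^{n-1}x_2^{n-2}\cdots x_{n-1}$ for $\omega_0=n\,(n-1)\cdots 1$ and $\mathfrak{G}_{\omega s_i}=\pi_i\mathfrak{G}_\omega$ whenever $\omega s_i$ has one fewer inversion than $\omega$, where $\pi_i(f)=\partial_i(f-x_{i+1}f)$ and $\partial_i(f)=(f-s_if)/(x_i-x_{i+1})$; equivalently $\mathfrak{G}_\omega=\sum_{(P,S)}(-1)^{|D(P)|+|S|-\ell(\omega)}\prod_{(i,j)\in D(P)\cup S}x_i$, summed over marked BPDs with $P\in Pipes(\omega)$. *)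

theory Defs
  imports "HOL-Combinatorics.Permutations" "HOL-Library.Poly_Mapping"
begin

text \<open>Elements of \<open>S\<^sub>n\<close> are functions \<open>w :: nat \<Rightarrow> nat\<close> with \<open>w permutes {1..n}\<close>.\<close>

definition vexillary :: "nat \<Rightarrow> (nat \<Rightarrow> nat) \<Rightarrow> bool" where
  "vexillary n w \<longleftrightarrow>
     \<not> (\<exists>a b c d. 1 \<le> a \<and> a < b \<and> b < c \<and> c < d \<and> d \<le> n \<and>
         w b < w a \<and> w a < w d \<and> w d < w c)"

definition lehmer_code :: "nat \<Rightarrow> (nat \<Rightarrow> nat) \<Rightarrow> nat \<Rightarrow> nat" where
  "lehmer_code n w i = card {j \<in> {i<..n}. w j < w i}"

definition perm_length :: "nat \<Rightarrow> (nat \<Rightarrow> nat) \<Rightarrow> nat" where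
  "perm_length n w = (\<Sum>i\<in>{1..n}. lehmer_code n w i)"

text \<open>\<open>R\<close> is the set of removed positions; \<open>i \<notin> R\<close> says that the remaining sequence
  still begins with \<open>w i\<close>.\<close>

definition rajchgot_code :: "nat \<Rightarrow> (nat \<Rightarrow> nat) \<Rightarrow> nat \<Rightarrow> nat" where
  "rajchgot_code n w i =
     Min {card R | R. R \<subseteq> {i..n} \<and> i \<notin> R \<and> strict_mono_on ({i..n} - R) w}"


section \<open>Bumpless pipe dreams\<close>

datatype tile = Cross | Vert | Horiz | Up_Elbow | Down_Elbow | Blank

definition meets_left :: "tile \<Rightarrow> bool" where
  "meets_left t \<longleftrightarrow> t \<in> {Cross, Horiz, Up_Elbow}"

definition meets_top :: "tile \<Rightarrow> bool" where
  "meets_top t \<longleftrightarrow> t \<in> {Cross, Vert, Up_Elbow}"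

definition meets_bottom :: "tile \<Rightarrow> bool" where
  "meets_bottom t \<longleftrightarrow> t \<in> {Cross, Vert, Down_Elbow}"

definition meets_right :: "tile \<Rightarrow> bool" where
  "meets_right t \<longleftrightarrow> t \<in> {Cross, Horiz, Down_Elbow}"

text \<open>A tiling is a function \<open>P\<close> of the row \<open>i\<close> (counted from the top) and the column \<open>j\<close>
  (counted from the left); its values outside \<open>{1..n} \<times> {1..n}\<close> are never used. The tiles form
  \<open>n\<close> pipes running from the bottom edge to the right edge iff the segments of adjacent squares
  fit together, every bottom and every right boundary edge is met, and no left or top boundary
  edge is met: traversed from the bottom of the grid, each tile leads a pipe only upwards or to
  the right, so there are no closed loops.\<close>

definition bumpless_pipe_dream :: "nat \<Rightarrow> (nat \<Rightarrow> nat \<Rightarrow> tile) \<Rightarrow> bool" where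
  "bumpless_pipe_dream n P \<longleftrightarrow>
     (\<forall>i\<in>{1..n}. \<forall>j\<in>{1..<n}. meets_right (P i j) \<longleftrightarrow> meets_left (P i (j + 1))) \<and>
     (\<forall>i\<in>{1..<n}. \<forall>j\<in>{1..n}. meets_bottom (P i j) \<longleftrightarrow> meets_top (P (i + 1) j)) \<and>
     (\<forall>j\<in>{1..n}. meets_bottom (P n j)) \<and>
     (\<forall>i\<in>{1..n}. meets_right (P i n)) \<and>
     (\<forall>i\<in>{1..n}. \<not> meets_left (P i 1)) \<and>
     (\<forall>j\<in>{1..n}. \<not> meets_top (P 1 j))"

text \<open>\<open>from_below n P i j\<close> and \<open>from_left n P i j\<close> are the labels of the pipes that enter square
  \<open>(i, j)\<close> through its bottom and its left edge, with \<open>0\<close> for no pipe; the label of a pipe is the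
  column in which it enters the grid. The pipes are followed from their starting points, after
  repeated crossings have been replaced by bump tiles: at a crossing tile \<open>(i, j)\<close> with
  \<open>bumps n P i j\<close> the pipe from the left turns upwards and the pipe from below turns right.
  A crossing tile bumps iff the same two pipes have already met at an earlier crossing tile, which
  necessarily lies weakly below and weakly to the left.\<close>

lemma bex_fundef_cong [fundef_cong]:
  "A = B \<Longrightarrow> (\<And>x. x \<in> B \<Longrightarrow> Q x \<longleftrightarrow> R x) \<Longrightarrow> (\<exists>x\<in>A. Q x) \<longleftrightarrow> (\<exists>x\<in>B. R x)"
  by (rule bex_cong)

function from_below :: "nat \<Rightarrow> (nat \<Rightarrow> nat \<Rightarrow> tile) \<Rightarrow> nat \<Rightarrow> nat \<Rightarrow> nat"
  and from_left :: "nat \<Rightarrow> (nat \<Rightarrow> nat \<Rightarrow> tile) \<Rightarrow> nat \<Rightarrow> nat \<Rightarrow> nat"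
  and bumps :: "nat \<Rightarrow> (nat \<Rightarrow> nat \<Rightarrow> tile) \<Rightarrow> nat \<Rightarrow> nat \<Rightarrow> bool"
where
  "from_below n P i j =
     (if i < n then
        (case P (i + 1) j of
           Vert \<Rightarrow> from_below n P (i + 1) j
         | Up_Elbow \<Rightarrow> from_left n P (i + 1) j
         | Cross \<Rightarrow> (if bumps n P (i + 1) j then from_left n P (i + 1) j
                    else from_below n P (i + 1) j)
         | _ \<Rightarrow> 0)
      else j)"
| "from_left n P i j =
     (if 1 < j then
        (case P i (j - 1) of
           Horiz \<Rightarrow> from_left n P i (j - 1)
         | Down_Elbow \<Rightarrow> from_below n P i (j - 1)
         | Cross \<Rightarrow> (if bumps n P i (j - 1) then from_below n P i (j - 1)
                    else from_left n P i (j - 1))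
         | _ \<Rightarrow> 0)
      else 0)"
| "bumps n P i j \<longleftrightarrow>
     (\<exists>i'\<in>{i..n}. \<exists>j'\<in>{1..j}. (i', j') \<noteq> (i, j) \<and> P i' j' = Cross \<and>
        {from_below n P i' j', from_left n P i' j'} = {from_below n P i j, from_left n P i j})"
  by pat_completeness auto
termination
  by (relation "measure (\<lambda>s. case s of
        Inl (n, P, i, j) \<Rightarrow> 2 * ((n - i) + j)
      | Inr (Inl (n, P, i, j)) \<Rightarrow> 2 * ((n - i) + j)
      | Inr (Inr (n, P, i, j)) \<Rightarrow> 2 * ((n - i) + j) + 1)") auto

text \<open>These equations loop as rewrite rules.\<close>

declare from_below.simps [simp del] from_left.simps [simp del] bumps.simps [simp del]

text \<open>\<open>from_left n P r (n + 1)\<close> is the label of the pipe leaving the grid at the right end of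
  row \<open>r\<close>.\<close>

definition Pipes :: "nat \<Rightarrow> (nat \<Rightarrow> nat) \<Rightarrow> (nat \<Rightarrow> nat \<Rightarrow> tile) set" where
  "Pipes n w =
     {P. bumpless_pipe_dream n P \<and> (\<forall>r\<in>{1..n}. from_left n P r (n + 1) = w r)}"

definition up_elbows :: "nat \<Rightarrow> (nat \<Rightarrow> nat \<Rightarrow> tile) \<Rightarrow> (nat \<times> nat) set" where
  "up_elbows n P = {(i, j) \<in> {1..n} \<times> {1..n}. P i j = Up_Elbow}"

definition blanks :: "nat \<Rightarrow> (nat \<Rightarrow> nat \<Rightarrow> tile) \<Rightarrow> (nat \<times> nat) set" where
  "blanks n P = {(i, j) \<in> {1..n} \<times> {1..n}. P i j = Blank}"

definition pipe_up_elbows :: "nat \<Rightarrow> (nat \<Rightarrow> nat \<Rightarrow> tile) \<Rightarrow> nat \<Rightarrow> (nat \<times> nat) set" where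
  "pipe_up_elbows n P p = {(i, j) \<in> up_elbows n P. from_left n P i j = p}"


section \<open>Grothendieck polynomials\<close>

text \<open>Integer polynomials in variables \<open>x\<^sub>0, x\<^sub>1, \<dots>\<close>; a monomial is its finitely supported
  exponent vector. Multiplication is the convolution product of \<^theory>\<open>HOL-Library.Poly_Mapping\<close>.\<close>

type_synonym int_mpoly = "(nat \<Rightarrow>\<^sub>0 nat) \<Rightarrow>\<^sub>0 int"

definition X :: "nat \<Rightarrow> int_mpoly" where
  "X i = Poly_Mapping.single (Poly_Mapping.single i 1) 1"

definition total_degree :: "int_mpoly \<Rightarrow> nat" where
  "total_degree f =
     Max (insert 0 ((\<lambda>m. \<Sum>i\<in>Poly_Mapping.keys m. Poly_Mapping.lookup m i) ` Poly_Mapping.keys f))"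

text \<open>\<open>swap_vars i f\<close> is \<open>s\<^sub>i f\<close>: the coefficient of a monomial \<open>m\<close> in it is the coefficient in
  \<open>f\<close> of \<open>m\<close> with the exponents of \<open>x\<^sub>i\<close> and \<open>x\<^sub>i\<^sub>+\<^sub>1\<close> exchanged.\<close>

definition swap_vars :: "nat \<Rightarrow> int_mpoly \<Rightarrow> int_mpoly" where
  "swap_vars i f = Poly_Mapping.map_key (Poly_Mapping.map_key (transpose i (i + 1))) f"

definition divided_difference :: "nat \<Rightarrow> int_mpoly \<Rightarrow> int_mpoly" where
  "divided_difference i f = (THE g. (X i - X (i + 1)) * g = f - swap_vars i f)"

definition isobaric_difference :: "nat \<Rightarrow> int_mpoly \<Rightarrow> int_mpoly" where
  "isobaric_difference i f = divided_difference i (f - X (i + 1) * f)"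

definition longest_perm :: "nat \<Rightarrow> nat \<Rightarrow> nat" where
  "longest_perm n i = (if i \<in> {1..n} then n + 1 - i else i)"

text \<open>\<open>grothendieck n w f\<close> says that \<open>f\<close> is the Grothendieck polynomial of \<open>w \<in> S\<^sub>n\<close>. The
  recursion may be followed along different chains below the longest permutation; since the operators
  satisfy the braid relations, they all give the same \<open>f\<close>.\<close>

inductive grothendieck :: "nat \<Rightarrow> (nat \<Rightarrow> nat) \<Rightarrow> int_mpoly \<Rightarrow> bool" for n where
  longest: "grothendieck n (longest_perm n) (\<Prod>i\<in>{1..n}. X i ^ (n - i))"
| descent: "grothendieck n w f \<Longrightarrow> i \<in> {1..<n} \<Longrightarrow>
     perm_length n (w \<circ> transpose i (i + 1)) + 1 = perm_length n w \<Longrightarrow>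
     grothendieck n (w \<circ> transpose i (i + 1)) (isobaric_difference i f)"

end

theory Submission
  imports Defs
begin

text \<open>From every up-elbow of pipe \<open>p\<close> start two paths running down and to the right: one follows
  the pipes vertically and the unused edges horizontally and ends in the column where some pipe
  \<open>y\<close> starts, the other one follows the pipes horizontally and the unused edges vertically
  and ends in the row where some pipe \<open>z\<close> exits. If \<open>w\<close> is vexillary, then \<open>y\<close> and \<open>z\<close> both
  start to the right of \<open>p\<close> and exit below it, and they cross. Different up-elbows of \<open>p\<close> give
  different \<open>y\<close> and different \<open>z\<close>, so these pairs cover the pipes that start to the right of \<open>p\<close>
  and exit below it by few decreasing sequences, which bounds the increasing ones. The same
  argument shows that no crossing is ever replaced by a bump, so that there are \<open>\<ell>(w)\<close> blank
  tiles.

  For the second part it remains to show that the degree of \<open>G\<^sub>w\<close> is at least \<open>\<Sum> r\<^sub>i\<close>. In the variables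
  \<open>1 - x\<^sub>i\<close> the operators \<open>\<pi>\<^sub>i\<close> are homogeneous, hence commute with the Euler operator \<open>E\<close>, and
  \<open>(maj (w\<inverse>) - E) G\<^sub>w = \<Sum> k G\<^bsub>s\<^sub>k w\<^esub>\<close>, summed over the \<open>k\<close> with \<open>s\<^sub>k w < w\<close>. This
  recursion shows that the coefficient of the monomial with exponents \<open>r\<^sub>i\<close> has the sign
  \<open>(-1)\<^bsup>\<ell>(w)\<^esup>\<close> and does not vanish, provided that this holds when no \<open>s\<^sub>k w < w\<close> has the same Rajchgot
  code; such \<open>w\<close> are obtained from 132-avoiding ones, where \<open>G\<^sub>w\<close> is a product, by \<open>\<pi>\<^sub>i\<close>'s that
  preserve the degree.\<close>

section \<open>Inversions and adjacent transpositions\<close>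

text \<open>The obstacle in the first part is that labels follow the pipes after bumps have been
  inserted, whereas the two paths see only tiles. Both agree where no bump occurs, so the claim
  about an up-elbow is proved under the assumption that no bump lies weakly below and to the right
  of it; a bump farthest to the lower right then contradicts this claim. All comparisons of labels
  rest on one principle: along a staircase, exactly the pairs that have already met at a crossing
  tile are inverted.

  Adding the bounds over all pipes gives |D(P)| + |U(P)| at most the sum of the Rajchgot code, so a
  lower bound for the degree forces equality for each pipe. There the obstacle is cancellation,
  since the operators have terms of both signs. The recursion with left factors avoids it: a left
  descent can only lower the Rajchgot code and always changes the parity of the length, and maj is
  at most the sum of the code, so in top degree all summands have one sign. What is left are
  permutations for which no summand is known to be nonzero; for them one extremal monomial is
  followed instead.\<close>

lemma perm_length_inversions:
  "perm_length n w = card {(i, j). 1 \<le> i \<and> i < j \<and> j \<le> n \<and> w j < w i}"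
proof -
  have "{(i, j). 1 \<le> i \<and> i < j \<and> j \<le> n \<and> w j < w i} = (SIGMA i:{1..n}. {j \<in> {i<..n}. w j < w i})" by auto
  then show ?thesis unfolding perm_length_def lehmer_code_def by simp
qed

abbreviation adj :: "nat \<Rightarrow> nat \<Rightarrow> nat" where
  "adj i \<equiv> transpose i (i + 1)"

lemma adj_less: "a < b \<Longrightarrow> \<not> (a = i \<and> b = i + 1) \<Longrightarrow> adj i a < adj i b"
  by (auto simp: transpose_def)

lemma comp_transpose_twice [simp]: "w \<circ> transpose a b \<circ> transpose a b = w"
  by (simp add: comp_assoc)

lemma adj_permutes: "i \<in> {1..<n} \<Longrightarrow> adj i permutes {1..n}"
  by (rule permutes_swap_id) auto

lemma permutes_comp_adj: "w permutes {1..n} \<Longrightarrow> i \<in> {1..<n} \<Longrightarrow> w \<circ> adj i permutes {1..n}"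
  by (rule permutes_compose[OF adj_permutes])

lemma permutes_adj_comp: "w permutes {1..n} \<Longrightarrow> k \<in> {1..<n} \<Longrightarrow> adj k \<circ> w permutes {1..n}"
  using permutes_compose[OF _ adj_permutes] .

text \<open>Applying \<open>adj i\<close> to both positions matches the inversions of
  \<open>w \<circ> adj i\<close> with those of \<open>w\<close> other than
  \<open>(i, i + 1)\<close>, because \<open>adj i\<close> preserves the order of every other
  pair.\<close>

lemma perm_length_descent:
  assumes "i \<in> {1..<n}" "w (i + 1) < w i"
  shows "perm_length n (w \<circ> adj i) + 1 = perm_length n w"
proof -
  let ?I = "\<lambda>w. {(a, b). 1 \<le> a \<and> a < b \<and> b \<le> n \<and> (w b :: nat) < w a}"
  have fin: "finite (?I w)" for w by (rule finite_subset[of _ "{1..n} \<times> {1..n}"]) auto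
  have r: "1 \<le> adj i a" "adj i a \<le> n" if "1 \<le> a" "a \<le> n" for a
    using that assms(1) by (auto simp: transpose_def)
  have "?I (w \<circ> adj i) = map_prod (adj i) (adj i) ` (?I w - {(i, i + 1)})"
  proof (intro equalityI subsetI)
    fix x assume "x \<in> ?I (w \<circ> adj i)"
    then obtain a b where x: "x = (a, b)" "1 \<le> a" "a < b" "b \<le> n" "w (adj i b) < w (adj i a)" by auto
    then have "\<not> (a = i \<and> b = i + 1)" using assms by auto
    from adj_less[OF x(3) this] have "(adj i a, adj i b) \<in> ?I w"
      using x r[of a] r[of b] by auto
    moreover have "(adj i a, adj i b) \<noteq> (i, i + 1)" using x(3) by (auto simp: transpose_def split: if_splits)
    ultimately have "(adj i a, adj i b) \<in> ?I w - {(i, i + 1)}" by blast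
    then show "x \<in> map_prod (adj i) (adj i) ` (?I w - {(i, i + 1)})"
      unfolding x(1) by (rule rev_image_eqI) simp
  next
    fix x assume "x \<in> map_prod (adj i) (adj i) ` (?I w - {(i, i + 1)})"
    then obtain a b where x: "x = (adj i a, adj i b)" "1 \<le> a" "a < b" "b \<le> n" "w b < w a" "\<not> (a = i \<and> b = i + 1)" by auto
    then show "x \<in> ?I (w \<circ> adj i)" using adj_less[OF x(3,6)] r[of a] r[of b] by auto
  qed
  then have "card (?I (w \<circ> adj i)) = card (map_prod (adj i) (adj i) ` (?I w - {(i, i + 1)}))"
    by (rule arg_cong)
  also have "\<dots> = card (?I w - {(i, i + 1)})"
  proof (rule card_image)
    have "inj (map_prod (adj i) (adj i))" by (rule prod.inj_map) (rule inj_transpose)+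
    then show "inj_on (map_prod (adj i) (adj i)) (?I w - {(i, i + 1)})" by (rule inj_on_subset) simp
  qed
  finally have "card (?I (w \<circ> adj i)) = card (?I w - {(i, i + 1)})" .
  moreover have "(i, i + 1) \<in> ?I w" using assms by auto
  ultimately show ?thesis unfolding perm_length_inversions using card_Suc_Diff1[OF fin, of "(i, i + 1)" w] by simp
qed

lemma perm_length_ascent:
  assumes "i \<in> {1..<n}" "w i < w (i + 1)"
  shows "perm_length n (w \<circ> adj i) = perm_length n w + 1"
  using perm_length_descent[of i n "w \<circ> adj i"] assms by simp

lemma perm_length_le: "perm_length n w \<le> n * n"
proof -
  have "card {(a, b). 1 \<le> a \<and> a < b \<and> b \<le> n \<and> w b < w a} \<le> card ({1..n} \<times> {1..n})"
    by (rule card_mono) auto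
  then show ?thesis unfolding perm_length_inversions by simp
qed

lemma longest_perm_permutes: "longest_perm n permutes {1..n}"
proof (rule bij_imp_permutes)
  show "bij_betw (longest_perm n) {1..n} {1..n}"
    by (rule bij_betwI[of _ _ _ "longest_perm n"]) (auto simp: longest_perm_def)
qed (auto simp: longest_perm_def)

lemma no_ascent_longest:
  assumes "w permutes {1..n}" "\<And>i. i \<in> {1..<n} \<Longrightarrow> w (i + 1) < w i"
  shows "w = longest_perm n"
proof
  fix i
  have w: "w j \<in> {1..n}" if "j \<in> {1..n}" for j using permutes_in_image[OF assms(1)] that by blast
  show "w i = longest_perm n i"
  proof (cases "i \<in> {1..n}")
    case True
    \<comment> \<open>Descending from position 1 bounds \<open>w i\<close> above by
      \<open>n + 1 - i\<close>, and counting back from position \<open>n\<close> gives the same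
      number as a lower bound.\<close>
    have up: "i \<in> {1..n} \<Longrightarrow> w i + i \<le> n + 1" for i
    proof (induction i)
      case (Suc i)
      then show ?case using w[of 1] assms(2)[of i] by (cases "i = 0") auto
    qed simp
    have down: "d < n \<Longrightarrow> d + 1 \<le> w (n - d)" for d
    proof (induction d)
      case 0
      then show ?case using w[of n] by auto
    next
      case (Suc d)
      have "Suc (n - Suc d) = n - d" using Suc.prems by simp
      moreover have "n - Suc d \<in> {1..<n}" using Suc.prems by auto
      ultimately show ?case using Suc assms(2)[of "n - Suc d"] by auto
    qed
    have "n - (n - i) = i" using True by simp
    then have "n - i + 1 \<le> w i" using down[of "n - i"] True by auto
    then show ?thesis using up[OF True] True by (auto simp: longest_perm_def)
  next
    case False
    then show ?thesis using permutes_not_in[OF assms(1)] by (auto simp: longest_perm_def)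
  qed
qed

lemma exists_ascent:
  assumes "w permutes {1..n}" "w \<noteq> longest_perm n"
  obtains i where "i \<in> {1..<n}" "w i < w (i + 1)"
proof -
  have "\<exists>i\<in>{1..<n}. \<not> w (i + 1) < w i" using no_ascent_longest assms by blast
  then obtain i where "i \<in> {1..<n}" "\<not> w (i + 1) < w i" by blast
  moreover have "w i \<noteq> w (i + 1)" using inj_eq[OF permutes_inj[OF assms(1)], of i "i + 1"] by simp
  ultimately show ?thesis using that by auto
qed

section \<open>The order of the labels along a staircase\<close>

lemma meets_simps [simp]:
  "meets_left Cross" "meets_left Horiz" "meets_left Up_Elbow"
  "\<not> meets_left Vert" "\<not> meets_left Down_Elbow" "\<not> meets_left Blank"
  "meets_top Cross" "meets_top Vert" "meets_top Up_Elbow"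
  "\<not> meets_top Horiz" "\<not> meets_top Down_Elbow" "\<not> meets_top Blank"
  "meets_bottom Cross" "meets_bottom Vert" "meets_bottom Down_Elbow"
  "\<not> meets_bottom Horiz" "\<not> meets_bottom Up_Elbow" "\<not> meets_bottom Blank"
  "meets_right Cross" "meets_right Horiz" "meets_right Down_Elbow"
  "\<not> meets_right Vert" "\<not> meets_right Up_Elbow" "\<not> meets_right Blank"
  by (simp_all add: meets_left_def meets_top_def meets_bottom_def meets_right_def)

locale bpd =
  fixes n :: nat and P :: "nat \<Rightarrow> nat \<Rightarrow> tile"
  assumes bpd: "bumpless_pipe_dream n P"
begin

abbreviation "FB \<equiv> from_below n P"
abbreviation "FL \<equiv> from_left n P"
abbreviation "bump \<equiv> bumps n P"

definition grid :: "(nat \<times> nat) set" where "grid = {1..n} \<times> {1..n}"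

lemma right_left: "i \<in> {1..n} \<Longrightarrow> j \<in> {1..<n} \<Longrightarrow> meets_right (P i j) \<longleftrightarrow> meets_left (P i (j + 1))"
  and bottom_top: "i \<in> {1..<n} \<Longrightarrow> j \<in> {1..n} \<Longrightarrow> meets_bottom (P i j) \<longleftrightarrow> meets_top (P (i + 1) j)"
  and bottom_edge: "j \<in> {1..n} \<Longrightarrow> meets_bottom (P n j)"
  and right_edge: "i \<in> {1..n} \<Longrightarrow> meets_right (P i n)"
  and left_edge: "i \<in> {1..n} \<Longrightarrow> \<not> meets_left (P i 1)"
  and top_edge: "j \<in> {1..n} \<Longrightarrow> \<not> meets_top (P 1 j)"
  using bpd unfolding bumpless_pipe_dream_def by blast+

definition out_top :: "nat \<Rightarrow> nat \<Rightarrow> nat" where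
  "out_top i j = (case P i j of Vert \<Rightarrow> FB i j | Up_Elbow \<Rightarrow> FL i j
     | Cross \<Rightarrow> (if bump i j then FL i j else FB i j) | _ \<Rightarrow> 0)"

definition out_right :: "nat \<Rightarrow> nat \<Rightarrow> nat" where
  "out_right i j = (case P i j of Horiz \<Rightarrow> FL i j | Down_Elbow \<Rightarrow> FB i j
     | Cross \<Rightarrow> (if bump i j then FB i j else FL i j) | _ \<Rightarrow> 0)"

lemma FB_bottom [simp]: "FB n j = j"
  by (subst from_below.simps) simp

lemma FL_left [simp]: "FL i (Suc 0) = 0"
  by (subst from_left.simps) simp

lemma FB_up: "i < n \<Longrightarrow> FB i j = out_top (Suc i) j"
  by (subst from_below.simps) (auto simp: out_top_def split: tile.split)

lemma FL_right: "1 \<le> j \<Longrightarrow> FL i (Suc j) = out_right i j"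
  by (subst from_left.simps) (auto simp: out_right_def split: tile.split)

text \<open>A pipe moves only up and to the right, so it never lies left of its starting column. A
  pipe entering through a left edge has already advanced by a column, which makes the second bound
  strict.\<close>

lemma label_bounds:
  "i \<le> n \<Longrightarrow> 1 \<le> j \<Longrightarrow> FB i j \<le> j"
  "i \<le> n \<Longrightarrow> 1 \<le> j \<Longrightarrow> FL i j < j"
proof (induction "2 * (n - i + j)" arbitrary: i j rule: less_induct)
  case less
  { case 1
    show ?case
    proof (cases "i = n")
      case False
      then have "FB i j = out_top (i + 1) j" using FB_up[of i j] 1 by simp
      moreover have "FB (i + 1) j \<le> j" "FL (i + 1) j < j" using less 1 False by auto
      ultimately show ?thesis by (auto simp: out_top_def split: tile.splits)
    qed simp
  next
    case 2
    show ?case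
    proof (cases "j = 1")
      case False
      then have "FL i j = out_right i (j - 1)" using FL_right[of "j - 1" i] 2 False by (cases j) auto
      moreover have "FB i (j - 1) \<le> j - 1" "FL i (j - 1) < j - 1" using less 2 False by auto
      ultimately show ?thesis using False 2 by (auto simp: out_right_def split: tile.splits)
    qed simp }
qed

text \<open>A bump exchanges the labels on the outgoing edges of a crossing but does not change
  which edges are met, so the label 0 depends on the tiles alone.\<close>

lemma label_nonzero:
  "i \<in> {1..n} \<Longrightarrow> j \<in> {1..n} \<Longrightarrow> FB i j \<noteq> 0 \<longleftrightarrow> meets_bottom (P i j)"
  "i \<in> {1..n} \<Longrightarrow> j \<in> {1..n} \<Longrightarrow> FL i j \<noteq> 0 \<longleftrightarrow> meets_left (P i j)"
proof (induction "2 * (n - i + j)" arbitrary: i j rule: less_induct)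
  case less
  { case 1
    show ?case
    proof (cases "i = n")
      case True then show ?thesis using bottom_edge[of j] 1 by auto
    next
      case False
      then have "FB i j = out_top (i + 1) j" using FB_up[of i j] 1 by simp
      moreover have "FB (i + 1) j \<noteq> 0 \<longleftrightarrow> meets_bottom (P (i+1) j)"
        "FL (i + 1) j \<noteq> 0 \<longleftrightarrow> meets_left (P (i+1) j)" using less 1 False by auto
      ultimately show ?thesis using bottom_top[of i j] 1 False
        by (auto simp: out_top_def split: tile.splits)
    qed
  next
    case 2
    show ?case
    proof (cases "j = 1")
      case True then show ?thesis using left_edge[of i] 2 by auto
    next
      case False
      then obtain j' where j': "j = Suc j'" "1 \<le> j'" using 2 by (cases j) auto
      then have "FL i j = out_right i j'" using FL_right[of j' i] by simp
      moreover have "FB i j' \<noteq> 0 \<longleftrightarrow> meets_bottom (P i j')"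
         "FL i j' \<noteq> 0 \<longleftrightarrow> meets_left (P i j')" using less 2 j' by auto
      ultimately show ?thesis using right_left[of i j'] j' 2
        by (auto simp: out_right_def split: tile.splits)
    qed }
qed

text \<open>The boundary of a set \<open>S\<close> of squares that is closed under going down and left is a staircase.
  Its edges are numbered from the top left: the left edge of square \<open>(i, j)\<close> has number \<open>i + j\<close> and
  its bottom edge \<open>i + j + 1\<close>. In \<open>reach S st\<close>, the state \<open>st\<close> maps the number of an edge of this
  staircase to the label on it, with \<open>0\<close> for no pipe. Adding a square affects only two consecutive
  entries, and either swaps them or leaves them unchanged.\<close>

definition init_state :: "nat \<Rightarrow> nat" where
  "init_state s = (if s \<le> 2 * n + 1 then s - (n + 1) else 0)"

inductive reach :: "(nat \<times> nat) set \<Rightarrow> (nat \<Rightarrow> nat) \<Rightarrow> bool" where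
  empty: "reach {} init_state"
| step: "reach S st \<Longrightarrow> (i, j) \<in> grid \<Longrightarrow> (i, j) \<notin> S \<Longrightarrow> j = 1 \<or> (i, j - 1) \<in> S \<Longrightarrow>
     i = n \<or> (i + 1, j) \<in> S \<Longrightarrow>
     reach (insert (i, j) S) (st(i + j := out_top i j, i + j + 1 := out_right i j))"

definition sw_closed :: "(nat \<times> nat) set \<Rightarrow> bool" where
  "sw_closed S \<longleftrightarrow> S \<subseteq> grid \<and>
     (\<forall>i j i' j'. (i, j) \<in> S \<longrightarrow> i \<le> i' \<longrightarrow> i' \<le> n \<longrightarrow> 1 \<le> j' \<longrightarrow> j' \<le> j \<longrightarrow> (i', j') \<in> S)"

lemma sw_closedD: "sw_closed S \<Longrightarrow> (i, j) \<in> S \<Longrightarrow> i \<le> i' \<Longrightarrow> i' \<le> n \<Longrightarrow> 1 \<le> j' \<Longrightarrow> j' \<le> j \<Longrightarrow> (i', j') \<in> S"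
  unfolding sw_closed_def by blast

lemma sw_closed_finite: "sw_closed S \<Longrightarrow> finite S"
  unfolding sw_closed_def grid_def by (meson finite_SigmaI finite_atLeastAtMost finite_subset)

lemma reach_closed: "reach S st \<Longrightarrow> sw_closed S"
proof (induction rule: reach.induct)
  case empty then show ?case by (simp add: sw_closed_def)
next
  case (step S st a b)
  have "(i', j') \<in> insert (a, b) S"
    if *: "(i, j) \<in> insert (a, b) S" "i \<le> i'" "i' \<le> n" "1 \<le> j'" "j' \<le> j" for i j i' j'
  proof (cases "(i, j) = (a, b)")
    case False then show ?thesis using * sw_closedD[OF step.IH, of i j i' j'] by blast
  next
    case eq: True
    show ?thesis
    proof (cases "i' > a")
      case True
      then have "(a + 1, b) \<in> S" using step * by auto
      then show ?thesis using sw_closedD[OF step.IH, of "a + 1" b i' j'] * eq True by auto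
    next
      case False
      then have i': "i' = a" using * eq by auto
      show ?thesis
      proof (cases "j' = b")
        case False
        then have "(a, b - 1) \<in> S" using step * eq i' by auto
        then show ?thesis using sw_closedD[OF step.IH, of a "b - 1" i' j'] * eq False i' by auto
      qed (use i' in auto)
    qed
  qed
  then show ?case using step unfolding sw_closed_def by auto
qed

text \<open>Adding \<open>(a, b)\<close> replaces the edges numbered \<open>a + b\<close> and
  \<open>a + b + 1\<close> by its top and its right edge. No other boundary edge has one of these
  numbers: by closure, \<open>S\<close> would then contain \<open>(a, b)\<close> or a square assumed
  to lie outside.\<close>

lemma reach_edges:
  assumes "reach S st"
  shows "\<And>i j. i \<in> {1..n} \<Longrightarrow> j \<in> {1..n+1} \<Longrightarrow> (i, j) \<notin> S \<Longrightarrow> j = 1 \<or> (i, j - 1) \<in> S \<Longrightarrow> st (i + j) = FL i j"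
    and "\<And>i j. i \<le> n \<Longrightarrow> j \<in> {1..n} \<Longrightarrow> (i, j) \<notin> S \<Longrightarrow> i = n \<or> (i + 1, j) \<in> S \<Longrightarrow> st (i + j + 1) = FB i j"
  using assms
proof (induction rule: reach.induct)
  \<comment> \<open>The first staircase runs down the left side, whose numbers are at most
    \<open>n + 1\<close> and get 0 by truncated subtraction, and then along the bottom, where number
    \<open>n + 1 + j\<close> gets the label \<open>j\<close>.\<close>
  case empty
  { case 1 then show ?case by (auto simp: init_state_def) next
    case 2 then show ?case by (auto simp: init_state_def) }
next
  case (step S st a b)
  note cl = reach_closed[OF step.hyps(1)]
  have ab: "1 \<le> a" "a \<le> n" "1 \<le> b" "b \<le> n" using step by (auto simp: grid_def)
  have S: "1 \<le> r \<and> r \<le> n \<and> 1 \<le> c \<and> c \<le> n" if "(r, c) \<in> S" for r c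
    using cl that unfolding sw_closed_def grid_def by auto
  { case (1 i j)
    show ?case
    proof (cases "(i, j - 1) = (a, b) \<and> j > 1")
      case True
      then have "i = a" "j = Suc b" by auto
      then show ?thesis using FL_right[of b a] ab by simp
    next
      case False
      then have old: "j = 1 \<or> (i, j - 1) \<in> S" "(i, j) \<notin> S" using 1 by auto
      have "i + j \<noteq> a + b"
      proof
        assume e: "i + j = a + b"
        have "(i, j) \<noteq> (a, b)" using 1 by auto
        then consider "i < a" | "i > a" using e by force
        then show False
        proof cases
          case 1
          then have "j - 1 \<ge> b" using e by auto
          then have "(i, j - 1) \<in> S" using old ab e by auto
          then show False using sw_closedD[OF cl, of i "j - 1" a b] 1 ab \<open>j - 1 \<ge> b\<close> step.hyps by auto
        next
          case 2
          then have "(a, b - 1) \<in> S" using step.hyps e 1 by auto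
          moreover have "j \<le> b - 1" using e 2 by linarith
          ultimately show False using sw_closedD[OF cl, of a "b - 1" i j] 2 old 1 by auto
        qed
      qed
      moreover have "i + j \<noteq> a + b + 1"
      proof
        assume e: "i + j = a + b + 1"
        consider "i < a" | "i = a" | "i > a" by linarith
        then show False
        proof cases
          case 1
          then have "(i, j - 1) \<in> S" using old ab e by auto
          moreover have "b \<le> j - 1" using e 1 by linarith
          ultimately show False using sw_closedD[OF cl, of i "j - 1" a b] 1 ab step.hyps by auto
        next
          case 2 then show False using e False ab by auto
        next
          case 3
          then have "(a + 1, b) \<in> S" using step.hyps 1 by auto
          then show False using sw_closedD[OF cl, of "a + 1" b i j] 3 e old 1 by auto
        qed
      qed
      ultimately show ?thesis using step.IH(1)[of i j] 1 old by simp
    qed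
  next
    case (2 i j)
    show ?case
    proof (cases "(i + 1, j) = (a, b)")
      case True
      then show ?thesis using FB_up[of i j] ab by auto
    next
      case False
      then have old: "i = n \<or> (i + 1, j) \<in> S" "(i, j) \<notin> S" using 2 by auto
      have "i + j + 1 \<noteq> a + b + 1"
      proof
        assume e: "i + j + 1 = a + b + 1"
        have "(i, j) \<noteq> (a, b)" using 2 by auto
        then consider "i < a" | "i > a" using e by force
        then show False
        proof cases
          case 1
          then have "(i + 1, j) \<in> S" using old ab by auto
          then show False using sw_closedD[OF cl, of "i + 1" j a b] 1 e ab step.hyps by auto
        next
          case 2
          then have "(a, b - 1) \<in> S" using step.hyps e \<open>j \<in> {1..n}\<close> by auto
          moreover have "j \<le> b - 1" using e 2 by linarith
          ultimately show False using sw_closedD[OF cl, of a "b - 1" i j] 2 old \<open>i \<le> n\<close> \<open>j \<in> {1..n}\<close> by auto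
        qed
      qed
      moreover have "i + j + 1 \<noteq> a + b"
      proof
        assume e: "i + j + 1 = a + b"
        consider "i + 1 < a" | "i + 1 = a" | "i \<ge> a" by linarith
        then show False
        proof cases
          case 1
          then have "(i + 1, j) \<in> S" using old ab by auto
          then show False using sw_closedD[OF cl, of "i + 1" j a b] 1 e ab step.hyps by auto
        next
          case 2 then show False using e False ab by auto
        next
          case 3
          then have "(a, b - 1) \<in> S" using step.hyps 2 e by auto
          moreover have "j \<le> b - 1" using e 3 by linarith
          ultimately show False using sw_closedD[OF cl, of a "b - 1" i j] 3 old 2 by auto
        qed
      qed
      ultimately show ?thesis using step.IH(2)[of i j] 2 old by simp
    qed }
qed

lemma reach_exists: "sw_closed S \<Longrightarrow> \<exists>st. reach S st"
proof (induction "card S" arbitrary: S)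
  case 0
  then have "S = {}" using sw_closed_finite by auto
  then show ?case using reach.empty by auto
next
  case (Suc k)
  have fin: "finite S" using Suc.prems sw_closed_finite by auto
  have ne: "S \<noteq> {}" using Suc by auto
  \<comment> \<open>A square maximizing \<open>j - i\<close> is a corner and can be removed last:
    any other square of \<open>S\<close> that forces it into \<open>S\<close> would have a larger
    difference.\<close>
  have "Max ((\<lambda>(i, j). int j - int i) ` S) \<in> (\<lambda>(i, j). int j - int i) ` S"
    using fin ne by (intro Max_in) auto
  then obtain a b where S: "(a, b) \<in> S" and m: "int b - int a = Max ((\<lambda>(i, j). int j - int i) ` S)"
    by auto
  have mx: "int j - int i \<le> int b - int a" if "(i, j) \<in> S" for i j
    unfolding m using fin that by (intro Max_ge) force+
  have g: "S \<subseteq> grid" using Suc.prems unfolding sw_closed_def by auto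
  have "sw_closed (S - {(a, b)})"
    unfolding sw_closed_def
  proof (intro conjI allI impI)
    fix i j i' j' assume *: "(i, j) \<in> S - {(a, b)}" "i \<le> i'" "i' \<le> n" "1 \<le> j'" "j' \<le> j"
    then have "(i', j') \<in> S" using sw_closedD[OF Suc.prems, of i j i' j'] by auto
    moreover have "(i', j') \<noteq> (a, b)" using mx[of i j] * by auto
    ultimately show "(i', j') \<in> S - {(a, b)}" by auto
  qed (use g in auto)
  moreover have "k = card (S - {(a, b)})" using card_Diff_singleton[OF S] Suc.hyps(2) by simp
  ultimately obtain st where st: "reach (S - {(a, b)}) st"
    using Suc.hyps(1) by blast
  have "a \<in> {1..n}" "b \<in> {1..n}" using S g unfolding grid_def by auto
  then have "b = 1 \<or> 1 \<le> b - 1 \<and> b - 1 \<noteq> b" "a = n \<or> a + 1 \<le> n" "1 \<le> b" "a \<le> n" by auto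
  then have "b = 1 \<or> (a, b - 1) \<in> S - {(a, b)}" "a = n \<or> (a + 1, b) \<in> S - {(a, b)}"
    using sw_closedD[OF Suc.prems S, of a "b - 1"] sw_closedD[OF Suc.prems S, of "a + 1" b] by auto
  from reach.step[OF st _ _ this] S g show ?case by (auto simp: insert_absorb)
qed

lemma reach_grid: "reach S st \<Longrightarrow> S \<subseteq> grid" "reach S st \<Longrightarrow> finite S"
  using reach_closed[of S st] sw_closed_finite[of S] by (simp_all add: sw_closed_def)

section \<open>Inversions of a state and crossing tiles\<close>

definition distinct_state :: "(nat \<Rightarrow> nat) \<Rightarrow> bool" where
  "distinct_state st \<longleftrightarrow> (\<forall>s t. st s = st t \<longrightarrow> st s \<noteq> 0 \<longrightarrow> s = t)"

lemma distinct_stateD: "distinct_state st \<Longrightarrow> st s = st t \<Longrightarrow> st s \<noteq> 0 \<Longrightarrow> s = t"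
  unfolding distinct_state_def by blast

text \<open>The first staircase carries the labels in increasing order, hence a pair counts as
  inverted when the larger label has the smaller number. The label 0 may repeat and is left
  out.\<close>

definition inv_pairs :: "(nat \<Rightarrow> nat) \<Rightarrow> (nat \<times> nat) set" where
  "inv_pairs st = {(l, m). 0 < l \<and> l < m \<and> (\<exists>s t. s < t \<and> st s = m \<and> st t = l)}"

definition crossings :: "(nat \<times> nat) set \<Rightarrow> (nat \<times> nat) set" where
  "crossings S = {(l, m). l < m \<and> (\<exists>(i, j) \<in> S. P i j = Cross \<and> {FB i j, FL i j} = {l, m})}"

lemma crossings_insert: "crossings (insert (i, j) S) = crossings S \<union>
    (if P i j = Cross \<and> FB i j \<noteq> FL i j then {(min (FB i j) (FL i j), max (FB i j) (FL i j))} else {})"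
  unfolding crossings_def by (auto simp: doubleton_eq_iff min_def max_def)

definition swap_state :: "nat \<Rightarrow> (nat \<Rightarrow> nat) \<Rightarrow> nat \<Rightarrow> nat" where
  "swap_state k st = st(k := st (k + 1), k + 1 := st k)"

lemma inv_pairs_iff: "(l, m) \<in> inv_pairs st \<longleftrightarrow> 0 < l \<and> l < m \<and> (\<exists>s t. s < t \<and> st s = m \<and> st t = l)"
  unfolding inv_pairs_def by auto

lemma inv_pairsI: "st s = m \<Longrightarrow> st t = l \<Longrightarrow> s < t \<Longrightarrow> 0 < l \<Longrightarrow> l < m \<Longrightarrow> (l, m) \<in> inv_pairs st"
  unfolding inv_pairs_def by auto

lemma swap_state_less:
  assumes "s < t" "\<not> (s = k \<and> t = k + 1)"
  obtains s' t' where "s' < t'" "swap_state k st s' = st s" "swap_state k st t' = st t"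
proof -
  let ?f = "\<lambda>s. if s = k then k + 1 else if s = k + 1 then k else s"
  have "swap_state k st (?f s) = st s" for s by (auto simp: swap_state_def)
  moreover have "?f s < ?f t" using assms by auto
  ultimately show ?thesis using that by blast
qed

lemma swap_state_twice: "swap_state k (swap_state k st) = st"
  by (auto simp: swap_state_def fun_eq_iff)

lemma distinct_state_swap:
  assumes "distinct_state st" shows "distinct_state (swap_state k st)"
  unfolding distinct_state_def
proof (intro allI impI)
  fix s t assume *: "swap_state k st s = swap_state k st t" "swap_state k st s \<noteq> 0"
  let ?f = "\<lambda>s. if s = k then k + 1 else if s = k + 1 then k else s"
  have f: "swap_state k st s = st (?f s)" for s by (auto simp: swap_state_def)
  have "?f s = ?f t" using * assms unfolding distinct_state_def f by blast
  then show "s = t" by (auto split: if_splits)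
qed

text \<open>Exchanging neighbours reverses the order of that pair only. If one of the two labels is
  0, the second branch applies and the pair removed there is not in the set.\<close>

lemma inv_pairs_swap:
  assumes "distinct_state st"
  shows "inv_pairs (swap_state k st) =
    (if 0 < st k \<and> st k < st (k + 1) then insert (st k, st (k + 1)) (inv_pairs st)
     else inv_pairs st - {(st (k + 1), st k)})"
proof -
  have dsw: "distinct_state (swap_state k st)" using distinct_state_swap[OF assms] .
  have 1: "(l, m) \<in> inv_pairs (swap_state k st)" if lm: "(l, m) \<in> inv_pairs st" "(l, m) \<noteq> (st (k + 1), st k)" for l m
  proof -
    obtain s t where st: "s < t" "st s = m" "st t = l" using lm unfolding inv_pairs_def by auto
    with lm have "\<not> (s = k \<and> t = k + 1)" by auto
    from swap_state_less[OF st(1) this] obtain s' t'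
      where "s' < t'" "swap_state k st s' = m" "swap_state k st t' = l" using st by metis
    then show ?thesis using lm unfolding inv_pairs_iff by blast
  qed
  have 2: "(l, m) \<in> inv_pairs st" if lm: "(l, m) \<in> inv_pairs (swap_state k st)" "(l, m) \<noteq> (st k, st (k + 1))" for l m
  proof -
    obtain s t where st: "s < t" "swap_state k st s = m" "swap_state k st t = l" using lm unfolding inv_pairs_def by auto
    with lm have "\<not> (s = k \<and> t = k + 1)" by (auto simp: swap_state_def)
    from swap_state_less[OF st(1) this] obtain s' t'
      where "s' < t'" "st s' = m" "st t' = l" using st swap_state_twice by metis
    then show ?thesis using lm unfolding inv_pairs_iff by blast
  qed
  have a1: "x \<in> inv_pairs (swap_state k st)" if "x \<in> inv_pairs st" "x \<noteq> (st (k + 1), st k)" for x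
    using 1[of "fst x" "snd x"] that by simp
  have a2: "x \<in> inv_pairs st" if "x \<in> inv_pairs (swap_state k st)" "x \<noteq> (st k, st (k + 1))" for x
    using 2[of "fst x" "snd x"] that by simp
  have 3: "(st k, st (k + 1)) \<in> inv_pairs (swap_state k st)" if "0 < st k \<and> st k < st (k + 1)"
    using that by (intro inv_pairsI[of _ k _ "k + 1"]) (auto simp: swap_state_def)
  have 4: "(st k, st (k + 1)) \<notin> inv_pairs (swap_state k st)" if "\<not> (0 < st k \<and> st k < st (k + 1))"
    using that unfolding inv_pairs_def by auto
  have 5: "(st (k + 1), st k) \<notin> inv_pairs (swap_state k st)"
  proof
    assume "(st (k + 1), st k) \<in> inv_pairs (swap_state k st)"
    then obtain s t where *: "s < t" "swap_state k st s = st k" "swap_state k st t = st (k + 1)" "0 < st (k+1)" "st (k+1) < st k"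
      unfolding inv_pairs_def by auto
    have "swap_state k st (k + 1) = st k" "swap_state k st k = st (k + 1)" by (auto simp: swap_state_def)
    then have "swap_state k st s = swap_state k st (k + 1)" "swap_state k st s \<noteq> 0"
      "swap_state k st t = swap_state k st k" "swap_state k st t \<noteq> 0" using * by auto
    then have "s = k + 1" "t = k" using dsw unfolding distinct_state_def by blast+
    with * show False by simp
  qed
  show ?thesis
  proof (cases "0 < st k \<and> st k < st (k + 1)")
    case True
    then have "(st (k + 1), st k) \<notin> inv_pairs st" unfolding inv_pairs_def by auto
    then have "x \<in> inv_pairs (swap_state k st) \<longleftrightarrow> x \<in> insert (st k, st (k + 1)) (inv_pairs st)" for x
      using a1 a2 3 True by (metis insert_iff)
    then show ?thesis using True by auto
  next
    case False
    then have "x \<in> inv_pairs (swap_state k st) \<longleftrightarrow> x \<in> inv_pairs st - {(st (k + 1), st k)}" for x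
      using a1 a2 4 5 False by (metis Diff_iff empty_iff insert_iff)
    then show ?thesis using False by auto
  qed
qed

text \<open>An elbow joins two edges with the same number, and so do both curves of a bump. A
  straight pipe joins edges whose numbers differ by one and changes places with the 0 on the other
  two edges.\<close>

lemma tile_step:
  assumes "(i, j) \<in> grid" "st (i + j) = FL i j" "st (i + j + 1) = FB i j"
  shows "st(i + j := out_top i j, i + j + 1 := out_right i j) =
    (if P i j \<in> {Vert, Horiz} \<or> P i j = Cross \<and> \<not> bump i j then swap_state (i + j) st else st)"
  using assms label_nonzero[of i j]
  by (cases "P i j") (auto simp: grid_def swap_state_def out_top_def out_right_def fun_eq_iff)

text \<open>The assumption on bumps is the conclusion of \<open>bump_iff\<close>; that lemma is
  proved by induction and applies this one to the squares already treated. At a crossing, a sorted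
  pair becomes inverted, and an inverted pair bumps and stays inverted.\<close>

lemma reach_inv_pairs:
  assumes "reach S st" "\<And>i j. (i, j) \<in> S \<Longrightarrow> P i j = Cross \<Longrightarrow> bump i j \<longleftrightarrow> FB i j < FL i j"
  shows "distinct_state st \<and> inv_pairs st = crossings S"
  using assms
proof (induction rule: reach.induct)
  case empty
  have "distinct_state init_state" unfolding distinct_state_def init_state_def by auto
  moreover have "inv_pairs init_state = {}" unfolding inv_pairs_def init_state_def by auto
  ultimately show ?case by (simp add: crossings_def)
next
  case (step S st i j)
  have IH: "distinct_state st" "inv_pairs st = crossings S" using step.IH step.prems by auto
  have ij: "1 \<le> i" "i \<le> n" "1 \<le> j" "j \<le> n" using step.hyps(2) by (auto simp: grid_def)
  have L: "st (i + j) = FL i j" using reach_edges(1)[OF step.hyps(1), of i j] step.hyps ij by auto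
  have B: "st (i + j + 1) = FB i j" using reach_edges(2)[OF step.hyps(1), of i j] step.hyps ij by auto
  have nz: "FB i j \<noteq> 0 \<longleftrightarrow> meets_bottom (P i j)" "FL i j \<noteq> 0 \<longleftrightarrow> meets_left (P i j)"
    using label_nonzero ij by auto
  have "distinct_state (swap_state (i + j) st)" using distinct_state_swap[OF IH(1)] .
  then have d: "distinct_state (st(i + j := out_top i j, i + j + 1 := out_right i j))"
    unfolding tile_step[OF step.hyps(2) L B] using IH(1) by simp
  have ne: "FB i j \<noteq> FL i j" if "P i j = Cross"
  proof
    assume "FB i j = FL i j"
    then have "st (i + j) = st (i + j + 1)" using L B by simp
    from distinct_stateD[OF IH(1) this] show False using L nz that by simp
  qed
  have bp: "P i j = Cross \<Longrightarrow> bump i j \<longleftrightarrow> FB i j < FL i j" using step.prems by auto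
  have "inv_pairs (st(i + j := out_top i j, i + j + 1 := out_right i j)) = crossings (insert (i, j) S)"
    (is "inv_pairs ?st' = _")
  proof (cases "P i j = Cross")
    case cr: True
    show ?thesis
    proof (cases "bump i j")
      case True
      then have "?st' = st" using tile_step[of i j st] step.hyps(2) L B cr by simp
      moreover have "(FB i j, FL i j) \<in> inv_pairs st"
        using bp cr True nz L B by (intro inv_pairsI[of _ "i + j" _ "i + j + 1"]) auto
      ultimately show ?thesis using IH(2) cr True bp crossings_insert[of i j S] by auto
    next
      case False
      then have "?st' = swap_state (i + j) st" using tile_step[of i j st] step.hyps(2) L B cr by simp
      moreover have "FL i j < FB i j" using False bp cr ne by auto
      ultimately show ?thesis using IH cr False bp nz L B crossings_insert[of i j S]
          inv_pairs_swap[OF IH(1), of "i + j"] by auto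
    qed
  next
    case False
    have "inv_pairs (swap_state (i + j) st) = inv_pairs st" if "P i j \<in> {Vert, Horiz}"
    proof -
      have "FL i j = 0 \<or> FB i j = 0" using that nz by auto
      then have ni: "(st (i + j + 1), st (i + j)) \<notin> inv_pairs st"
        and nb: "\<not> (0 < st (i + j) \<and> st (i + j) < st (i + j + 1))"
        unfolding inv_pairs_iff L B by auto
      have "inv_pairs (swap_state (i + j) st) = inv_pairs st - {(st (i + j + 1), st (i + j))}"
        using inv_pairs_swap[OF IH(1), of "i + j"] unfolding if_not_P[OF nb] .
      then show ?thesis using ni by blast
    qed
    then have "inv_pairs ?st' = inv_pairs st"
      using tile_step[of i j st] step.hyps(2) L B False by simp
    then show ?thesis using IH(2) False crossings_insert[of i j S] by auto
  qed
  then show ?case using d by blast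
qed

text \<open>The labels are sorted along the first staircase, and a pair gets inverted exactly at its first
  crossing.\<close>

lemma bump_iff:
  assumes "(i, j) \<in> grid" "P i j = Cross"
  shows "bump i j \<longleftrightarrow> FB i j < FL i j"
  using assms
proof (induction "(n - i) + j" arbitrary: i j rule: less_induct)
  case less
  \<comment> \<open>These are the squares among which \<open>bumps\<close> looks for an earlier
    meeting of the two pipes, and the induction hypothesis covers all crossings among them.\<close>
  let ?S = "{i..n} \<times> {1..j} - {(i, j)}"
  have ij: "1 \<le> i" "i \<le> n" "1 \<le> j" "j \<le> n" using less.prems by (auto simp: grid_def)
  have "sw_closed ?S" using ij unfolding sw_closed_def grid_def by auto
  then obtain st where st: "reach ?S st" using reach_exists by blast
  have "bump i' j' \<longleftrightarrow> FB i' j' < FL i' j'" if "(i', j') \<in> ?S" "P i' j' = Cross" for i' j'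
  proof (rule less.hyps)
    show "(i', j') \<in> grid" using that ij by (auto simp: grid_def)
    have "i' > i \<or> j' < j" using that by auto
    then show "n - i' + j' < n - i + j" using that ij by auto
  qed fact
  from reach_inv_pairs[OF st this] have d: "distinct_state st" and c: "inv_pairs st = crossings ?S" by auto
  have "j = 1 \<or> (i, j - 1) \<in> ?S" using ij by (cases "j = 1") (simp, simp, linarith)
  then have L: "st (i + j) = FL i j" using reach_edges(1)[OF st, of i j] ij by auto
  have "i = n \<or> (i + 1, j) \<in> ?S" using ij by (cases "i = n") (simp, simp)
  then have B: "st (i + j + 1) = FB i j" using reach_edges(2)[OF st, of i j] ij by auto
  have nz: "FB i j \<noteq> 0" "FL i j \<noteq> 0" using label_nonzero ij less.prems by auto
  have ne: "FB i j \<noteq> FL i j"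
    using distinct_stateD[OF d, of "i + j" "i + j + 1"] L B nz by auto
  have "bump i j \<longleftrightarrow> (min (FB i j) (FL i j), max (FB i j) (FL i j)) \<in> crossings ?S"
    using ne by (subst bumps.simps) (force simp: crossings_def doubleton_eq_iff min_def max_def)
  also have "\<dots> \<longleftrightarrow> FB i j < FL i j"
  proof
    assume "(min (FB i j) (FL i j), max (FB i j) (FL i j)) \<in> crossings ?S"
    then obtain s t where s: "s < t" "st s = max (FB i j) (FL i j)" "st t = min (FB i j) (FL i j)"
      unfolding c[symmetric] inv_pairs_iff by blast
    show "FB i j < FL i j"
    proof (rule ccontr)
      assume "\<not> FB i j < FL i j"
      then have "st s = st (i + j + 1)" "st t = st (i + j)" using s L B by auto
      then have "s = i + j + 1" "t = i + j"
        using distinct_stateD[OF d, of s "i + j + 1"] distinct_stateD[OF d, of t "i + j"] L B nz by auto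
      with s show False by simp
    qed
  next
    assume "FB i j < FL i j"
    then show "(min (FB i j) (FL i j), max (FB i j) (FL i j)) \<in> crossings ?S"
      unfolding c[symmetric] using nz L B by (intro inv_pairsI[of _ "i + j" _ "i + j + 1"]) auto
  qed
  finally show ?case .
qed

lemma reach_state:
  assumes "reach S st"
  shows "distinct_state st" "inv_pairs st = crossings S"
  using reach_inv_pairs[OF assms] bump_iff reach_grid[OF assms] by blast+

lemma crossings_mono: "S \<subseteq> T \<Longrightarrow> crossings S \<subseteq> crossings T"
  unfolding crossings_def by blast

lemma sw_closed_grid: "sw_closed grid"
  unfolding sw_closed_def grid_def by auto

text \<open>Without bumps, the pipe from the left has the smaller label at every crossing, so the
  pair is not yet inverted there and each crossing adds a new inverted pair.\<close>

lemma crossing_count: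
  assumes "reach S st" "\<And>i j. (i, j) \<in> grid \<Longrightarrow> P i j = Cross \<Longrightarrow> \<not> bump i j"
  shows "finite (inv_pairs st) \<and> card {(i, j) \<in> S. P i j = Cross} = card (inv_pairs st)"
  using assms
proof (induction rule: reach.induct)
  case empty
  have "inv_pairs init_state = {}" unfolding inv_pairs_def init_state_def by auto
  then show ?case by simp
next
  case (step S st i j)
  have IH: "finite (inv_pairs st)" "card {(i, j) \<in> S. P i j = Cross} = card (inv_pairs st)"
    using step by auto
  have ij: "1 \<le> i" "i \<le> n" "1 \<le> j" "j \<le> n" using step.hyps(2) by (auto simp: grid_def)
  have L: "st (i + j) = FL i j" using reach_edges(1)[OF step.hyps(1), of i j] step.hyps ij by auto
  have B: "st (i + j + 1) = FB i j" using reach_edges(2)[OF step.hyps(1), of i j] step.hyps ij by auto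
  have nz: "FB i j \<noteq> 0 \<longleftrightarrow> meets_bottom (P i j)" "FL i j \<noteq> 0 \<longleftrightarrow> meets_left (P i j)"
    using label_nonzero ij by auto
  note d = reach_state[OF step.hyps(1)]
  note d' = reach_state(2)[OF reach.step[OF step.hyps(1-5)]]
  have finS: "finite {(i, j) \<in> S. P i j = Cross}"
    by (rule finite_subset[OF _ reach_grid(2)[OF step.hyps(1)]]) auto
  have s: "{(i', j') \<in> insert (i, j) S. P i' j' = Cross} =
    (if P i j = Cross then insert (i, j) {(i, j) \<in> S. P i j = Cross} else {(i, j) \<in> S. P i j = Cross})"
    by auto
  show ?case
  proof (cases "P i j = Cross")
    case True
    have "FB i j \<noteq> FL i j"
      using distinct_stateD[OF d(1), of "i + j" "i + j + 1"] L B nz True by auto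
    then have lt: "FL i j < FB i j" using bump_iff[OF step.hyps(2) True] step.prems step.hyps(2) True by auto
    have "(FL i j, FB i j) \<notin> inv_pairs st"
    proof
      assume "(FL i j, FB i j) \<in> inv_pairs st"
      then obtain s t where *: "s < t" "st s = FB i j" "st t = FL i j" unfolding inv_pairs_iff by blast
      then have "s = i + j + 1" "t = i + j"
        using distinct_stateD[OF d(1), of s "i + j + 1"] distinct_stateD[OF d(1), of t "i + j"] L B nz True by auto
      with * show False by simp
    qed
    moreover have "crossings (insert (i, j) S) = insert (FL i j, FB i j) (inv_pairs st)"
      using crossings_insert[of i j S] d lt True by auto
    ultimately show ?thesis unfolding d' s using IH True finS step.hyps(3) by auto
  next
    case False
    then have "crossings (insert (i, j) S) = inv_pairs st" using crossings_insert[of i j S] d by auto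
    then show ?thesis unfolding d' s using IH False by simp
  qed
qed

end

section \<open>Paths through the complementary tiling\<close>

text \<open>Reflection in the main diagonal: bottom and right edges change places, as do left and
  top edges, and each elbow is symmetric. It carries statements about the tiles of a row over to
  columns; labels are not transferred this way.\<close>

fun transpose_tile :: "tile \<Rightarrow> tile" where
  "transpose_tile Vert = Horiz"
| "transpose_tile Horiz = Vert"
| "transpose_tile t = t"

lemma meets_transpose [simp]:
  "meets_left (transpose_tile t) \<longleftrightarrow> meets_top t"
  "meets_top (transpose_tile t) \<longleftrightarrow> meets_left t"
  "meets_right (transpose_tile t) \<longleftrightarrow> meets_bottom t"
  "meets_bottom (transpose_tile t) \<longleftrightarrow> meets_right t"
  by (cases t; simp)+

lemma transpose_tile_eq [simp]:
  "transpose_tile t = Up_Elbow \<longleftrightarrow> t = Up_Elbow"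
  "transpose_tile t = Down_Elbow \<longleftrightarrow> t = Down_Elbow"
  "transpose_tile t = Cross \<longleftrightarrow> t = Cross"
  by (cases t; simp)+

abbreviation transpose_bpd :: "(nat \<Rightarrow> nat \<Rightarrow> tile) \<Rightarrow> nat \<Rightarrow> nat \<Rightarrow> tile" where
  "transpose_bpd P \<equiv> \<lambda>i j. transpose_tile (P j i)"

text \<open>The path that follows the vertical edges met by a pipe downwards, and the horizontal
  edges not met by a pipe to the right; \<open>d\<close> says whether it enters square \<open>(i, j)\<close> from above or
  from the left. The value is the column in which the path reaches the bottom. For the
  transposed tiling one gets the row in which the path along the horizontal pipe edges and the
  unused vertical edges reaches the right end.\<close>

function co_end :: "nat \<Rightarrow> (nat \<Rightarrow> nat \<Rightarrow> tile) \<Rightarrow> bool \<Rightarrow> nat \<Rightarrow> nat \<Rightarrow> nat" where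
  "co_end n P d i j =
     (if i > n \<or> j > n then j
      else if (if d then P i j \<noteq> Up_Elbow else P i j = Down_Elbow) then co_end n P True (i + 1) j
      else co_end n P False i (j + 1))"
  by pat_completeness auto
termination by (relation "measure (\<lambda>(n, P, d, i, j). (n + 1 - i) + (n + 1 - j))") auto

declare co_end.simps [simp del]

context bpd
begin

lemma bpd_transpose: "bpd n (transpose_bpd P)"
  using bpd unfolding bpd_def bumpless_pipe_dream_def by simp

text \<open>The edge through which the path enters: a met top edge or an unmet left edge. The value
  \<open>i = n + 1\<close> stands for a path that has left through the bottom. Since all edges on
  the right side of the grid are met, \<open>j\<close> never exceeds \<open>n\<close>.\<close>

definition legit :: "bool \<Rightarrow> nat \<Rightarrow> nat \<Rightarrow> bool" where
  "legit d i j \<longleftrightarrow> 1 \<le> i \<and> i \<le> n + 1 \<and> 1 \<le> j \<and> j \<le> n \<and>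
     (if d then i = n + 1 \<or> meets_top (P i j) else i \<le> n \<and> \<not> meets_left (P i j))"

definition turns_down :: "bool \<Rightarrow> nat \<Rightarrow> nat \<Rightarrow> bool" where
  "turns_down d i j \<longleftrightarrow> (if d then P i j \<noteq> Up_Elbow else P i j = Down_Elbow)"

lemma co_end_step: "i \<le> n \<Longrightarrow> j \<le> n \<Longrightarrow>
  co_end n P d i j = (if turns_down d i j then co_end n P True (i + 1) j else co_end n P False i (j + 1))"
  by (subst co_end.simps) (simp add: turns_down_def)

lemma co_end_final: "co_end n P d (n + 1) j = j"
  by (subst co_end.simps) simp

lemma co_step_legit:
  assumes "legit d i j" "i \<le> n"
  shows "turns_down d i j \<Longrightarrow> legit True (i + 1) j" "\<not> turns_down d i j \<Longrightarrow> legit False i (j + 1)"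
proof -
  have ij: "1 \<le> i" "i \<le> n" "1 \<le> j" "j \<le> n" using assms by (auto simp: legit_def)
  { assume "turns_down d i j"
    then have "meets_bottom (P i j)" using assms by (cases "P i j") (auto simp: legit_def turns_down_def split: if_splits)
    then show "legit True (i + 1) j" using ij bottom_top[of i j] by (cases "i = n") (auto simp: legit_def) }
  { assume "\<not> turns_down d i j"
    then have "\<not> meets_right (P i j)" using assms by (cases "P i j") (auto simp: legit_def turns_down_def split: if_splits)
    then show "legit False i (j + 1)" using ij right_left[of i j] right_edge[of i] by (cases "j = n") (auto simp: legit_def) }
qed

lemma legit_True_final: "legit d (n + 1) j \<Longrightarrow> d"
  by (auto simp: legit_def split: if_splits)

text \<open>Each step raises \<open>i + j\<close> by one until the path stands at row
  \<open>n + 1\<close> in its final column. This separates a path that has ended from one that is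
  still inside the grid.\<close>

lemma co_end_level: "legit d i j \<Longrightarrow> i + j \<le> n + 1 + co_end n P d i j \<and> (i \<le> n \<longrightarrow> i + j < n + 1 + co_end n P d i j)"
proof (induction "2 * n + 2 - (i + j)" arbitrary: d i j rule: less_induct)
  case less
  then have r: "i \<le> n + 1" "j \<le> n" by (auto simp: legit_def)
  show ?case
  proof (cases "i = n + 1")
    case True then show ?thesis using co_end_final by simp
  next
    case False
    with r have i: "i \<le> n" by simp
    have m: "2 * n + 2 - (i + 1 + j) < 2 * n + 2 - (i + j)" "2 * n + 2 - (i + (j + 1)) < 2 * n + 2 - (i + j)"
      using i r by linarith+
    show ?thesis
    proof (cases "turns_down d i j")
      case True
      then show ?thesis using less.hyps[OF m(1), of True] co_step_legit(1)[OF less.prems i] co_end_step[of i j d] i r by auto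
    next
      case False
      then show ?thesis using less.hyps[OF m(2), of False] co_step_legit(2)[OF less.prems i] co_end_step[of i j d] i r by auto
    qed
  qed
qed

text \<open>Paths can be traced backwards: two paths through one square leave it through different
  edges, so paths on the same level never merge.\<close>

lemma co_end_inj:
  assumes "legit d i j" "legit d' i' j'" "i + j = i' + j'" "co_end n P d i j = co_end n P d' i' j'"
  shows "d = d' \<and> i = i' \<and> j = j'"
  using assms
proof (induction "2 * n + 2 - (i + j)" arbitrary: d i j d' i' j' rule: less_induct)
  case less
  have r: "i \<le> n + 1" "j \<le> n" "i' \<le> n + 1" "j' \<le> n" using less.prems by (auto simp: legit_def)
  consider "i = n + 1" "i' = n + 1" | "i = n + 1" "i' \<le> n" | "i \<le> n" "i' = n + 1" | "i \<le> n" "i' \<le> n"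
    using r by linarith
  then show ?case
  proof cases
    case 1
    then show ?thesis using less.prems legit_True_final[of d j] legit_True_final[of d' j'] by auto
  next
    case 2
    then show ?thesis using co_end_level[OF less.prems(2)] co_end_final[of d j] less.prems by auto
  next
    case 3
    then show ?thesis using co_end_level[OF less.prems(1)] co_end_final[of d' j'] less.prems by auto
  next
    case 4
    define nx where "nx = (\<lambda>d i j. if turns_down d i j then (True, i + 1, j) else (False, i, j + 1))"
    obtain e k l where e: "nx d i j = (e, k, l)" by (metis prod_cases3)
    obtain e' k' l' where e': "nx d' i' j' = (e', k', l')" by (metis prod_cases3)
    have "legit e k l" "legit e' k' l'"
      using e e' co_step_legit[OF less.prems(1) 4(1)] co_step_legit[OF less.prems(2) 4(2)]
      by (auto simp: nx_def split: if_splits)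
    moreover have "co_end n P e k l = co_end n P d i j" "co_end n P e' k' l' = co_end n P d' i' j'"
      using e e' co_end_step[OF 4(1) r(2)] co_end_step[OF 4(2) r(4)] by (auto simp: nx_def split: if_splits)
    moreover have "k + l = i + j + 1" "k' + l' = i' + j' + 1" using e e' by (auto simp: nx_def split: if_splits)
    moreover have "2 * n + 2 - (i + j + 1) < 2 * n + 2 - (i + j)" using 4 r by linarith
    ultimately have eq: "e = e' \<and> k = k' \<and> l = l'"
      using less.hyps[of k l e e' k' l'] less.prems by metis
    then have "i = i'" "j = j'" and td: "turns_down d i j \<longleftrightarrow> turns_down d' i j" using e e' by (auto simp: nx_def split: if_splits)
    moreover have "d = d'"
    proof (rule ccontr)
      assume "d \<noteq> d'"
      then show False using td less.prems(1,2) 4 \<open>i = i'\<close> \<open>j = j'\<close>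
        by (cases "P i j") (auto simp: legit_def turns_down_def split: if_splits)
    qed
    ultimately show ?thesis by simp
  qed
qed

text \<open>The path of the earlier state reaches the level of the later one and, having the same
  end, must coincide with it there; paths move only down and to the right.\<close>

lemma co_end_eq_imp_le:
  assumes "legit d i j" "legit d' i' j'" "i + j \<le> i' + j'" "co_end n P d i j = co_end n P d' i' j'"
  shows "i \<le> i' \<and> j \<le> j'"
  using assms
proof (induction "i' + j' - (i + j)" arbitrary: d i j rule: less_induct)
  case less
  show ?case
  proof (cases "i + j = i' + j'")
    case True
    then show ?thesis using co_end_inj[OF less.prems(1,2) True less.prems(4)] by simp
  next
    case False
    have r: "i \<le> n + 1" "j \<le> n" using less.prems by (auto simp: legit_def)
    have "i \<noteq> n + 1"
      using False co_end_level[OF less.prems(2)] co_end_final[of d j] less.prems(3,4) by auto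
    then have i: "i \<le> n" using r by simp
    have m: "i' + j' - (i + 1 + j) < i' + j' - (i + j)" "i' + j' - (i + (j + 1)) < i' + j' - (i + j)"
      using False less.prems(3) by linarith+
    show ?thesis
    proof (cases "turns_down d i j")
      case True
      then show ?thesis using less.hyps[OF m(1), of True] co_step_legit(1)[OF less.prems(1) i] co_end_step[OF i r(2), of d] less.prems False by auto
    next
      case F: False
      then show ?thesis using less.hyps[OF m(2), of False] co_step_legit(2)[OF less.prems(1) i] co_end_step[OF i r(2), of d] less.prems False by auto
    qed
  qed
qed

text \<open>An unmet edge continues to the right through vertical and blank tiles. Since the last
  edge of the row is met, a down-elbow must stop it.\<close>

lemma next_down_elbow:
  assumes "i \<in> {1..n}" "1 \<le> j" "j \<le> n" "\<not> meets_left (P i j)"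
  shows "\<exists>k. j \<le> k \<and> k \<le> n \<and> P i k = Down_Elbow \<and> co_end n P False i j = co_end n P True (i + 1) k"
  using assms
proof (induction "n - j" arbitrary: j rule: less_induct)
  case less
  show ?case
  proof (cases "P i j = Down_Elbow")
    case True
    then show ?thesis using co_end_step[of i j False] less.prems by (auto simp: turns_down_def)
  next
    case False
    then have nr: "\<not> meets_right (P i j)" using less.prems by (cases "P i j") auto
    then have "j < n" using right_edge[of i] less.prems by (cases "j = n") auto
    then have "\<not> meets_left (P i (j + 1))" using right_left[of i j] less.prems nr by auto
    then obtain k where "j + 1 \<le> k" "k \<le> n" "P i k = Down_Elbow" "co_end n P False i (j + 1) = co_end n P True (i + 1) k"
      using less.hyps[of "j + 1"] \<open>j < n\<close> less.prems by (auto simp: diff_less_mono2)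
    then show ?thesis using co_end_step[of i j False] less.prems False by (auto simp: turns_down_def intro!: exI[of _ k])
  qed
qed

lemma up_elbow_next:
  assumes "(a, b) \<in> grid" "P a b = Up_Elbow"
  shows "a \<in> {1..n}" "b < n" "1 \<le> b" "\<not> meets_left (P a (b + 1))" "legit False a (b + 1)"
proof -
  show ab: "a \<in> {1..n}" "1 \<le> b" using assms by (auto simp: grid_def)
  have "b \<noteq> n" using right_edge[of a] assms ab by auto
  then show bn: "b < n" using assms by (auto simp: grid_def)
  then show nl: "\<not> meets_left (P a (b + 1))" using right_left[of a b] ab assms by auto
  then show "legit False a (b + 1)" using ab bn by (auto simp: legit_def)
qed

interpretation T: bpd n "transpose_bpd P" by (rule bpd_transpose)

text \<open>The two paths start with the first one to the upper right of the second one, but the first one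
  ends at the bottom and the second one at the right; in the square where they meet, they enter from
  above and from the left, and unless it is a crossing they separate again on the same sides.\<close>

lemma co_paths_cross:
  assumes "legit d i j" "T.legit e l k" "i + j = k + l" "i < k \<or> i = k \<and> d \<and> e"
  shows "\<exists>x y. i \<le> x \<and> x \<le> n \<and> l \<le> y \<and> y \<le> n \<and> P x y = Cross \<and>
    co_end n P True (x + 1) y = co_end n P d i j \<and>
    co_end n (transpose_bpd P) True (y + 1) x = co_end n (transpose_bpd P) e l k"
  using assms
proof (induction "2 * n + 2 - (i + j)" arbitrary: d i j e k l rule: less_induct)
  case less
  have r: "1 \<le> i" "1 \<le> j" "j \<le> n" "1 \<le> k" "k \<le> n" "1 \<le> l" "l \<le> n + 1" "i \<le> n + 1"
    using less.prems by (auto simp: legit_def T.legit_def)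
  \<comment> \<open>The first path cannot leave through the right side nor the second through the
    bottom. Hence \<open>i \<le> k \<le> n\<close> and \<open>l \<le> j \<le> n\<close>, both paths
    are still in the grid, and the induction can end only at a crossing.\<close>
  have i: "i \<le> n" using r less.prems by linarith
  have l: "l \<le> n" using r less.prems by linarith
  note cs = co_step_legit[OF less.prems(1) i] and ce = co_end_step[OF i r(3), of d]
  note ds = T.co_step_legit[OF less.prems(2) l] and de = T.co_end_step[OF l r(5), of e]
  show ?case
  proof (cases "i = k \<and> P i j = Cross")
    case True
    then have lj: "l = j" "d" "e" using less.prems by auto
    show ?thesis
      by (rule exI[of _ i], rule exI[of _ j])
        (use lj True ce de r i in \<open>auto simp: turns_down_def T.turns_down_def\<close>)
  next
    case nc: False
    define i1 j1 where "i1 = (if turns_down d i j then i + 1 else i)" and "j1 = (if turns_down d i j then j else j + 1)"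
    define d1 where "d1 = turns_down d i j"
    define l1 k1 where "l1 = (if T.turns_down e l k then l + 1 else l)" and "k1 = (if T.turns_down e l k then k else k + 1)"
    define e1 where "e1 = T.turns_down e l k"
    have "legit d1 i1 j1" using cs by (auto simp: d1_def i1_def j1_def)
    moreover have "T.legit e1 l1 k1" using ds by (auto simp: e1_def l1_def k1_def)
    moreover have "i1 + j1 = k1 + l1" using less.prems by (auto simp: i1_def j1_def k1_def l1_def)
    moreover have "i1 < k1 \<or> i1 = k1 \<and> d1 \<and> e1"
    proof (cases "i < k")
      case True
      then show ?thesis by (auto simp: i1_def k1_def d1_def e1_def)
    next
      case False
      then have same: "i = k" "j = l" "d" "e" using less.prems by auto
      then have "P i j = Up_Elbow" using less.prems(1,2) nc i l
        by (cases "P i j") (auto simp: legit_def T.legit_def)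
      then show ?thesis using same by (auto simp: i1_def k1_def turns_down_def T.turns_down_def)
    qed
    moreover have m: "2 * n + 2 - (i1 + j1) < 2 * n + 2 - (i + j)" using i r by (auto simp: i1_def j1_def)
    ultimately obtain x y where xy: "i1 \<le> x" "x \<le> n" "l1 \<le> y" "y \<le> n" "P x y = Cross"
      "co_end n P True (x + 1) y = co_end n P d1 i1 j1"
      "co_end n (transpose_bpd P) True (y + 1) x = co_end n (transpose_bpd P) e1 l1 k1"
      using less.hyps[of i1 j1 d1 e1 l1 k1] m by blast
    moreover have "i \<le> i1" "l \<le> l1" by (auto simp: i1_def l1_def)
    moreover have "co_end n P d1 i1 j1 = co_end n P d i j" using ce by (auto simp: d1_def i1_def j1_def)
    moreover have "co_end n (transpose_bpd P) e1 l1 k1 = co_end n (transpose_bpd P) e l k"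
      using de by (auto simp: e1_def l1_def k1_def)
    ultimately have "i \<le> x \<and> x \<le> n \<and> l \<le> y \<and> y \<le> n \<and> P x y = Cross \<and>
      co_end n P True (x + 1) y = co_end n P d i j \<and>
      co_end n (transpose_bpd P) True (y + 1) x = co_end n (transpose_bpd P) e l k" by simp
    then show ?thesis by blast
  qed
qed

lemma up_elbow_cross:
  assumes "(a, b) \<in> grid" "P a b = Up_Elbow"
  obtains x y where "a \<le> x" "x \<le> n" "b \<le> y" "y \<le> n" "P x y = Cross"
    "co_end n P True (x + 1) y = co_end n P False a (b + 1)"
    "co_end n (transpose_bpd P) True (y + 1) x = co_end n (transpose_bpd P) False b (a + 1)"
proof -
  have "(b, a) \<in> T.grid" using assms by (auto simp: grid_def T.grid_def)
  then have "T.legit False b (a + 1)" using T.up_elbow_next[of b a] assms by simp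
  from co_paths_cross[OF up_elbow_next(5)[OF assms] this] show ?thesis using that by auto
qed

lemma next_down_elbow_col:
  assumes "(a, b) \<in> grid" "P a b = Up_Elbow"
  obtains r where "a < r" "r \<le> n" "P r b = Down_Elbow"
    "co_end n (transpose_bpd P) False b (a + 1) = co_end n (transpose_bpd P) True (b + 1) r"
proof -
  have g: "(b, a) \<in> T.grid" using assms by (auto simp: grid_def T.grid_def)
  note u = T.up_elbow_next[OF g]
  have "a + 1 \<le> n" using u(2) assms by simp
  from T.next_down_elbow[of b "a + 1"] u assms this obtain k where
    "a + 1 \<le> k" "k \<le> n" "P k b = Down_Elbow" "co_end n (transpose_bpd P) False b (a + 1) = co_end n (transpose_bpd P) True (b + 1) k"
    by auto
  then show ?thesis using that[of k] by simp
qed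

lemma next_down_elbow_row:
  assumes "(a, b) \<in> grid" "P a b = Up_Elbow"
  obtains c where "b < c" "c \<le> n" "P a c = Down_Elbow" "co_end n P False a (b + 1) = co_end n P True (a + 1) c"
proof -
  note u = up_elbow_next[OF assms]
  have "b + 1 \<le> n" using u(2) by simp
  from next_down_elbow[OF u(1) _ this u(4)] obtain k where
    "b + 1 \<le> k" "k \<le> n" "P a k = Down_Elbow" "co_end n P False a (b + 1) = co_end n P True (a + 1) k"
    by auto
  then show ?thesis using that[of k] by simp
qed

lemma co_end_transpose_eq_imp_le:
  assumes "(a, b) \<in> grid" "P a b = Up_Elbow" "(a', b') \<in> grid" "P a' b' = Up_Elbow" "a + b \<le> a' + b'"
    "co_end n (transpose_bpd P) False b (a + 1) = co_end n (transpose_bpd P) False b' (a' + 1)"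
  shows "a \<le> a' \<and> b \<le> b'"
proof -
  have "(b, a) \<in> T.grid" "(b', a') \<in> T.grid" using assms by (auto simp: grid_def T.grid_def)
  then have "T.legit False b (a + 1)" "T.legit False b' (a' + 1)" using T.up_elbow_next(5) assms by auto
  from T.co_end_eq_imp_le[OF this] show ?thesis using assms by auto
qed

lemma co_end_transpose_final: "co_end n (transpose_bpd P) d (n + 1) j = j"
  by (rule T.co_end_final)

lemma co_end_transpose_step: "i \<le> n \<Longrightarrow> j \<le> n \<Longrightarrow>
  co_end n (transpose_bpd P) True j i = (if P i j \<noteq> Up_Elbow then co_end n (transpose_bpd P) True (j + 1) i
     else co_end n (transpose_bpd P) False j (i + 1))"
  using T.co_end_step[of j i True] by (simp add: T.turns_down_def)

end

section \<open>Pipes and their exits\<close>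

locale bpd_perm = bpd +
  fixes w :: "nat \<Rightarrow> nat"
  assumes perm: "w permutes {1..n}"
    and exits: "r \<in> {1..n} \<Longrightarrow> FL r (n + 1) = w r"
begin

abbreviation v :: "nat \<Rightarrow> nat" where "v \<equiv> inv w"

lemma v_w [simp]: "v (w r) = r" and w_v [simp]: "w (v r) = r"
  using permutes_inverses[OF perm] by auto

lemma v_range: "l \<in> {1..n} \<Longrightarrow> v l \<in> {1..n}"
  using permutes_in_image[OF permutes_inv[OF perm]] by blast

lemma w_range: "r \<in> {1..n} \<Longrightarrow> w r \<in> {1..n}"
  using permutes_in_image[OF perm] by blast

lemma v_inj: "v l = v m \<Longrightarrow> l = m"
  by (metis w_v)

text \<open>The last staircase runs along the top and then down the right side, where number
  \<open>r + n + 1\<close> is the exit of row \<open>r\<close>. Thereby the pairs meeting at some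
  crossing tile become the inversions of \<open>w\<close>.\<close>

lemma full_state: "\<exists>st. reach grid st \<and> (\<forall>l \<in> {1..n}. st (v l + n + 1) = l)"
proof -
  obtain st where st: "reach grid st" using reach_exists[OF sw_closed_grid] by blast
  have "st (v l + n + 1) = l" if "l \<in> {1..n}" for l
  proof -
    have "v l \<in> {1..n}" using v_range that by blast
    then have "st (v l + (n + 1)) = FL (v l) (n + 1)"
      by (intro reach_edges(1)[OF st]) (auto simp: grid_def)
    then show ?thesis using exits[OF \<open>v l \<in> {1..n}\<close>] by (simp add: add.assoc)
  qed
  with st show ?thesis by blast
qed

lemma label_range:
  "i \<in> {1..n} \<Longrightarrow> j \<in> {1..n} \<Longrightarrow> FB i j \<noteq> 0 \<Longrightarrow> FB i j \<in> {1..n}"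
  "i \<in> {1..n} \<Longrightarrow> j \<in> {1..n} \<Longrightarrow> FL i j \<noteq> 0 \<Longrightarrow> FL i j \<in> {1..n}"
  using label_bounds[of i j] by auto

lemma crossings_inverted:
  assumes "(l, m) \<in> crossings grid"
  shows "l \<in> {1..n}" "m \<in> {1..n}" "l < m" "v m < v l"
proof -
  obtain i j where ij: "(i, j) \<in> grid" "P i j = Cross" "{FB i j, FL i j} = {l, m}" and lm: "l < m"
    using assms unfolding crossings_def by auto
  then have "FB i j \<in> {1..n}" "FL i j \<in> {1..n}"
    using label_range[of i j] label_nonzero[of i j] by (auto simp: grid_def)
  then show r: "l \<in> {1..n}" "m \<in> {1..n}" "l < m" using ij lm by (auto simp: doubleton_eq_iff)
  obtain st where st: "reach grid st" "\<And>l. l \<in> {1..n} \<Longrightarrow> st (v l + n + 1) = l" using full_state by blast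
  then have "(l, m) \<in> inv_pairs st" using assms reach_state(2) by simp
  then obtain s t where *: "s < t" "st s = m" "st t = l" unfolding inv_pairs_iff by blast
  have "s = v m + n + 1" "t = v l + n + 1"
    using distinct_stateD[OF reach_state(1)[OF st(1)], of s "v m + n + 1"]
      distinct_stateD[OF reach_state(1)[OF st(1)], of t "v l + n + 1"] st(2) r * by auto
  with * show "v m < v l" by simp
qed

lemma inverted_crossings:
  assumes "l \<in> {1..n}" "m \<in> {1..n}" "l < m" "v m < v l"
  shows "(l, m) \<in> crossings grid"
proof -
  obtain st where st: "reach grid st" "\<And>l. l \<in> {1..n} \<Longrightarrow> st (v l + n + 1) = l" using full_state by blast
  have "(l, m) \<in> inv_pairs st"
    using assms st(2) by (intro inv_pairsI[of _ "v m + n + 1" _ "v l + n + 1"]) auto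
  then show ?thesis using reach_state(2)[OF st(1)] by simp
qed

text \<open>The two edges lie on a common staircase, and an inverted pair of labels on it stays
  inverted until the exits.\<close>

lemma label_order:
  assumes "1 \<le> i" "i \<le> i'" "i' \<le> n" "1 \<le> j" "j \<le> j'" "j' \<le> n" "FL i j \<noteq> 0" "FB i' j' \<noteq> 0"
  shows "FL i j \<noteq> FB i' j'" "FL i j < FB i' j' \<or> v (FL i j) < v (FB i' j')"
proof -
  \<comment> \<open>Its boundary comes down the left side of column \<open>j\<close> from row
    \<open>i\<close> on and then follows the bottom of row \<open>i'\<close> to the right, so it
    contains both edges.\<close>
  let ?S = "{(r, c) \<in> grid. i \<le> r \<and> c < j \<or> i' < r}"
  have "sw_closed ?S" unfolding sw_closed_def grid_def by auto
  then obtain st where st: "reach ?S st" using reach_exists by blast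
  have "j = 1 \<or> (i, j - 1) \<in> ?S" using assms by (cases "j = 1") (simp, simp add: grid_def, linarith)
  then have L: "st (i + j) = FL i j" using assms by (intro reach_edges(1)[OF st]) auto
  have "i' = n \<or> (i' + 1, j') \<in> ?S" using assms by (cases "i' = n") (simp, simp add: grid_def)
  then have B: "st (i' + j' + 1) = FB i' j'" using assms by (intro reach_edges(2)[OF st]) auto
  show ne: "FL i j \<noteq> FB i' j'"
    using distinct_stateD[OF reach_state(1)[OF st], of "i + j" "i' + j' + 1"] L B assms by auto
  show "FL i j < FB i' j' \<or> v (FL i j) < v (FB i' j')"
  proof (rule disjCI)
    assume "\<not> v (FL i j) < v (FB i' j')"
    show "FL i j < FB i' j'"
    proof (rule ccontr)
      assume "\<not> FL i j < FB i' j'"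
      then have "(FB i' j', FL i j) \<in> inv_pairs st"
        using ne assms L B by (intro inv_pairsI[of _ "i + j" _ "i' + j' + 1"]) auto
      then have "(FB i' j', FL i j) \<in> crossings grid"
        using reach_state(2)[OF st] crossings_mono[OF reach_grid(1)[OF st]] by auto
      from crossings_inverted(4)[OF this] \<open>\<not> v (FL i j) < v (FB i' j')\<close> show False by simp
    qed
  qed
qed

lemma cross_inverted:
  assumes "(i, j) \<in> grid" "P i j = Cross" "FL i j < FB i j"
  shows "v (FB i j) < v (FL i j)"
proof -
  have "(FL i j, FB i j) \<in> crossings grid" using assms unfolding crossings_def by auto
  from crossings_inverted(4)[OF this] show ?thesis .
qed

lemma top_row: "FB 0 j = 0" if "j \<in> {1..n}"
proof -
  have "n > 0" "\<not> meets_top (P 1 j)" using that top_edge[of j] by auto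
  then show ?thesis using FB_up[of 0 j] by (cases "P 1 j") (auto simp: out_top_def)
qed

lemma pipe_continues:
  assumes "(i, j) \<in> grid" "l \<noteq> 0" "FB i j = l \<or> FL i j = l"
  shows "FB (i - 1) j = l \<or> FL i (j + 1) = l"
proof -
  have "FB (i - 1) j = out_top i j" using FB_up[of "i - 1" j] assms by (auto simp: grid_def)
  moreover have "FL i (j + 1) = out_right i j" using FL_right[of j i] assms by (auto simp: grid_def)
  moreover have "FB i j \<noteq> 0 \<longleftrightarrow> meets_bottom (P i j)" "FL i j \<noteq> 0 \<longleftrightarrow> meets_left (P i j)"
    using label_nonzero[of i j] assms by (auto simp: grid_def)
  ultimately show ?thesis using assms by (cases "P i j") (auto simp: out_top_def out_right_def)
qed

lemma exit_bound:
  "i \<le> n \<Longrightarrow> j \<in> {1..n} \<Longrightarrow> FB i j \<noteq> 0 \<Longrightarrow> v (FB i j) \<le> i"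
  "i \<in> {1..n} \<Longrightarrow> j \<in> {1..n + 1} \<Longrightarrow> FL i j \<noteq> 0 \<Longrightarrow> v (FL i j) \<le> i"
proof (induction "i + (n + 1 - j)" arbitrary: i j rule: less_induct)
  case less
  { case 1
    show ?case
    proof (cases "i = 0")
      case False
      with 1 have "(i, j) \<in> grid" by (auto simp: grid_def)
      from pipe_continues[OF this 1(3)] consider "FB (i - 1) j = FB i j" | "FL i (j + 1) = FB i j" by auto
      then show ?thesis
      proof cases
        case a: 1
        have "v (FB (i - 1) j) \<le> i - 1" using less(1)[of "i - 1" j] 1 False a by auto
        then show ?thesis using a by simp
      next
        case 2
        have m: "i + (n + 1 - (j + 1)) < i + (n + 1 - j)" using 1 by auto
        show ?thesis using less(2)[OF m] 2 1 False by auto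
      qed
    qed (use 1 top_row in auto)
  next
    case 2
    show ?case
    proof (cases "j = n + 1")
      case True then show ?thesis using exits[of i] 2 by auto
    next
      case False
      with 2 have g: "(i, j) \<in> grid" by (auto simp: grid_def)
      from pipe_continues[OF this 2(3)] consider "FB (i - 1) j = FL i j" | "FL i (j + 1) = FL i j" by auto
      then show ?thesis
      proof cases
        case 1
        have "v (FB (i - 1) j) \<le> i - 1" using less(1)[of "i - 1" j] 2 False 1 by auto
        then show ?thesis using 1 by simp
      next
        case a: 2
        have m: "i + (n + 1 - (j + 1)) < i + (n + 1 - j)" using g by (auto simp: grid_def)
        show ?thesis using less(2)[OF m] 2 a g by (auto simp: grid_def)
      qed
    qed }
qed

text \<open>Without bumps, the second path runs along with the pipe until the pipe exits or turns
  upwards, and from there it is the path that starts at this up-elbow. So an up-elbow inherits its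
  ends from other up-elbows farther to the lower right.\<close>

lemma follow_right:
  assumes "i \<in> {1..n}" "j \<in> {1..n + 1}" "FL i j \<noteq> 0"
    "\<And>c. j \<le> c \<Longrightarrow> c \<le> n \<Longrightarrow> P i c = Cross \<Longrightarrow> \<not> bump i c"
  shows "(FL i j = w i \<and> co_end n (transpose_bpd P) True j i = i) \<or>
    (\<exists>c. j \<le> c \<and> c \<le> n \<and> P i c = Up_Elbow \<and> FL i c = FL i j \<and>
      co_end n (transpose_bpd P) True j i = co_end n (transpose_bpd P) False c (i + 1))"
  using assms
proof (induction "n + 1 - j" arbitrary: j rule: less_induct)
  case less
  show ?case
  proof (cases "j = n + 1")
    case True
    then show ?thesis using exits[of i] less.prems co_end_transpose_final by auto
  next
    case False
    then have j: "j \<in> {1..n}" using less.prems by auto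
    have ml: "meets_left (P i j)" using label_nonzero(2)[of i j] less.prems j by auto
    show ?thesis
    proof (cases "P i j = Up_Elbow")
      case True
      then show ?thesis using j co_end_transpose_step[of i j] less.prems(1) by auto
    next
      case ne: False
      then have eq: "FL i (j + 1) = FL i j"
        using ml FL_right[of j i] j less.prems(4)[of j] by (cases "P i j") (auto simp: out_right_def)
      have ce: "co_end n (transpose_bpd P) True j i = co_end n (transpose_bpd P) True (j + 1) i"
        using co_end_transpose_step[of i j] ne j less.prems(1) by auto
      have m: "n + 1 - (j + 1) < n + 1 - j" using j by auto
      have "(FL i (j + 1) = w i \<and> co_end n (transpose_bpd P) True (j + 1) i = i) \<or>
        (\<exists>c. j + 1 \<le> c \<and> c \<le> n \<and> P i c = Up_Elbow \<and> FL i c = FL i (j + 1) \<and>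
          co_end n (transpose_bpd P) True (j + 1) i = co_end n (transpose_bpd P) False c (i + 1))"
        by (rule less.hyps[OF m less.prems(1)]) (use less.prems j eq in auto)
      then show ?thesis unfolding ce eq
      proof
        assume "\<exists>c. j + 1 \<le> c \<and> c \<le> n \<and> P i c = Up_Elbow \<and> FL i c = FL i j \<and>
          co_end n (transpose_bpd P) True (j + 1) i = co_end n (transpose_bpd P) False c (i + 1)"
        then obtain c where c: "j + 1 \<le> c" "c \<le> n" "P i c = Up_Elbow" "FL i c = FL i j"
          "co_end n (transpose_bpd P) True (j + 1) i = co_end n (transpose_bpd P) False c (i + 1)" by blast
        then have "j \<le> c" by simp
        with c show "(FL i j = w i \<and> co_end n (transpose_bpd P) True (j + 1) i = i) \<or>
          (\<exists>c. j \<le> c \<and> c \<le> n \<and> P i c = Up_Elbow \<and> FL i c = FL i j \<and>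
           co_end n (transpose_bpd P) True (j + 1) i = co_end n (transpose_bpd P) False c (i + 1))" by blast
      qed blast
    qed
  qed
qed

text \<open>The pipe is traced backwards here, to its start or to the up-elbow by which it came into
  this column.\<close>

lemma follow_down:
  assumes "i \<in> {1..n}" "j \<in> {1..n}" "FB i j \<noteq> 0"
    "\<And>r. i < r \<Longrightarrow> r \<le> n \<Longrightarrow> P r j = Cross \<Longrightarrow> \<not> bump r j"
  shows "(FB i j = j \<and> co_end n P True (i + 1) j = j) \<or>
    (\<exists>r. i < r \<and> r \<le> n \<and> P r j = Up_Elbow \<and> FL r j = FB i j \<and>
      co_end n P True (i + 1) j = co_end n P False r (j + 1))"
  using assms
proof (induction "n - i" arbitrary: i rule: less_induct)
  case less
  show ?case
  proof (cases "i = n")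
    case True
    then show ?thesis using co_end_final by auto
  next
    case False
    then have i: "i < n" "i + 1 \<in> {1..n}" using less.prems by auto
    have mt: "meets_top (P (i + 1) j)" using label_nonzero(1)[of i j] bottom_top[of i j] less.prems i by auto
    have up: "FB i j = out_top (i + 1) j" using FB_up[of i j] i by simp
    show ?thesis
    proof (cases "P (i + 1) j = Up_Elbow")
      case True
      then show ?thesis using up i co_end_step[of "i + 1" j True] less.prems
        by (auto simp: out_top_def turns_down_def intro!: exI[of _ "Suc i"])
    next
      case ne: False
      then have eq: "FB (i + 1) j = FB i j"
        using mt up less.prems(4)[of "i + 1"] i by (cases "P (i + 1) j") (auto simp: out_top_def)
      have ce: "co_end n P True (i + 1) j = co_end n P True (i + 1 + 1) j"
        using co_end_step[of "i + 1" j True] ne i less.prems(2) by (auto simp: turns_down_def)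
      have m: "n - (i + 1) < n - i" using i by auto
      have nb: "\<not> bump r j" if "i + 1 < r" "r \<le> n" "P r j = Cross" for r using less.prems(4)[of r] that by auto
      have "(FB (i + 1) j = j \<and> co_end n P True (i + 1 + 1) j = j) \<or>
        (\<exists>r. i + 1 < r \<and> r \<le> n \<and> P r j = Up_Elbow \<and> FL r j = FB (i + 1) j \<and>
          co_end n P True (i + 1 + 1) j = co_end n P False r (j + 1))"
        by (rule less.hyps[OF m i(2) less.prems(2) _ nb]) (use less.prems(3) eq in auto)
      then show ?thesis unfolding ce eq
      proof
        assume "\<exists>r. i + 1 < r \<and> r \<le> n \<and> P r j = Up_Elbow \<and> FL r j = FB i j \<and>
          co_end n P True (i + 1 + 1) j = co_end n P False r (j + 1)"
        then obtain r where c: "i + 1 < r" "r \<le> n" "P r j = Up_Elbow" "FL r j = FB i j"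
          "co_end n P True (i + 1 + 1) j = co_end n P False r (j + 1)" by blast
        then have "i < r" by simp
        with c show "(FB i j = j \<and> co_end n P True (i + 1 + 1) j = j) \<or>
          (\<exists>r. i < r \<and> r \<le> n \<and> P r j = Up_Elbow \<and> FL r j = FB i j \<and>
          co_end n P True (i + 1 + 1) j = co_end n P False r (j + 1))" by blast
      qed blast
    qed
  qed
qed

text \<open>No pipe crosses the right edge of column \<open>c\<close>, so tracing the pipe back
  along row \<open>i\<close> must end at a square that it enters from below.\<close>

lemma trace_left:
  assumes "i \<in> {1..n}" "1 \<le> c" "c < j" "j \<le> n" "FL i j \<noteq> 0" "\<not> meets_right (P i c)"
  shows "\<exists>k. c < k \<and> k < j \<and> FB i k = FL i j"
  using assms
proof (induction "j" rule: less_induct)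
  case (less j)
  obtain k where k: "j = Suc k" using less.prems by (cases j) auto
  have R: "FL i j = out_right i k" using FL_right[of k i] less.prems k by auto
  have "k \<noteq> c"
  proof
    assume "k = c"
    then have "\<not> meets_right (P i k)" using less.prems by simp
    then have "out_right i k = 0" by (cases "P i k") (auto simp: out_right_def)
    with R less.prems show False by simp
  qed
  then have ck: "c < k" using less.prems k by auto
  have "FB i k = FL i j \<or> FL i k = FL i j"
    using R less.prems by (cases "P i k") (auto simp: out_right_def)
  then show ?case
  proof
    assume "FB i k = FL i j" then show ?thesis using ck k by auto
  next
    assume e: "FL i k = FL i j"
    then have "\<exists>k'. c < k' \<and> k' < k \<and> FB i k' = FL i k" using less.IH[of k] less.prems ck k by auto
    then show ?thesis using e k by auto
  qed
qed

text \<open>By \<open>label_order\<close>, a pipe that enters a square from the left enters no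
  square weakly below and to the right of it from below. A second elbow in that direction would
  require this, either just above it or, in the same row, between the two elbows.\<close>

lemma up_elbow_antichain:
  assumes "(a, b) \<in> grid" "P a b = Up_Elbow" "(a', b') \<in> grid" "P a' b' = Up_Elbow"
    "FL a b = FL a' b'" "a \<le> a'" "b \<le> b'"
  shows "a = a' \<and> b = b'"
proof (rule ccontr)
  assume ne: "\<not> (a = a' \<and> b = b')"
  have r: "1 \<le> a" "a' \<le> n" "1 \<le> b" "b' \<le> n" using assms by (auto simp: grid_def)
  have nz: "FL a b \<noteq> 0" using label_nonzero(2)[of a b] assms by (auto simp: grid_def)
  show False
  proof (cases "a = a'")
    case True
    then have "b < b'" using ne assms by auto
    then obtain k where "b < k" "k < b'" "FB a k = FL a b"
      using trace_left[of a b b'] assms r nz True by auto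
    then show False using label_order(1)[of a a b k] r nz assms True by auto
  next
    case False
    then obtain x where x: "a' = Suc x" "a \<le> x" using assms by (cases a') auto
    then have "FB x b' = FL a b" using FB_up[of x b'] assms r by (auto simp: out_top_def)
    then show False using label_order(1)[of a x b b'] x r nz assms by auto
  qed
qed

end

section \<open>Vexillary bumpless pipe dreams\<close>

locale vex_bpd = bpd_perm +
  assumes vex: "vexillary n w"
begin

lemma no_2143:
  assumes "l < u" "u < z" "z < y" "v u < v l" "v l < v y" "v y < v z" "u \<in> {1..n}" "z \<in> {1..n}"
  shows False
proof -
  have "1 \<le> v u" "v z \<le> n" using v_range assms by auto
  moreover have "w (v l) < w (v u)" "w (v u) < w (v z)" "w (v z) < w (v y)" using assms by simp_all
  ultimately show False using vex assms(4-6) unfolding vexillary_def by blast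
qed

text \<open>A column is also the label of the pipe starting in it, so this value is used directly as
  a label. By contrast \<open>row_end\<close> is a row, and its pipe is
  \<open>w (row_end a b)\<close>.\<close>

definition col_end :: "nat \<Rightarrow> nat \<Rightarrow> nat" where
  "col_end a b = co_end n P False a (b + 1)"

definition row_end :: "nat \<Rightarrow> nat \<Rightarrow> nat" where
  "row_end a b = co_end n (transpose_bpd P) False b (a + 1)"

text \<open>Equivalently, \<open>p\<close>, \<open>y\<close>, \<open>z\<close> occur in this order
  in the one-line notation of \<open>w\<close> and form a 132 pattern.\<close>

definition good_elbow :: "nat \<Rightarrow> nat \<Rightarrow> bool" where
  "good_elbow a b \<longleftrightarrow> (let p = FL a b; y = col_end a b; z = w (row_end a b) in
     y \<in> {1..n} \<and> z \<in> {1..n} \<and> p < z \<and> z < y \<and> v p < v y \<and> v y < v z)"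

lemma good_elbowD:
  assumes "good_elbow a b"
  shows "col_end a b \<in> {1..n}" "w (row_end a b) \<in> {1..n}" "FL a b < w (row_end a b)"
    "w (row_end a b) < col_end a b" "v (FL a b) < v (col_end a b)" "v (col_end a b) < v (w (row_end a b))"
  using assms unfolding good_elbow_def Let_def by blast+

text \<open>If the label \<open>l\<close> in square \<open>(x', b)\<close> is smaller than \<open>u = FL x b\<close>, then \<open>l\<close> has turned upwards
  in column \<open>b\<close>, and the next pipe below that elbow is by induction larger than \<open>u\<close>. The two pipes reached from
  the elbow then form a 2143 pattern with \<open>u\<close> and \<open>l\<close>.\<close>

lemma column_order:
  assumes "(x, b) \<in> grid" "FL x b \<noteq> 0" "x \<le> x'" "x' \<le> n" "FB x' b \<noteq> 0"
    and nb: "\<And>r c. (r, c) \<in> grid \<Longrightarrow> x < r \<Longrightarrow> b \<le> c \<Longrightarrow> P r c = Cross \<Longrightarrow> \<not> bump r c"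
    and good: "\<And>r c. (r, c) \<in> grid \<Longrightarrow> x < r \<Longrightarrow> b \<le> c \<Longrightarrow> P r c = Up_Elbow \<Longrightarrow> good_elbow r c"
  shows "FL x b < FB x' b"
  using assms(3-5)
proof (induction "n - x'" arbitrary: x' rule: less_induct)
  case less
  let ?u = "FL x b" and ?l = "FB x' b"
  have r: "x \<in> {1..n}" "b \<in> {1..n}" "x' \<in> {1..n}" using assms(1) less.prems by (auto simp: grid_def)
  have u: "?u \<in> {1..n}" using label_range(2)[of x b] r assms(2) by blast
  have ord: "?u \<noteq> ?l" "?u < ?l \<or> v ?u < v ?l"
    using label_order[of x x' b b] r less.prems assms(2) by auto
  show ?case
  proof (rule ccontr)
    assume "\<not> ?u < ?l"
    with ord have lu: "?l < ?u" and vul: "v ?u < v ?l" by auto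
    have "?u < b" using label_bounds(2)[of x b] r by auto
    with lu have "?l \<noteq> b" by auto
    moreover have "\<not> bump r b" if "x' < r" "r \<le> n" "P r b = Cross" for r
      using nb[of r b] that r less.prems(1) by (auto simp: grid_def)
    ultimately obtain q where q: "x' < q" "q \<le> n" "P q b = Up_Elbow" "FL q b = ?l"
      using follow_down[OF r(3,2) less.prems(3)] by blast
    have gq: "(q, b) \<in> grid" using q r by (auto simp: grid_def)
    have G: "good_elbow q b" using good[OF gq _ _ q(3)] q less.prems by auto
    obtain s where s: "q < s" "s \<le> n" "P s b = Down_Elbow"
      "row_end q b = co_end n (transpose_bpd P) True (b + 1) s"
      by (rule next_down_elbow_col[OF gq q(3), folded row_end_def])
    have sr: "s \<in> {1..n}" using s q r by auto
    have fs: "FB s b \<noteq> 0" using label_nonzero(1)[OF sr r(2)] s by simp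
    have "n - s < n - x'" using s q by auto
    from less.hyps[OF this _ s(2) fs] have us: "?u < FB s b" using s q less.prems by simp
    have fl: "FL s (b + 1) = FB s b" using FL_right[of b s] r s by (auto simp: out_right_def)
    have nbs: "\<not> bump s c" if "b + 1 \<le> c" "c \<le> n" "P s c = Cross" for c
      using nb[of s c] that sr s q less.prems(1) by (auto simp: grid_def)
    have "b + 1 \<in> {1..n + 1}" "FL s (b + 1) \<noteq> 0" using r fs fl by auto
    from follow_right[OF sr this nbs]
    have "FB s b = w s \<and> row_end q b = s \<or>
      (\<exists>c. b + 1 \<le> c \<and> c \<le> n \<and> P s c = Up_Elbow \<and> FL s c = FB s b \<and> row_end q b = row_end s c)"
      unfolding fl s(4) unfolding row_end_def by blast
    then have "?u < w (row_end q b)"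
    proof
      assume "\<exists>c. b + 1 \<le> c \<and> c \<le> n \<and> P s c = Up_Elbow \<and> FL s c = FB s b \<and> row_end q b = row_end s c"
      then obtain c where c: "b + 1 \<le> c" "c \<le> n" "P s c = Up_Elbow" "FL s c = FB s b" "row_end q b = row_end s c" by blast
      then have "good_elbow s c" using good[of s c] sr s q less.prems by (auto simp: grid_def)
      from good_elbowD(3)[OF this] c us show ?thesis by simp
    qed (use us in auto)
    from no_2143[OF lu this good_elbowD(4)[OF G] vul] good_elbowD[OF G] q u show False by simp
  qed
qed

text \<open>Otherwise \<open>?q\<close> is larger than \<open>?p\<close> and exits above it, hence
  above row \<open>a\<close>, so it turns upwards at a later elbow of this row. By induction the
  next down-elbow there belongs to a pipe exiting below \<open>?p\<close>, and the two pipes reached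
  from that elbow complete \<open>?q\<close> and \<open>?p\<close> to a 2143 pattern.\<close>

lemma row_order:
  assumes "(a, b) \<in> grid" "P a b = Up_Elbow" "b < b'" "b' \<le> n" "P a b' = Down_Elbow"
    and nb: "\<And>r c. (r, c) \<in> grid \<Longrightarrow> a \<le> r \<Longrightarrow> b < c \<Longrightarrow> P r c = Cross \<Longrightarrow> \<not> bump r c"
    and good: "\<And>r c. (r, c) \<in> grid \<Longrightarrow> a \<le> r \<Longrightarrow> b < c \<Longrightarrow> P r c = Up_Elbow \<Longrightarrow> good_elbow r c"
  shows "v (FL a b) < v (FB a b')"
  using assms(3-5)
proof (induction "n - b'" arbitrary: b' rule: less_induct)
  case less
  let ?p = "FL a b" and ?q = "FB a b'"
  have r: "a \<in> {1..n}" "b \<in> {1..n}" "b' \<in> {1..n}" using assms(1) less.prems by (auto simp: grid_def)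
  have nz: "?p \<noteq> 0" using label_nonzero(2)[OF r(1,2)] assms(2) by simp
  then have p: "?p \<in> {1..n}" using label_range(2) r by blast
  have qnz: "?q \<noteq> 0" using label_nonzero(1)[OF r(1,3)] less.prems by simp
  then have q: "?q \<in> {1..n}" using label_range(1) r by blast
  have ord: "?p \<noteq> ?q" "?p < ?q \<or> v ?p < v ?q"
    using label_order[of a a b b'] r less.prems nz qnz by auto
  show ?case
  proof (rule ccontr)
    assume "\<not> v ?p < v ?q"
    with ord v_inj have vqp: "v ?q < v ?p" and pq: "?p < ?q" by (metis linorder_neqE_nat)+
    have "FB (a - 1) b = ?p" using FB_up[of "a - 1" b] r assms(2) by (auto simp: out_top_def)
    then have "v ?p \<le> a - 1" using exit_bound(1)[of "a - 1" b] r nz by auto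
    then have qa: "?q \<noteq> w a" using vqp r by auto
    have fl: "FL a (b' + 1) = ?q" using FL_right[of b' a] r less.prems by (auto simp: out_right_def)
    have nba: "\<not> bump a c" if "b' + 1 \<le> c" "c \<le> n" "P a c = Cross" for c
      using nb[of a c] that r less.prems(1) by (auto simp: grid_def)
    have "b' + 1 \<in> {1..n + 1}" "FL a (b' + 1) \<noteq> 0" using r qnz fl by auto
    from follow_right[OF r(1) this nba] qa obtain c where c: "b' + 1 \<le> c" "c \<le> n" "P a c = Up_Elbow" "FL a c = ?q"
      unfolding fl by blast
    have gc: "(a, c) \<in> grid" using c r by (auto simp: grid_def)
    have G: "good_elbow a c" using good[OF gc _ _ c(3)] c less.prems by auto
    obtain d where d: "c < d" "d \<le> n" "P a d = Down_Elbow" "col_end a c = co_end n P True (a + 1) d"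
      by (rule next_down_elbow_row[OF gc c(3), folded col_end_def])
    have dr: "d \<in> {1..n}" using d c r by auto
    have fd: "FB a d \<noteq> 0" using label_nonzero(1)[OF r(1) dr] d by simp
    have "n - d < n - b'" using c d by auto
    from less.hyps[OF this _ d(2,3)] have pd: "v ?p < v (FB a d)" using c d less.prems by simp
    have "\<not> bump r d" if "a < r" "r \<le> n" "P r d = Cross" for r
      using nb[of r d] that dr r d c less.prems(1) by (auto simp: grid_def)
    from follow_down[OF r(1) dr fd this]
    have "FB a d = d \<and> col_end a c = d \<or>
      (\<exists>r. a < r \<and> r \<le> n \<and> P r d = Up_Elbow \<and> FL r d = FB a d \<and> col_end a c = col_end r d)"
      unfolding d(4) unfolding col_end_def by blast
    then have "v ?p < v (col_end a c)"
    proof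
      assume "\<exists>r. a < r \<and> r \<le> n \<and> P r d = Up_Elbow \<and> FL r d = FB a d \<and> col_end a c = col_end r d"
      then obtain s where s: "a < s" "s \<le> n" "P s d = Up_Elbow" "FL s d = FB a d" "col_end a c = col_end s d" by blast
      then have "good_elbow s d" using good[of s d] dr d c less.prems by (auto simp: grid_def)
      from good_elbowD(5)[OF this] s pd show ?thesis by simp
    qed (use pd in auto)
    from no_2143[OF pq _ good_elbowD(4)[OF G] vqp this good_elbowD(6)[OF G]] good_elbowD[OF G] c q
    show False by simp
  qed
qed

text \<open>Induction from the lower right corner. \<open>row_order\<close> and
  \<open>column_order\<close> compare \<open>p\<close> with the pipes at the next down-elbows to the
  right and below, from which \<open>y\<close> and \<open>z\<close> inherit the comparison. The
  comparison of \<open>y\<close> with \<open>z\<close> comes from the crossing where the two paths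
  meet.\<close>

lemma good_elbow:
  assumes "(a, b) \<in> grid" "P a b = Up_Elbow"
    and "\<And>r c. (r, c) \<in> grid \<Longrightarrow> a \<le> r \<Longrightarrow> b \<le> c \<Longrightarrow> P r c = Cross \<Longrightarrow> \<not> bump r c"
  shows "good_elbow a b"
  using assms
proof (induction "2 * n - (a + b)" arbitrary: a b rule: less_induct)
  case less
  note g = less.prems(1) and up = less.prems(2) and nb = less.prems(3)
  have r: "a \<in> {1..n}" "b \<in> {1..n}" using g by (auto simp: grid_def)
  have good: "good_elbow s c" if "(s, c) \<in> grid" "a \<le> s" "b \<le> c" "a < s \<or> b < c" "P s c = Up_Elbow" for s c
  proof (rule less.hyps[OF _ that(1,5)])
    show "2 * n - (s + c) < 2 * n - (a + b)" using that by (auto simp: grid_def)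
    show "\<not> bump s' c'" if "(s', c') \<in> grid" "s \<le> s'" "c \<le> c'" "P s' c' = Cross" for s' c'
      using nb[OF that(1) _ _ that(4)] that \<open>a \<le> s\<close> \<open>b \<le> c\<close> by auto
  qed
  let ?p = "FL a b" and ?y = "col_end a b" and ?z = "w (row_end a b)"
  have pnz: "?p \<noteq> 0" using label_nonzero(2)[OF r] up by simp
  have down: "FB s c = c \<and> co_end n P True (s + 1) c = c \<or>
      (\<exists>s'. s < s' \<and> s' \<le> n \<and> P s' c = Up_Elbow \<and> FL s' c = FB s c \<and> good_elbow s' c \<and>
        co_end n P True (s + 1) c = col_end s' c)"
    if "(s, c) \<in> grid" "a \<le> s" "b \<le> c" "FB s c \<noteq> 0" for s c
  proof -
    have sc: "s \<in> {1..n}" "c \<in> {1..n}" using that by (auto simp: grid_def)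
    have "\<not> bump r c" if "s < r" "r \<le> n" "P r c = Cross" for r
      using nb[of r c] that sc \<open>a \<le> s\<close> \<open>b \<le> c\<close> by (auto simp: grid_def)
    from follow_down[OF sc that(4) this] show ?thesis
    proof
      assume "\<exists>r>s. r \<le> n \<and> P r c = Up_Elbow \<and> FL r c = FB s c \<and> co_end n P True (s + 1) c = co_end n P False r (c + 1)"
      then obtain s' where s': "s < s'" "s' \<le> n" "P s' c = Up_Elbow" "FL s' c = FB s c"
        "co_end n P True (s + 1) c = col_end s' c" unfolding col_end_def by blast
      then have "good_elbow s' c" using good[of s' c] that sc by (auto simp: grid_def)
      with s' show ?thesis by blast
    qed (assumption | rule disjI1)+
  qed
  have right: "FL s c = w s \<and> co_end n (transpose_bpd P) True c s = s \<or>
      (\<exists>c'. c \<le> c' \<and> c' \<le> n \<and> P s c' = Up_Elbow \<and> FL s c' = FL s c \<and> good_elbow s c' \<and>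
        co_end n (transpose_bpd P) True c s = row_end s c')"
    if "s \<in> {1..n}" "c \<in> {1..n+1}" "a \<le> s" "b < c" "FL s c \<noteq> 0" for s c
  proof -
    have "\<not> bump s c'" if "c \<le> c'" "c' \<le> n" "P s c' = Cross" for c'
      using nb[of s c'] that \<open>s \<in> {1..n}\<close> \<open>a \<le> s\<close> \<open>b < c\<close> by (auto simp: grid_def)
    from follow_right[OF that(1,2,5) this] show ?thesis
    proof
      assume "\<exists>c'\<ge>c. c' \<le> n \<and> P s c' = Up_Elbow \<and> FL s c' = FL s c \<and>
        co_end n (transpose_bpd P) True c s = co_end n (transpose_bpd P) False c' (s + 1)"
      then obtain c' where c': "c \<le> c'" "c' \<le> n" "P s c' = Up_Elbow" "FL s c' = FL s c"
        "co_end n (transpose_bpd P) True c s = row_end s c'" unfolding row_end_def by blast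
      then have "good_elbow s c'" using good[of s c'] that by (auto simp: grid_def)
      with c' show ?thesis by blast
    qed (assumption | rule disjI1)+
  qed
  obtain b' where b': "b < b'" "b' \<le> n" "P a b' = Down_Elbow" "?y = co_end n P True (a + 1) b'"
    by (rule next_down_elbow_row[OF g up, folded col_end_def])
  have r': "b' \<in> {1..n}" using b' r by auto
  have c1: "FB a b' \<noteq> 0" using label_nonzero(1)[OF r(1) r'] b' by simp
  have vpc: "v ?p < v (FB a b')"
    by (rule row_order[OF g up b'(1-3)]) (use nb good in auto)
  have y_cases: "FB a b' = b' \<and> ?y = b' \<or> (\<exists>s'. FL s' b' = FB a b' \<and> good_elbow s' b' \<and> ?y = col_end s' b')"
  proof -
    have "(a, b') \<in> grid" "b \<le> b'" using r r' b' by (auto simp: grid_def)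
    from down[OF this(1) order_refl this(2) c1] show ?thesis unfolding b'(4) by blast
  qed
  have vpy: "v ?p < v ?y" and yr: "?y \<in> {1..n}"
  proof -
    have "v ?p < v ?y \<and> ?y \<in> {1..n}"
      using y_cases
    proof
      assume "\<exists>s'. FL s' b' = FB a b' \<and> good_elbow s' b' \<and> ?y = col_end s' b'"
      then obtain s' where s: "FL s' b' = FB a b'" "good_elbow s' b'" "?y = col_end s' b'" by blast
      from good_elbowD(1,5)[OF s(2)] show ?thesis using vpc unfolding s by simp
    qed (use vpc r' in simp)
    then show "v ?p < v ?y" "?y \<in> {1..n}" by blast+
  qed
  obtain a' where a': "a < a'" "a' \<le> n" "P a' b = Down_Elbow"
    "row_end a b = co_end n (transpose_bpd P) True (b + 1) a'"
    by (rule next_down_elbow_col[OF g up, folded row_end_def])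
  have s': "a' \<in> {1..n}" using a' r by auto
  have d1: "FB a' b \<noteq> 0" using label_nonzero(1)[OF s' r(2)] a' by simp
  have pd: "?p < FB a' b"
    by (rule column_order[OF g pnz _ a'(2) d1]) (use nb good a' in auto)
  have fl: "FL a' (b + 1) = FB a' b" using FL_right[of b a'] r a' by (auto simp: out_right_def)
  have z_cases: "FL a' (b + 1) = w a' \<and> row_end a b = a' \<or>
      (\<exists>c'. FL a' c' = FL a' (b + 1) \<and> good_elbow a' c' \<and> row_end a b = row_end a' c')"
  proof -
    have "b + 1 \<in> {1..n+1}" "a \<le> a'" "b < b + 1" "FL a' (b + 1) \<noteq> 0" using r a' d1 fl by auto
    from right[OF s' this] show ?thesis unfolding a'(4) by blast
  qed
  have pz: "?p < ?z" and zr: "?z \<in> {1..n}"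
  proof -
    have "?p < ?z \<and> ?z \<in> {1..n}"
      using z_cases
    proof
      assume "FL a' (b + 1) = w a' \<and> row_end a b = a'"
      then show ?thesis using pd fl w_range[OF s'] by simp
    next
      assume "\<exists>c'. FL a' c' = FL a' (b + 1) \<and> good_elbow a' c' \<and> row_end a b = row_end a' c'"
      then obtain c' where s: "FL a' c' = FL a' (b + 1)" "good_elbow a' c'" "row_end a b = row_end a' c'" by blast
      from good_elbowD(2,3)[OF s(2)] show ?thesis using pd fl unfolding s by simp
    qed
    then show "?p < ?z" "?z \<in> {1..n}" by blast+
  qed
  \<comment> \<open>The vertical pipe \<open>?v\<close> and the horizontal pipe \<open>?h\<close> of
    this crossing separate the two ends: \<open>?z < ?v \<le> ?y\<close> and
    \<open>v ?y < v ?h \<le> v ?z\<close>.\<close>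
  obtain x y where xy: "a \<le> x" "x \<le> n" "b \<le> y" "y \<le> n" "P x y = Cross"
    "co_end n P True (x + 1) y = ?y" "co_end n (transpose_bpd P) True (y + 1) x = row_end a b"
    by (rule up_elbow_cross[OF g up, folded col_end_def row_end_def])
  have gx: "(x, y) \<in> grid" "x \<in> {1..n}" "y \<in> {1..n}" using xy r by (auto simp: grid_def)
  let ?v = "FB x y" and ?h = "FL x y"
  have nz: "?v \<noteq> 0" "?h \<noteq> 0" using label_nonzero gx xy by auto
  have vr: "?v \<in> {1..n}" "?h \<in> {1..n}" using label_range gx nz by blast+
  have ne: "?h \<noteq> ?v" using label_order(1)[of x x y y] gx nz by auto
  have nbxy: "\<not> bump x y" using nb[OF gx(1)] xy by auto
  with bump_iff[OF gx(1) xy(5)] ne have hv: "?h < ?v" by simp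
  have vvh: "v ?v < v ?h" using cross_inverted[OF gx(1) xy(5) hv] .
  have Y: "?v = y \<and> ?y = y \<or> (\<exists>s'. FL s' y = ?v \<and> good_elbow s' y \<and> ?y = col_end s' y)"
    using down[OF gx(1) xy(1,3) nz(1)] unfolding xy(6) by blast
  have flx: "FL x (y + 1) = ?h" using FL_right[of y x] gx xy nbxy by (auto simp: out_right_def)
  have Z: "?h = w x \<and> row_end a b = x \<or> (\<exists>c'. FL x c' = ?h \<and> good_elbow x c' \<and> row_end a b = row_end x c')"
  proof -
    have "y + 1 \<in> {1..n+1}" "b < y + 1" "FL x (y + 1) \<noteq> 0" using gx xy nz flx by auto
    from right[OF gx(2) this(1) xy(1) this(2,3)] show ?thesis unfolding flx xy(7) by blast
  qed
  \<comment> \<open>If \<open>?y\<close> comes from a further elbow of \<open>?v\<close> and exits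
    below \<open>?h\<close>, then \<open>?v\<close>, \<open>?h\<close> and the two pipes of that
    elbow form a 2143 pattern.\<close>
  have vy: "?v \<le> ?y \<and> v ?y < v ?h"
    using Y
  proof
    assume "\<exists>s'. FL s' y = ?v \<and> good_elbow s' y \<and> ?y = col_end s' y"
    then obtain s' where s: "FL s' y = ?v" "good_elbow s' y" "?y = col_end s' y" by blast
    note G = good_elbowD[OF s(2)]
    have "?v < ?y" using G s by simp
    moreover have "v ?y < v ?h"
    proof (rule ccontr)
      assume "\<not> v ?y < v ?h"
      moreover have "v ?y \<noteq> v ?h" using v_inj[of ?y ?h] \<open>?v < ?y\<close> hv by auto
      ultimately have "v ?h < v ?y" by simp
      then show False using no_2143[OF hv _ _ vvh, of "w (row_end s' y)" ?y] G s vr by simp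
    qed
    ultimately show ?thesis by simp
  qed (use vvh in auto)
  have zh: "?z < ?v \<and> v ?h \<le> v ?z"
    using Z
  proof
    assume "\<exists>c'. FL x c' = ?h \<and> good_elbow x c' \<and> row_end a b = row_end x c'"
    then obtain c' where s: "FL x c' = ?h" "good_elbow x c'" "row_end a b = row_end x c'" by blast
    note G = good_elbowD[OF s(2)]
    have "v ?h < v ?z" using G s by simp
    moreover have "?z < ?v"
    proof (rule ccontr)
      assume "\<not> ?z < ?v"
      moreover have "?z \<noteq> ?v" using \<open>v ?h < v ?z\<close> vvh by (metis less_asym)
      ultimately have "?v < ?z" by simp
      then show False using no_2143[OF hv _ _ vvh, of ?z "col_end x c'"] G s vr by simp
    qed
    ultimately show ?thesis by simp
  qed (use hv in auto)
  show ?case unfolding good_elbow_def Let_def using yr zr pz vpy vy zh by auto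
qed

text \<open>At a bump without further bumps weakly below and to the right, the pipe from below would
  violate \<open>column_order\<close>.\<close>

theorem no_bump:
  assumes "(i, j) \<in> grid" "P i j = Cross"
  shows "\<not> bump i j"
proof
  assume b: "bump i j"
  let ?B = "{(i, j) \<in> grid. P i j = Cross \<and> bump i j}"
  have fin: "finite ?B" by (rule finite_subset[of _ grid]) (auto simp: grid_def)
  have ne: "?B \<noteq> {}" using assms b by auto
  have "Max ((\<lambda>(i, j). i + j) ` ?B) \<in> (\<lambda>(i, j). i + j) ` ?B" using fin ne by (intro Max_in) auto
  then obtain x y where B: "(x, y) \<in> ?B" and m: "x + y = Max ((\<lambda>(i, j). i + j) ` ?B)" by auto
  have mx: "r + c \<le> x + y" if "(r, c) \<in> ?B" for r c
    unfolding m using fin imageI[OF that, of "\<lambda>(i, j). i + j"] by (auto intro: Max_ge)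
  have nb: "\<not> bump r c" if "(r, c) \<in> grid" "x < r" "y \<le> c" "P r c = Cross" for r c
    using mx[of r c] that by auto
  have g: "(x, y) \<in> grid" "P x y = Cross" "bump x y" using B by auto
  have good: "good_elbow r c" if "(r, c) \<in> grid" "x < r" "y \<le> c" "P r c = Up_Elbow" for r c
    by (rule good_elbow) (use that nb in auto)
  have xy: "x \<in> {1..n}" "y \<in> {1..n}" using g by (auto simp: grid_def)
  then have nz: "FL x y \<noteq> 0" "FB x y \<noteq> 0" "x \<le> n" using label_nonzero[of x y] g by auto
  have "FL x y < FB x y"
    by (rule column_order[OF g(1) nz(1) order_refl nz(3,2)]) (use nb good in auto)
  then show False using bump_iff[OF g(1,2)] g(3) by simp
qed

end

section \<open>Counting up-elbows and blank tiles\<close>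

lemma card_inversion_matching:
  fixes y z :: "'e \<Rightarrow> nat" and v :: "nat \<Rightarrow> nat"
  assumes "finite Q" and inj: "inj_on y E" "inj_on z E"
    and Q: "\<And>e. e \<in> E \<Longrightarrow> y e \<in> Q" "\<And>e. e \<in> E \<Longrightarrow> z e \<in> Q"
    and inverted: "\<And>e. e \<in> E \<Longrightarrow> z e < y e" "\<And>e. e \<in> E \<Longrightarrow> v (y e) < v (z e)"
    and M: "\<And>a b. a \<in> M \<Longrightarrow> b \<in> M \<Longrightarrow> a < b \<Longrightarrow> v a < v b"
  shows "card E \<le> card (Q - M)"
proof -
  \<comment> \<open>The pairs \<open>(y e, z e)\<close> are the edges of a graph whose components are decreasing sequences,
    each with at most one element in \<open>M\<close>. An edge from which \<open>M\<close> can still be reached is charged to \<open>y e\<close>,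
    any other edge to \<open>z e\<close>.\<close>

  define above where "above x \<longleftrightarrow> (\<exists>m\<in>M. m \<le> x \<and> v x \<le> v m)" for x
  define f where "f e = (if above (z e) then y e else z e)" for e
  have up: "above (y e) \<and> y e \<notin> M" if eE: "e \<in> E" and az: "above (z e)" for e
  proof -
    obtain m where m: "m \<in> M" "m \<le> z e" "v (z e) \<le> v m" using az unfolding above_def by blast
    have "m < y e" "v (y e) < v m" using m inverted[OF eE] by auto
    have "y e \<notin> M"
    proof
      assume "y e \<in> M"
      from M[OF m(1) this \<open>m < y e\<close>] \<open>v (y e) < v m\<close> show False by simp
    qed
    moreover have "above (y e)" unfolding above_def using m(1) \<open>m < y e\<close> \<open>v (y e) < v m\<close>
      by (intro bexI[of _ m]) auto
    ultimately show ?thesis by simp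
  qed
  have low: "z e \<notin> M" if "\<not> above (z e)" for e using that unfolding above_def by blast
  have "inj_on f E"
  proof (rule inj_onI)
    fix e e' assume *: "e \<in> E" "e' \<in> E" "f e = f e'"
    \<comment> \<open>The charged element thus reveals which of the two rules charged it, so
      injectivity of \<open>y\<close> and of \<open>z\<close> is enough.\<close>
    have ab: "above (f e) \<longleftrightarrow> above (z e)" if "e \<in> E" for e using up[OF that] by (auto simp: f_def)
    have "above (z e) \<longleftrightarrow> above (z e')" using ab[OF *(1)] ab[OF *(2)] *(3) by simp
    then show "e = e'" using * inj_onD[OF inj(1), of e e'] inj_onD[OF inj(2), of e e']
      by (cases "above (z e)") (auto simp: f_def)
  qed
  moreover have "f ` E \<subseteq> Q - M" using Q up low by (auto simp: f_def)
  ultimately show ?thesis using card_inj_on_le assms(1) by blast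
qed

lemma rajchgot_code_ge:
  assumes "\<And>R. R \<subseteq> {i..n} \<Longrightarrow> i \<notin> R \<Longrightarrow> strict_mono_on ({i..n} - R) w \<Longrightarrow> k \<le> card R"
  shows "k \<le> rajchgot_code n w i"
proof -
  let ?A = "{card R | R. R \<subseteq> {i..n} \<and> i \<notin> R \<and> strict_mono_on ({i..n} - R) w}"
  have "?A \<subseteq> card ` Pow {i..n}" by auto
  then have "finite ?A" by (rule finite_subset) simp
  moreover have "?A \<noteq> {}"
  proof -
    have "{i..n} - {i<..n} \<subseteq> {i}" by auto
    then have "strict_mono_on ({i..n} - {i<..n}) w" by (auto simp: strict_mono_on_def)
    then have "card {i<..n} \<in> ?A" by (intro CollectI exI[of _ "{i<..n}"]) auto
    then show ?thesis by blast
  qed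
  ultimately have "Min ?A \<in> ?A" by (rule Min_in)
  then show ?thesis unfolding rajchgot_code_def using assms by auto
qed

context bpd
begin

text \<open>Every tile has as many incoming as outgoing ends, and in each row one pipe leaves at the
  right while none enters at the left. So each row passes on one pipe fewer through its top than it
  receives, and the first row passes on none.\<close>

lemma row_edge_counts:
  assumes "i \<in> {1..n}"
  shows "(\<Sum>j\<in>{1..n}. of_bool (meets_top (P i j))) = int i - 1"
    "(\<Sum>j\<in>{1..n}. of_bool (meets_bottom (P i j))) = int i"
proof -
  let ?e = "of_bool :: bool \<Rightarrow> int"
  have flow: "?e (meets_left t) + ?e (meets_bottom t) = ?e (meets_top t) + ?e (meets_right t)" for t
    by (cases t) auto
  have hor: "(\<Sum>j\<in>{1..n}. ?e (meets_right (P i j))) = (\<Sum>j\<in>{1..n}. ?e (meets_left (P i j))) + 1"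
    if i: "i \<in> {1..n}" for i
  proof -
    obtain m where m: "n = Suc m" using i by (cases n) auto
    have "(\<Sum>j\<in>{1..n}. ?e (meets_right (P i j))) = (\<Sum>j\<in>{1..m}. ?e (meets_right (P i j))) + 1"
      using right_edge[OF i] m by simp
    also have "(\<Sum>j\<in>{1..m}. ?e (meets_right (P i j))) = (\<Sum>j\<in>{1..m}. ?e (meets_left (P i (Suc j))))"
      by (rule sum.cong) (use right_left[OF i] m in auto)
    also have "\<dots> = (\<Sum>j\<in>{Suc 1..Suc m}. ?e (meets_left (P i j)))"
      by (simp only: sum.shift_bounds_cl_Suc_ivl)
    also have "\<dots> = (\<Sum>j\<in>{1..n}. ?e (meets_left (P i j)))"
      using left_edge[OF i] i sum.atLeast_Suc_atMost[of 1 n "\<lambda>j. ?e (meets_left (P i j))"]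
      unfolding m[symmetric] by simp
    finally show ?thesis .
  qed
  have row: "(\<Sum>j\<in>{1..n}. ?e (meets_bottom (P i j))) = (\<Sum>j\<in>{1..n}. ?e (meets_top (P i j))) + 1"
    if "i \<in> {1..n}" for i
  proof -
    have "(\<Sum>j\<in>{1..n}. ?e (meets_left (P i j)) + ?e (meets_bottom (P i j)))
      = (\<Sum>j\<in>{1..n}. ?e (meets_top (P i j)) + ?e (meets_right (P i j)))" by (simp only: flow)
    then show ?thesis unfolding sum.distrib using hor[OF that] by linarith
  qed
  have tops: "i \<in> {1..n} \<Longrightarrow> (\<Sum>j\<in>{1..n}. ?e (meets_top (P i j))) = int i - 1" for i
  proof (induction i)
    case (Suc i)
    show ?case
    proof (cases "i = 0")
      case True
      then have "(\<Sum>j\<in>{1..n}. ?e (meets_top (P (Suc i) j))) = (\<Sum>j\<in>{1..n}. 0)"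
        by (intro sum.cong) (use top_edge in auto)
      then show ?thesis using True by simp
    next
      case False
      then have "(\<Sum>j\<in>{1..n}. ?e (meets_top (P (Suc i) j))) = (\<Sum>j\<in>{1..n}. ?e (meets_bottom (P i j)))"
        by (intro sum.cong) (use bottom_top[of i] Suc.prems in auto)
      then show ?thesis using row[of i] Suc False by simp
    qed
  qed simp
  then show "(\<Sum>j\<in>{1..n}. ?e (meets_top (P i j))) = int i - 1" using assms .
  then show "(\<Sum>j\<in>{1..n}. ?e (meets_bottom (P i j))) = int i" using row[OF assms] by simp
qed

text \<open>A crossing meets four edges of its square, a blank tile none, and every other tile two,
  while the number of edges met in the whole grid is known.\<close>

lemma card_cross_eq_blank: "card {(i, j) \<in> grid. P i j = Cross} = card {(i, j) \<in> grid. P i j = Blank}"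
proof -
  interpret T: bpd n "transpose_bpd P" by (rule bpd_transpose)
  let ?e = "of_bool :: bool \<Rightarrow> int"
  have fin: "finite grid" unfolding grid_def by simp
  have tile: "(?e (meets_top t) + ?e (meets_bottom t)) + (?e (meets_left t) + ?e (meets_right t)) =
      2 + (2 * ?e (t = Cross) - 2 * ?e (t = Blank))" for t by (cases t) auto
  have cells: "(\<Sum>(i, j)\<in>grid. f i j) = (\<Sum>i\<in>{1..n}. \<Sum>j\<in>{1..n}. f i j)" for f :: "nat \<Rightarrow> nat \<Rightarrow> int"
    unfolding grid_def by (simp add: sum.cartesian_product)
  \<comment> \<open>Row \<open>i\<close> has \<open>i - 1\<close> met top edges and \<open>i\<close>
    met bottom edges; column \<open>j\<close> gives the same numbers for left and right
    edges.\<close>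
  have arith: "(\<Sum>i\<in>{1..m}. 2 * int i - 1) = int m * int m" for m :: nat
    by (induction m) (auto simp: algebra_simps)
  have "(\<Sum>(i, j)\<in>grid. (?e (meets_top (P i j)) + ?e (meets_bottom (P i j))) + (?e (meets_left (P i j)) + ?e (meets_right (P i j))))
    = (\<Sum>(i, j)\<in>grid. ?e (meets_top (P i j)) + ?e (meets_bottom (P i j))) +
      (\<Sum>(i, j)\<in>grid. ?e (meets_left (P i j)) + ?e (meets_right (P i j)))"
    by (simp only: sum.distrib[symmetric] case_prod_unfold)
  also have "(\<Sum>(i, j)\<in>grid. ?e (meets_top (P i j)) + ?e (meets_bottom (P i j))) = (\<Sum>i\<in>{1..n}. 2 * int i - 1)"
    unfolding cells
  proof (rule sum.cong)
    fix i assume "i \<in> {1..n}"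
    from row_edge_counts[OF this]
    show "(\<Sum>j\<in>{1..n}. ?e (meets_top (P i j)) + ?e (meets_bottom (P i j))) = 2 * int i - 1"
      unfolding sum.distrib by linarith
  qed simp
  also have "(\<Sum>(i, j)\<in>grid. ?e (meets_left (P i j)) + ?e (meets_right (P i j))) = (\<Sum>j\<in>{1..n}. 2 * int j - 1)"
    unfolding cells
  proof (subst sum.swap, rule sum.cong)
    fix j assume "j \<in> {1..n}"
    from T.row_edge_counts[OF this]
    show "(\<Sum>i\<in>{1..n}. ?e (meets_left (P i j)) + ?e (meets_right (P i j))) = 2 * int j - 1"
      unfolding sum.distrib meets_transpose by linarith
  qed simp
  finally have "(\<Sum>(i, j)\<in>grid. 2 + (2 * ?e (P i j = Cross) - 2 * ?e (P i j = Blank))) = 2 * (int n * int n)"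
    unfolding tile arith by simp
  moreover have "(\<Sum>(i, j)\<in>grid. 2 + (2 * ?e (P i j = Cross) - 2 * ?e (P i j = Blank))) =
     2 * (int n * int n) + 2 * (\<Sum>(i, j)\<in>grid. ?e (P i j = Cross)) - 2 * (\<Sum>(i, j)\<in>grid. ?e (P i j = Blank))"
    by (simp add: case_prod_unfold sum.distrib sum_subtractf sum_distrib_left grid_def del: sum_of_bool_eq)
  moreover have "(\<Sum>(i, j)\<in>grid. ?e (P i j = t)) = int (card {(i, j) \<in> grid. P i j = t})" for t
    using fin by (simp add: case_prod_unfold Int_def)
  ultimately show ?thesis by simp
qed

end

context vex_bpd
begin

lemma pipe_up_elbowsD:
  assumes "e \<in> pipe_up_elbows n P p"
  shows "e \<in> grid" "P (fst e) (snd e) = Up_Elbow" "FL (fst e) (snd e) = p" "good_elbow (fst e) (snd e)"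
proof -
  show g: "e \<in> grid" "P (fst e) (snd e) = Up_Elbow" "FL (fst e) (snd e) = p"
    using assms by (auto simp: pipe_up_elbows_def up_elbows_def grid_def)
  then show "good_elbow (fst e) (snd e)" by (intro good_elbow) (use no_bump in auto)
qed

text \<open>Equal ends put one elbow weakly below and to the right of the other, whereas the
  up-elbows of one pipe form an antichain.\<close>

lemma elbow_ends_inj:
  "inj_on (\<lambda>e. col_end (fst e) (snd e)) (pipe_up_elbows n P p)"
  "inj_on (\<lambda>e. row_end (fst e) (snd e)) (pipe_up_elbows n P p)"
proof -
  have le: "e = e'" if "e \<in> pipe_up_elbows n P p" "e' \<in> pipe_up_elbows n P p"
    "fst e + snd e \<le> fst e' + snd e'"
    "col_end (fst e) (snd e) = col_end (fst e') (snd e') \<or> row_end (fst e) (snd e) = row_end (fst e') (snd e')" for e e'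
  proof -
    obtain a b a' b' where e: "e = (a, b)" "e' = (a', b')" by force
    note p = pipe_up_elbowsD[OF that(1)] and p' = pipe_up_elbowsD[OF that(2)]
    have g: "(a, b) \<in> grid" "P a b = Up_Elbow" "(a', b') \<in> grid" "P a' b' = Up_Elbow" "FL a b = FL a' b'"
      using p p' e by auto
    have "a \<le> a' \<and> b \<le> b'"
    proof (cases "col_end a b = col_end a' b'")
      case True
      then show ?thesis
        using co_end_eq_imp_le[OF up_elbow_next(5)[OF g(1,2)] up_elbow_next(5)[OF g(3,4)]] that(3) e
        by (simp add: col_end_def)
    next
      case False
      then have "row_end a b = row_end a' b'" using that(4) e by simp
      then show ?thesis
        using co_end_transpose_eq_imp_le[OF g(1-4)] that(3) e by (simp add: row_end_def)
    qed
    then show ?thesis using up_elbow_antichain[OF g] e by simp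
  qed
  show "inj_on (\<lambda>e. col_end (fst e) (snd e)) (pipe_up_elbows n P p)"
    "inj_on (\<lambda>e. row_end (fst e) (snd e)) (pipe_up_elbows n P p)"
    by (rule inj_onI, use le nle_le in metis)+
qed

text \<open>As position \<open>v p\<close> is kept, every later position with a smaller value must
  be removed, which accounts for the Lehmer code. The kept pipes in \<open>Q\<close> form an
  increasing sequence \<open>M\<close>, so \<open>card_inversion_matching\<close> forces one further
  removal per up-elbow.\<close>

theorem up_elbows_bound:
  assumes p: "p \<in> {1..n}"
  shows "card (pipe_up_elbows n P p) + lehmer_code n w (v p) \<le> rajchgot_code n w (v p)"
proof (rule rajchgot_code_ge)
  let ?i = "v p"
  fix R assume R: "R \<subseteq> {?i..n}" "?i \<notin> R" "strict_mono_on ({?i..n} - R) w"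
  have i: "?i \<in> {1..n}" using v_range[OF p] .
  have mono: "w j < w k" if "j < k" "j \<in> {?i..n} - R" "k \<in> {?i..n} - R" for j k
    using R(3) that by (auto simp: strict_mono_on_def)
  define Q where "Q = {q \<in> {1..n}. p < q \<and> ?i < v q}"
  define M where "M = {q \<in> Q. v q \<notin> R}"
  let ?L = "{j \<in> {?i<..n}. w j < w ?i}"
  let ?E = "pipe_up_elbows n P p"
  have vq: "v q \<in> {?i..n}" if "q \<in> Q" for q using that v_range[of q] by (auto simp: Q_def)
  have "card ?E \<le> card (Q - M)"
  proof (rule card_inversion_matching[where v = v and y = "\<lambda>e. col_end (fst e) (snd e)" and z = "\<lambda>e. w (row_end (fst e) (snd e))"])
    show "inj_on (\<lambda>e. col_end (fst e) (snd e)) ?E" by (rule elbow_ends_inj)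
    show "inj_on (\<lambda>e. w (row_end (fst e) (snd e))) ?E"
      using elbow_ends_inj(2)[of p] unfolding inj_on_def by (metis v_w)
    show "v a < v b" if "a \<in> M" "b \<in> M" "a < b" for a b
    proof (rule ccontr)
      assume "\<not> v a < v b"
      moreover have "v a \<noteq> v b" using v_inj that(3) by blast
      ultimately have "v b < v a" by simp
      from mono[OF this] that vq show False by (auto simp: M_def)
    qed
    fix e assume e: "e \<in> ?E"
    note G = good_elbowD[OF pipe_up_elbowsD(4)[OF e]] and f = pipe_up_elbowsD(3)[OF e]
    show "col_end (fst e) (snd e) \<in> Q" "w (row_end (fst e) (snd e)) \<in> Q"
      using G unfolding Q_def f by (simp_all del: v_w)
    show "w (row_end (fst e) (snd e)) < col_end (fst e) (snd e)"
      "v (col_end (fst e) (snd e)) < v (w (row_end (fst e) (snd e)))" using G by simp_all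
  qed (simp add: Q_def)
  also have "card (Q - M) = card (v ` (Q - M))"
    by (rule card_image[symmetric]) (auto simp: inj_on_def dest: v_inj)
  finally have "card ?E + card ?L \<le> card (v ` (Q - M)) + card ?L" by simp
  also have "\<dots> = card (v ` (Q - M) \<union> ?L)"
    by (rule card_Un_disjoint[symmetric]) (auto simp: Q_def)
  also have "\<dots> \<le> card R"
  proof (rule card_mono)
    show "finite R" using R(1) finite_subset by blast
    have "j \<in> R" if "j \<in> ?L" for j
      using mono[of ?i j] that R(2) i by auto
    then show "v ` (Q - M) \<union> ?L \<subseteq> R" by (auto simp: M_def)
  qed
  finally show "card ?E + lehmer_code n w ?i \<le> card R" unfolding lehmer_code_def .
qed

lemma card_blanks: "card (blanks n P) = perm_length n w"
proof -
  obtain st where st: "reach grid st" "\<And>l. l \<in> {1..n} \<Longrightarrow> st (v l + n + 1) = l" using full_state by blast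
  have "blanks n P = {(i, j) \<in> grid. P i j = Blank}" by (auto simp: blanks_def grid_def)
  then have "card (blanks n P) = card {(i, j) \<in> grid. P i j = Cross}" using card_cross_eq_blank by simp
  also have "\<dots> = card (crossings grid)"
    using crossing_count[OF st(1)] no_bump reach_state(2)[OF st(1)] by auto
  also have "\<dots> = card ((\<lambda>(i, j). (w j, w i)) ` {(i, j). 1 \<le> i \<and> i < j \<and> j \<le> n \<and> w j < w i})"
  proof (rule arg_cong[of _ _ card], intro equalityI subsetI)
    fix x assume "x \<in> crossings grid"
    moreover obtain l m where x: "x = (l, m)" by force
    ultimately have c: "l \<in> {1..n}" "m \<in> {1..n}" "l < m" "v m < v l" using crossings_inverted by auto
    then have "(v m, v l) \<in> {(i, j). 1 \<le> i \<and> i < j \<and> j \<le> n \<and> w j < w i}" using v_range[of l] v_range[of m] by auto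
    then show "x \<in> (\<lambda>(i, j). (w j, w i)) ` {(i, j). 1 \<le> i \<and> i < j \<and> j \<le> n \<and> w j < w i}"
      unfolding x by (rule rev_image_eqI) simp
  next
    fix x assume "x \<in> (\<lambda>(i, j). (w j, w i)) ` {(i, j). 1 \<le> i \<and> i < j \<and> j \<le> n \<and> w j < w i}"
    then obtain i j where "x = (w j, w i)" "1 \<le> i" "i < j" "j \<le> n" "w j < w i" by auto
    then show "x \<in> crossings grid" using inverted_crossings[of "w j" "w i"] w_range[of i] w_range[of j] by auto
  qed
  also have "\<dots> = card {(i, j). 1 \<le> i \<and> i < j \<and> j \<le> n \<and> w j < w i}"
    by (rule card_image) (auto simp: inj_on_def dest: injD[OF permutes_inj[OF perm]])
  finally show ?thesis using perm_length_inversions by simp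
qed

lemma sum_pipe_up_elbows: "(\<Sum>p\<in>{1..n}. card (pipe_up_elbows n P p)) = card (up_elbows n P)"
proof -
  have fin: "finite (up_elbows n P)" by (rule finite_subset[of _ "{1..n} \<times> {1..n}"]) (auto simp: up_elbows_def)
  have sub: "pipe_up_elbows n P p \<subseteq> up_elbows n P" for p by (auto simp: pipe_up_elbows_def)
  have "up_elbows n P = (\<Union>p\<in>{1..n}. pipe_up_elbows n P p)"
  proof (intro equalityI subsetI)
    fix e assume "e \<in> up_elbows n P"
    then obtain i j where e: "e = (i, j)" "i \<in> {1..n}" "j \<in> {1..n}" "P i j = Up_Elbow" "e \<in> up_elbows n P" by (auto simp: up_elbows_def)
    then have "FL i j \<in> {1..n}" using label_range(2)[of i j] label_nonzero(2)[of i j] by simp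
    then show "e \<in> (\<Union>p\<in>{1..n}. pipe_up_elbows n P p)" using e by (auto simp: pipe_up_elbows_def)
  qed (use sub in auto)
  then have "card (up_elbows n P) = card (\<Union>p\<in>{1..n}. pipe_up_elbows n P p)" by simp
  also have "\<dots> = (\<Sum>p\<in>{1..n}. card (pipe_up_elbows n P p))"
  proof (rule card_UN_disjoint)
    show "\<forall>p\<in>{1..n}. finite (pipe_up_elbows n P p)" using finite_subset[OF sub fin] by blast
  qed (auto simp: pipe_up_elbows_def)
  finally show ?thesis by simp
qed

end

section \<open>Polynomials and Demazure operators\<close>

abbreviation lookup :: "('a \<Rightarrow>\<^sub>0 'b :: zero) \<Rightarrow> 'a \<Rightarrow> 'b" where
  "lookup \<equiv> Poly_Mapping.lookup"

abbreviation keys :: "('a \<Rightarrow>\<^sub>0 'b :: zero) \<Rightarrow> 'a set" where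
  "keys \<equiv> Poly_Mapping.keys"

abbreviation single :: "'a \<Rightarrow> 'b \<Rightarrow> 'a \<Rightarrow>\<^sub>0 'b :: zero" where
  "single \<equiv> Poly_Mapping.single"

type_synonym mon = "nat \<Rightarrow>\<^sub>0 nat"

text \<open>Integer polynomials form the free abelian group on the monomials:
  \<open>frag_of m\<close> is a monomial, and \<open>frag_extend\<close> extends a map on monomials
  linearly. The operators below are treated in this form.\<close>

lemma int_mpoly_induct [case_names zero mono diff]:
  fixes f :: int_mpoly
  assumes "P 0" "\<And>m. P (frag_of m)" "\<And>a b. P a \<Longrightarrow> P b \<Longrightarrow> P (a - b)"
  shows "P f"
  using subset_UNIV assms by (rule frag_induction)

lemma frag_of_add: "(frag_of (m + m') :: int_mpoly) = frag_of m * frag_of m'"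
  by (simp add: mult_single)

lemma X_frag: "X i = frag_of (single i 1)"
  by (simp add: X_def)

lemma X_power: "X i ^ k = frag_of (single i k)"
proof (induction k)
  case (Suc k)
  have "single i (Suc k) = single i 1 + single i k"
    by (simp add: single_add[symmetric])
  then show ?case using Suc by (simp add: X_frag frag_of_add)
qed simp

lemma X_inj: "X i = X j \<longleftrightarrow> i = j"
proof
  assume "X i = X j"
  then have "lookup (X i) (single j 1) = 1" by (simp add: X_frag)
  then have "single j (1::nat) = single i 1" by (simp add: X_frag split: if_splits)
  then show "i = j" by (metis lookup_single_eq lookup_single_not_eq zero_neq_one)
qed simp

definition mdeg :: "mon \<Rightarrow> nat" where
  "mdeg m = (\<Sum>i\<in>keys m. lookup m i)"

lemma mdeg_superset: "finite A \<Longrightarrow> keys m \<subseteq> A \<Longrightarrow> mdeg m = (\<Sum>i\<in>A. lookup m i)"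
  unfolding mdeg_def by (rule sum.mono_neutral_left) (auto simp: in_keys_iff)

lemma mdeg_add: "mdeg (m + m') = mdeg m + mdeg m'"
proof -
  let ?A = "keys m \<union> keys m'"
  have "mdeg (m + m') = (\<Sum>i\<in>?A. lookup (m + m') i)"
    by (rule mdeg_superset) (use keys_add[of m m'] in auto)
  also have "\<dots> = mdeg m + mdeg m'"
    by (simp add: mdeg_superset[of ?A] lookup_add sum.distrib)
  finally show ?thesis .
qed

lemma mdeg_zero [simp]: "mdeg 0 = 0" and mdeg_single [simp]: "mdeg (single i k) = k"
  by (simp_all add: mdeg_def)

lemma mon_induct [case_names zero add]:
  fixes m :: mon
  assumes "P 0" "\<And>m i. P m \<Longrightarrow> P (m + single i 1)"
  shows "P m"
proof (induction "mdeg m" arbitrary: m)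
  case 0
  have "lookup m i = 0" for i
    using 0 by (cases "i \<in> keys m") (auto simp: mdeg_def in_keys_iff)
  then have "m = 0" by (intro poly_mapping_eqI) simp
  then show ?case using assms by simp
next
  case (Suc k)
  then have "m \<noteq> 0" by auto
  then obtain i where i: "lookup m i \<noteq> 0" by (metis lookup_zero poly_mapping_eqI)
  let ?m = "m - single i 1"
  have m: "m = ?m + single i 1"
    using i by (intro poly_mapping_eqI) (auto simp: lookup_add lookup_minus lookup_single when_def)
  then have "mdeg m = mdeg ?m + 1" by (metis mdeg_add mdeg_single)
  then have "P ?m" using Suc by simp
  then show ?case using assms(2) m by metis
qed

section \<open>Substitutions as ring endomorphisms\<close>

lemma frag_extend_mult:
  fixes h :: "mon \<Rightarrow> int_mpoly"
  assumes "\<And>m m'. h (m + m') = h m * h m'"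
  shows "frag_extend h (f * g) = frag_extend h f * frag_extend h g"
proof (induction f rule: int_mpoly_induct)
  case (mono m)
  show ?case
  proof (induction g rule: int_mpoly_induct)
    case (mono m')
    show ?case using assms by (simp add: frag_of_add[symmetric] del: frag_of_add)
  qed (simp_all add: right_diff_distrib frag_extend_diff)
qed (simp_all add: left_diff_distrib frag_extend_diff)

locale poly_hom =
  fixes F :: "int_mpoly \<Rightarrow> int_mpoly"
  assumes diff: "F (a - b) = F a - F b" and mult: "F (a * b) = F a * F b" and one: "F 1 = 1"
begin

lemma zero: "F 0 = 0" using diff[of 0 0] by simp
lemma minus: "F (- a) = - F a" using diff[of 0 a] zero by simp
lemma add: "F (a + b) = F a + F b" using diff[of a "- b"] minus by simp
lemma of_nat: "F (of_nat k) = of_nat k" by (induction k) (simp_all add: zero add one)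
lemma power: "F (a ^ k) = F a ^ k" by (induction k) (simp_all add: mult one)
lemma prod: "F (prod g A) = (\<Prod>a\<in>A. F (g a))" by (induction A rule: infinite_finite_induct) (simp_all add: one mult)

end

lemma poly_hom_eqI:
  assumes "poly_hom F" "poly_hom G" "\<And>i. F (X i) = G (X i)"
  shows "F f = G f"
proof (induction f rule: int_mpoly_induct)
  case (mono m)
  show ?case
  proof (induction m rule: mon_induct)
    case zero
    then show ?case using poly_hom.one[OF assms(1)] poly_hom.one[OF assms(2)] by simp
  next
    case (add m i)
    then show ?case using assms(3)[of i]
      by (simp only: frag_of_add X_frag poly_hom.mult[OF assms(1)] poly_hom.mult[OF assms(2)])
  qed
qed (simp_all add: poly_hom.zero[OF assms(1)] poly_hom.zero[OF assms(2)] poly_hom.diff[OF assms(1)] poly_hom.diff[OF assms(2)])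

lemma poly_hom_id: "poly_hom (\<lambda>f. f)" by (simp add: poly_hom_def)

lemma poly_hom_comp: "poly_hom F \<Longrightarrow> poly_hom G \<Longrightarrow> poly_hom (\<lambda>f. F (G f))"
  by (simp add: poly_hom_def)

lemma poly_hom_extend:
  assumes "\<And>m m'. h (m + m') = h m * h m'" "h 0 = 1"
  shows "poly_hom (frag_extend h)"
proof
  show "frag_extend h 1 = 1" using frag_extend_of[of h 0] assms(2) by simp
qed (simp_all add: frag_extend_diff frag_extend_mult[OF assms(1)])

definition swap_mon :: "nat \<Rightarrow> mon \<Rightarrow> mon" where
  "swap_mon i m = Poly_Mapping.map_key (transpose i (i + 1)) m"

lemma lookup_swap_mon: "lookup (swap_mon i m) k = lookup m (transpose i (i + 1) k)"
  unfolding swap_mon_def by (simp add: map_key.rep_eq)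

lemma swap_mon_twice [simp]: "swap_mon i (swap_mon i m) = m"
  by (rule poly_mapping_eqI) (simp add: lookup_swap_mon)

lemma swap_mon_add: "swap_mon i (m + m') = swap_mon i m + swap_mon i m'"
  by (rule poly_mapping_eqI) (simp add: lookup_swap_mon lookup_add)

lemma swap_mon_zero [simp]: "swap_mon i 0 = 0"
  by (rule poly_mapping_eqI) (simp add: lookup_swap_mon)

lemma swap_vars_extend: "swap_vars i f = frag_extend (\<lambda>m. frag_of (swap_mon i m)) f"
proof -
  have inj: "inj (swap_mon i)" by (rule inj_on_inverseI[of _ "swap_mon i"]) simp
  have sv: "swap_vars i f = Poly_Mapping.map_key (swap_mon i) f" for f
    by (simp add: swap_vars_def swap_mon_def[abs_def])
  have dif: "Poly_Mapping.map_key (swap_mon i) (a - b) =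
    Poly_Mapping.map_key (swap_mon i) a - Poly_Mapping.map_key (swap_mon i) b" for a b :: int_mpoly
    by (rule poly_mapping_eqI) (simp add: map_key.rep_eq[OF inj] lookup_minus)
  show ?thesis unfolding sv
  proof (induction f rule: int_mpoly_induct)
    case zero
    then show ?case using map_key_zero[OF inj] by simp
  next
    case (mono m)
    then show ?case using map_key_single[OF inj, of "swap_mon i m" 1] by simp
  next
    case (diff a b)
    then show ?case by (simp add: dif frag_extend_diff)
  qed
qed

lemma swap_hom: "poly_hom (swap_vars i)"
  using poly_hom_extend[of "\<lambda>m. frag_of (swap_mon i m)"]
  by (simp add: swap_vars_extend[abs_def] swap_mon_add frag_of_add)

lemma swap_X: "swap_vars i (X k) = X (transpose i (i + 1) k)"
proof -
  have "swap_mon i (single k 1) = single (transpose i (i + 1) k) 1"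
    by (rule poly_mapping_eqI) (auto simp: lookup_swap_mon lookup_single when_def transpose_def)
  then show ?thesis by (simp add: swap_vars_extend X_frag)
qed

lemmas swap_diff = poly_hom.diff[OF swap_hom]
  and swap_mult = poly_hom.mult[OF swap_hom]
  and swap_one = poly_hom.one[OF swap_hom]
  and swap_of_nat = poly_hom.of_nat[OF swap_hom]

lemma swap_twice [simp]: "swap_vars i (swap_vars i f) = f"
  by (rule poly_hom_eqI[OF poly_hom_comp[OF swap_hom swap_hom] poly_hom_id])
    (simp add: swap_X transpose_involutory)

lemma swap_commute:
  assumes "i + 1 < j"
  shows "swap_vars i (swap_vars j f) = swap_vars j (swap_vars i f)"
  by (rule poly_hom_eqI[OF poly_hom_comp[OF swap_hom swap_hom] poly_hom_comp[OF swap_hom swap_hom]])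
    (use assms in \<open>auto simp: swap_X transpose_def\<close>)

lemma swap_braid:
  "swap_vars i (swap_vars (i + 1) (swap_vars i f)) = swap_vars (i + 1) (swap_vars i (swap_vars (i + 1) f))"
  by (rule poly_hom_eqI[OF poly_hom_comp[OF swap_hom poly_hom_comp[OF swap_hom swap_hom]]
        poly_hom_comp[OF swap_hom poly_hom_comp[OF swap_hom swap_hom]]])
    (auto simp: swap_X transpose_def)

text \<open>\<open>complement\<close> is the substitution \<open>x\<^sub>i \<mapsto> 1 - x\<^sub>i\<close>, which turns \<open>\<pi>\<^sub>i\<close> into the homogeneous
  operator \<open>dem i\<close> below.\<close>

definition comp_mon :: "mon \<Rightarrow> int_mpoly" where
  "comp_mon m = (\<Prod>i\<in>keys m. (1 - X i) ^ lookup m i)"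

lemma comp_mon_superset:
  "finite A \<Longrightarrow> keys m \<subseteq> A \<Longrightarrow> comp_mon m = (\<Prod>i\<in>A. (1 - X i) ^ lookup m i)"
  unfolding comp_mon_def by (rule prod.mono_neutral_left) (auto simp: in_keys_iff)

lemma comp_mon_add: "comp_mon (m + m') = comp_mon m * comp_mon m'"
proof -
  let ?A = "keys m \<union> keys m'"
  have "comp_mon (m + m') = (\<Prod>i\<in>?A. (1 - X i) ^ lookup (m + m') i)"
    by (rule comp_mon_superset) (use keys_add[of m m'] in auto)
  also have "\<dots> = comp_mon m * comp_mon m'"
    by (simp add: comp_mon_superset[of ?A] lookup_add prod.distrib power_add)
  finally show ?thesis .
qed

definition complement :: "int_mpoly \<Rightarrow> int_mpoly" where
  "complement = frag_extend comp_mon"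

lemma complement_hom: "poly_hom complement"
  unfolding complement_def by (rule poly_hom_extend[OF comp_mon_add]) (simp add: comp_mon_def)

lemma complement_X: "complement (X i) = 1 - X i"
  by (simp add: complement_def X_frag comp_mon_def)

lemmas complement_diff = poly_hom.diff[OF complement_hom]
  and complement_mult = poly_hom.mult[OF complement_hom]
  and complement_one = poly_hom.one[OF complement_hom]

lemma complement_twice [simp]: "complement (complement f) = f"
  by (rule poly_hom_eqI[OF poly_hom_comp[OF complement_hom complement_hom] poly_hom_id])
    (simp add: complement_X complement_diff complement_one)

lemma complement_swap: "complement (swap_vars i f) = swap_vars i (complement f)"
  by (rule poly_hom_eqI[OF poly_hom_comp[OF complement_hom swap_hom] poly_hom_comp[OF swap_hom complement_hom]])
    (simp add: complement_X swap_X swap_diff swap_one)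

section \<open>Demazure operators\<close>

definition mono_xy :: "nat \<Rightarrow> mon \<Rightarrow> nat \<Rightarrow> nat \<Rightarrow> mon" where
  "mono_xy i m a b = Poly_Mapping.update i a (Poly_Mapping.update (i + 1) b m)"

lemma lookup_mono_xy: "lookup (mono_xy i m a b) k = (if k = i then a else if k = i + 1 then b else lookup m k)"
  by (simp add: mono_xy_def lookup_update)

lemma mono_xy_self: "mono_xy i m (lookup m i) (lookup m (i + 1)) = m"
  by (rule poly_mapping_eqI) (simp add: lookup_mono_xy)

lemma frag_of_mono_xy: "(frag_of (mono_xy i m a b) :: int_mpoly) = frag_of (mono_xy i m 0 0) * (X i ^ a * X (i + 1) ^ b)"
proof -
  have "mono_xy i m a b = mono_xy i m 0 0 + (single i a + single (i + 1) b)"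
    by (rule poly_mapping_eqI) (auto simp: lookup_mono_xy lookup_add lookup_single when_def)
  then show ?thesis by (simp add: frag_of_add X_power)
qed

lemma swap_mon_mono_xy: "swap_mon i m = mono_xy i m (lookup m (i + 1)) (lookup m i)"
  by (rule poly_mapping_eqI) (auto simp: lookup_mono_xy lookup_swap_mon transpose_def)

text \<open>With \<open>x = X i\<close> and \<open>y = X (i + 1)\<close>, this is the quotient of
  \<open>y * f - x * swap_vars i f\<close> by \<open>y - x\<close> for a monomial \<open>f\<close>,
  written out as a geometric sum: the Demazure operator with the two variables exchanged. For
  \<open>p = q + 1\<close> the sum is empty.\<close>

definition dem_mon :: "nat \<Rightarrow> mon \<Rightarrow> int_mpoly" where
  "dem_mon i m = (let p = lookup m i; q = lookup m (i + 1) in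
     if p \<le> q then \<Sum>k\<in>{p..<Suc q}. frag_of (mono_xy i m k (p + q - k))
     else - (\<Sum>k\<in>{Suc q..<p}. frag_of (mono_xy i m k (p + q - k))))"

definition dem :: "nat \<Rightarrow> int_mpoly \<Rightarrow> int_mpoly" where
  "dem i = frag_extend (dem_mon i)"

lemma telescope:
  fixes x y :: "'a :: comm_ring_1"
  assumes "a \<le> b" "b \<le> s + 1"
  shows "(y - x) * (\<Sum>k\<in>{a..<b}. x ^ k * y ^ (s - k)) = x ^ a * y ^ (s + 1 - a) - x ^ b * y ^ (s + 1 - b)"
  using assms
proof (induction b rule: dec_induct)
  case (step b)
  have e: "s + 1 - b = Suc (s - b)" using step.prems by simp
  have "(y - x) * (\<Sum>k\<in>{a..<Suc b}. x ^ k * y ^ (s - k)) =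
    (y - x) * (\<Sum>k\<in>{a..<b}. x ^ k * y ^ (s - k)) + (y - x) * (x ^ b * y ^ (s - b))"
    using step.hyps by (simp add: algebra_simps)
  also have "\<dots> = x ^ a * y ^ (s + 1 - a) - x ^ b * y ^ (s + 1 - b) + (y - x) * (x ^ b * y ^ (s - b))"
    using step by simp
  also have "\<dots> = x ^ a * y ^ (s + 1 - a) - x ^ Suc b * y ^ (s + 1 - Suc b)"
    unfolding e by (simp add: algebra_simps)
  finally show ?case .
qed simp

lemma dem_eq: "(X (i + 1) - X i) * dem i f = X (i + 1) * f - X i * swap_vars i f"
proof (induction f rule: int_mpoly_induct)
  case (mono m)
  define p q where "p = lookup m i" and "q = lookup m (i + 1)"
  define r :: int_mpoly where "r = frag_of (mono_xy i m 0 0)"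
  let ?x = "X i" and ?y = "X (i + 1)"
  have m: "frag_of m = r * (?x ^ p * ?y ^ q)"
    using frag_of_mono_xy[of i m p q] by (simp add: p_def q_def r_def mono_xy_self[simplified])
  have sm: "frag_of (swap_mon i m) = r * (?x ^ q * ?y ^ p)"
    unfolding swap_mon_mono_xy frag_of_mono_xy[of i m "lookup m (i + 1)"] by (simp add: p_def q_def r_def)
  have s: "(?y - ?x) * (\<Sum>k\<in>{a..<b}. frag_of (mono_xy i m k (p + q - k))) =
    r * (?x ^ a * ?y ^ (p + q + 1 - a) - ?x ^ b * ?y ^ (p + q + 1 - b))" if "a \<le> b" "b \<le> p + q + 1" for a b
  proof -
    have "(\<Sum>k\<in>{a..<b}. frag_of (mono_xy i m k (p + q - k))) = r * (\<Sum>k\<in>{a..<b}. ?x ^ k * ?y ^ (p + q - k))"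
      unfolding sum_distrib_left r_def by (rule sum.cong) (simp_all only: frag_of_mono_xy[of i m _ "p + q - _"])
    then show ?thesis by (simp only: telescope[OF that] mult.left_commute[of "?y - ?x" r])
  qed
  have "(?y - ?x) * dem_mon i m = r * (?x ^ p * ?y ^ (q + 1) - ?x ^ (q + 1) * ?y ^ p)"
  proof (cases "p \<le> q")
    case True
    then show ?thesis using s[of p "Suc q"] unfolding dem_mon_def Let_def p_def[symmetric] q_def[symmetric]
      by simp
  next
    case False
    then show ?thesis using s[of "Suc q" p] unfolding dem_mon_def Let_def p_def[symmetric] q_def[symmetric]
      by (simp add: algebra_simps)
  qed
  then show ?case unfolding dem_def swap_vars_extend frag_extend_of unfolding m sm by (simp add: algebra_simps)
qed (simp_all add: dem_def frag_extend_diff swap_diff poly_hom.zero[OF swap_hom] right_diff_distrib)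

lemma X_diff_nonzero: "i \<noteq> j \<Longrightarrow> X i - X j \<noteq> 0"
  using X_inj[of i j] by auto

text \<open>Polynomials form an integral domain, so the quotient is unique and identities for
  \<open>dem i\<close> can be checked after multiplication by the denominator.\<close>

lemma dem_eqI:
  assumes "(X (i + 1) - X i) * g = X (i + 1) * f - X i * swap_vars i f"
  shows "dem i f = g"
proof -
  have "(X (i + 1) - X i) * dem i f = (X (i + 1) - X i) * g" using dem_eq assms by simp
  then show ?thesis using X_diff_nonzero[of "i + 1" i] by (simp only: mult_cancel_left) simp
qed

lemma dem_diff: "dem i (f - g) = dem i f - dem i g" and dem_add: "dem i (f + g) = dem i f + dem i g"
  and dem_zero [simp]: "dem i 0 = 0"
  by (simp_all add: dem_def frag_extend_diff frag_extend_add)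

lemma dem_sum: "dem i (sum g A) = (\<Sum>a\<in>A. dem i (g a))"
  by (induction A rule: infinite_finite_induct) (simp_all add: dem_add)

lemma swap_X_simps [simp]:
  "swap_vars i (X i) = X (Suc i)" "swap_vars i (X (Suc i)) = X i"
  "k \<noteq> i \<Longrightarrow> k \<noteq> Suc i \<Longrightarrow> swap_vars i (X k) = X k"
  by (simp_all add: swap_X transpose_def)

lemma swap_dem: "swap_vars i (dem i f) = dem i f"
proof (rule sym, rule dem_eqI)
  have "swap_vars i ((X (i + 1) - X i) * dem i f) = swap_vars i (X (i + 1) * f - X i * swap_vars i f)"
    by (simp only: dem_eq)
  then have "(X i - X (i + 1)) * swap_vars i (dem i f) = X i * swap_vars i f - X (i + 1) * f"
    by (simp add: swap_mult swap_diff)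
  then show "(X (i + 1) - X i) * swap_vars i (dem i f) = X (i + 1) * f - X i * swap_vars i f"
    by (simp add: algebra_simps)
qed

lemma dem_invariant_mult: "swap_vars i s = s \<Longrightarrow> dem i (s * f) = s * dem i f"
proof (rule dem_eqI)
  assume s: "swap_vars i s = s"
  have "(X (i + 1) - X i) * (s * dem i f) = s * ((X (i + 1) - X i) * dem i f)" by (simp add: algebra_simps)
  then show "(X (i + 1) - X i) * (s * dem i f) = X (i + 1) * (s * f) - X i * swap_vars i (s * f)"
    unfolding dem_eq swap_mult s by (simp add: algebra_simps)
qed

lemma dem_invariant: "swap_vars i s = s \<Longrightarrow> dem i s = s"
  by (rule dem_eqI) (simp add: algebra_simps)

lemma dem_idem: "dem i (dem i f) = dem i f"
  by (rule dem_invariant[OF swap_dem])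

text \<open>With \<open>x = X i\<close> and \<open>y = X (i + 1)\<close>, the numerator
  \<open>y * (1 - x) - x * (1 - y)\<close> is the denominator \<open>y - x\<close>.\<close>

lemma dem_linear_factor: "swap_vars i s = s \<Longrightarrow> dem i (s * (1 - X i)) = s"
  by (rule dem_eqI) (simp add: swap_mult swap_diff swap_one algebra_simps)

lemma dem_commute:
  assumes "i + 1 < j"
  shows "dem i (dem j f) = dem j (dem i f)"
proof -
  let ?a = "X i" and ?b = "X (i + 1)" and ?c = "X j" and ?d = "X (j + 1)"
  have sX: "swap_vars i ?c = ?c" "swap_vars i ?d = ?d" "swap_vars j ?a = ?a" "swap_vars j ?b = ?b" using assms by simp_all
  have 1: "(?d - ?c) * swap_vars i (dem j f) = ?d * swap_vars i f - ?c * swap_vars i (swap_vars j f)"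
    using arg_cong[OF dem_eq[of j f], of "swap_vars i"] by (simp only: swap_mult swap_diff sX)
  have 2: "(?b - ?a) * swap_vars j (dem i f) = ?b * swap_vars j f - ?a * swap_vars i (swap_vars j f)"
    using arg_cong[OF dem_eq[of i f], of "swap_vars j"] by (simp only: swap_mult swap_diff sX swap_commute[OF assms])
  have "(?b - ?a) * ((?d - ?c) * dem i (dem j f)) = (?d - ?c) * ((?b - ?a) * dem i (dem j f))" by (simp add: algebra_simps)
  also have "\<dots> = ?b * ((?d - ?c) * dem j f) - ?a * ((?d - ?c) * swap_vars i (dem j f))"
    unfolding dem_eq[of i "dem j f"] by (simp add: algebra_simps)
  also have "\<dots> = ?d * ((?b - ?a) * dem i f) - ?c * ((?b - ?a) * swap_vars j (dem i f))"
    unfolding dem_eq[of j f] dem_eq[of i f] 1 2 by (simp add: algebra_simps)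
  also have "\<dots> = (?b - ?a) * ((?d - ?c) * dem j (dem i f))"
    unfolding dem_eq[of j "dem i f"] by (simp add: algebra_simps)
  finally show ?thesis using X_diff_nonzero[of "i + 1" i] X_diff_nonzero[of "j + 1" j] by simp
qed

text \<open>The right-hand side is the alternating sum of the images of \<open>b c\<^sup>2 f\<close> under the permutations of
  \<open>a, b, c\<close>; \<open>s12f\<close> stands for \<open>s\<^sub>1 s\<^sub>2 f\<close>, and so on.\<close>

lemma braid_algebra:
  fixes a b c f s1f s2f s12f s21f s121f g1 g2 g3 s2g1 s1g2 :: "'a :: idom"
  assumes "b \<noteq> a"
    and g1: "(b - a) * g1 = b * f - a * s1f"
    and s2g1: "(c - a) * s2g1 = c * s2f - a * s21f"
    and g2: "(c - b) * g2 = c * g1 - b * s2g1"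
    and s1g2: "(c - a) * (c - b) * (a - b) * s1g2 = c * (c - b) * (a * s1f - b * f) - a * (a - b) * (c * s12f - b * s121f)"
    and g3: "(b - a) * g3 = b * g2 - a * s1g2"
  shows "(b - a) * (c - a) * (c - b) * g3 =
    b * c * c * f - a * c * c * s1f - b * b * c * s2f + a * a * c * s12f + a * b * b * s21f - a * a * b * s121f"
proof -
  have g2': "(c - a) * (c - b) * (b - a) * g2 = c * (c - a) * (b * f - a * s1f) - b * (b - a) * (c * s2f - a * s21f)"
  proof -
    have "(c - a) * (c - b) * (b - a) * g2 = (c - a) * (b - a) * ((c - b) * g2)" by (simp add: algebra_simps)
    also have "\<dots> = c * (c - a) * ((b - a) * g1) - b * (b - a) * ((c - a) * s2g1)"
      unfolding g2 by (simp add: algebra_simps)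
    finally show ?thesis unfolding g1 s2g1 .
  qed
  have "(b - a) * ((b - a) * (c - a) * (c - b) * g3) = (b - a) * (c - a) * (c - b) * ((b - a) * g3)" by (simp add: algebra_simps)
  also have "\<dots> = b * ((c - a) * (c - b) * (b - a) * g2) + a * ((c - a) * (c - b) * (a - b) * s1g2)"
    unfolding g3 by (simp add: algebra_simps)
  also have "\<dots> = (b - a) * (b * c * c * f - a * c * c * s1f - b * b * c * s2f + a * a * c * s12f + a * b * b * s21f - a * a * b * s121f)"
    unfolding g2' s1g2 by (simp add: algebra_simps)
  finally show ?thesis using assms(1) by simp
qed

text \<open>Multiplied by the Vandermonde product, both sides expand to the same alternating sum;
  only the last terms differ in form, and \<open>swap_braid\<close> identifies them.\<close>

lemma dem_braid: "dem i (dem (i + 1) (dem i f)) = dem (i + 1) (dem i (dem (i + 1) f))"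
proof -
  let ?j = "i + 1"
  let ?a = "X i" and ?b = "X (i + 1)" and ?c = "X (i + 2)"
  let ?s = "swap_vars i" and ?t = "swap_vars ?j"
  have sX: "?s ?a = ?b" "?s ?b = ?a" "?s ?c = ?c" "?t ?a = ?a" "?t ?b = ?c" "?t ?c = ?b"
    using swap_X_simps[of i] swap_X_simps[of "i + 1"] by simp_all
  have ne: "?b - ?a \<noteq> 0" "?c - ?a \<noteq> 0" "?c - ?b \<noteq> 0" by (rule X_diff_nonzero; simp)+
  have ei: "(?b - ?a) * dem i g = ?b * g - ?a * ?s g" for g by (rule dem_eq)
  have ej: "(?c - ?b) * dem ?j g = ?c * g - ?b * ?t g" for g using dem_eq[of ?j g] by simp
  have tei: "(?c - ?a) * ?t (dem i g) = ?c * ?t g - ?a * ?t (?s g)" for g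
    using arg_cong[OF ei[of g], of ?t] by (simp only: swap_mult swap_diff sX)
  have sej: "(?c - ?a) * ?s (dem ?j g) = ?c * ?s g - ?a * ?s (?t g)" for g
    using arg_cong[OF ej[of g], of ?s] by (simp only: swap_mult swap_diff sX)
  have L: "(?b - ?a) * (?c - ?a) * (?c - ?b) * dem i (dem ?j (dem i f)) =
    ?b * ?c * ?c * f - ?a * ?c * ?c * ?s f - ?b * ?b * ?c * ?t f + ?a * ?a * ?c * ?s (?t f) + ?a * ?b * ?b * ?t (?s f)
      - ?a * ?a * ?b * ?s (?t (?s f))"
  proof (rule braid_algebra[where ?g1.0 = "dem i f" and ?s2g1.0 = "?t (dem i f)" and ?g2.0 = "dem ?j (dem i f)"
        and ?s1g2.0 = "?s (dem ?j (dem i f))"])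
    have "(?c - ?a) * (?b - ?a) * ?s (dem ?j (dem i f)) * (?c - ?b) =
      (?c - ?b) * (?b - ?a) * ((?c - ?a) * ?s (dem ?j (dem i f)))" by (simp only: ac_simps)
    also have "(?c - ?a) * ?s (dem ?j (dem i f)) = ?c * dem i f - ?a * ?s (?t (dem i f))"
      using sej[of "dem i f"] swap_dem[of i f] by simp
    finally have 1: "(?c - ?a) * (?b - ?a) * ?s (dem ?j (dem i f)) * (?c - ?b) =
      ?c * (?c - ?b) * ((?b - ?a) * dem i f) - ?a * (?b - ?a) * ((?c - ?b) * ?s (?t (dem i f)))"
      by (simp add: algebra_simps)
    have "(?c - ?b) * ?s (?t (dem i f)) = ?c * ?s (?t f) - ?b * ?s (?t (?s f))"
      using arg_cong[OF tei[of f], of ?s] by (simp only: swap_mult swap_diff sX)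
    from 1[unfolded this ei] show "(?c - ?a) * (?c - ?b) * (?a - ?b) * ?s (dem ?j (dem i f)) =
      ?c * (?c - ?b) * (?a * ?s f - ?b * f) - ?a * (?a - ?b) * (?c * ?s (?t f) - ?b * ?s (?t (?s f)))"
      by (simp add: algebra_simps)
  qed (use ne ei ej tei in auto)
  have R: "(?b - ?a) * (?c - ?a) * (?c - ?b) * dem ?j (dem i (dem ?j f)) =
    ?b * ?c * ?c * f - ?a * ?c * ?c * ?s f - ?b * ?b * ?c * ?t f + ?a * ?a * ?c * ?s (?t f) + ?a * ?b * ?b * ?t (?s f)
      - ?a * ?a * ?b * ?t (?s (?t f))"
  proof -
    let ?h = "dem i (dem ?j f)"
    have h: "(?c - ?a) * ((?b - ?a) * ?h) = (?c - ?a) * ?b * dem ?j f - ?a * (?c * ?s f - ?a * ?s (?t f))"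
      unfolding ei[of "dem ?j f"] sej[symmetric] by (simp add: algebra_simps)
    have sdj: "?t (dem ?j f) = dem ?j f" by (rule swap_dem)
    have th: "(?b - ?a) * ((?c - ?a) * ?t ?h) = (?b - ?a) * ?c * dem ?j f - ?a * (?b * ?t (?s f) - ?a * ?t (?s (?t f)))"
      using arg_cong[OF h, of ?t] by (simp only: swap_mult swap_diff sX sdj)
    have "(?b - ?a) * (?c - ?a) * (?c - ?b) * dem ?j ?h = (?b - ?a) * (?c - ?a) * ((?c - ?b) * dem ?j ?h)"
      by (simp only: ac_simps)
    also have "\<dots> = ?c * ((?c - ?a) * ((?b - ?a) * ?h)) - ?b * ((?b - ?a) * ((?c - ?a) * ?t ?h))"
      unfolding ej[of ?h] by (simp add: algebra_simps)
    also have "\<dots> = ?b * ?c * ((?c - ?b) * dem ?j f) - ?c * ?a * (?c * ?s f - ?a * ?s (?t f))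
        + ?b * ?a * (?b * ?t (?s f) - ?a * ?t (?s (?t f)))"
      unfolding h th by (simp add: algebra_simps)
    finally show ?thesis unfolding ej[of f] by (simp add: algebra_simps)
  qed
  have "(?b - ?a) * (?c - ?a) * (?c - ?b) * dem i (dem ?j (dem i f)) =
    (?b - ?a) * (?c - ?a) * (?c - ?b) * dem ?j (dem i (dem ?j f))"
    unfolding L R swap_braid[of i f] ..
  then show ?thesis using ne by simp
qed

section \<open>The Euler operator\<close>

definition euler :: "int_mpoly \<Rightarrow> int_mpoly" where
  "euler = frag_extend (\<lambda>m. frag_cmul (int (mdeg m)) (frag_of m))"

lemma euler_diff: "euler (f - g) = euler f - euler g" and euler_zero [simp]: "euler 0 = 0"
  and euler_mono: "euler (frag_of m) = of_nat (mdeg m) * frag_of m"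
proof -
  have c: "frag_cmul (int k) f = of_nat k * f" for k and f :: int_mpoly
    by (induction k) (simp_all add: frag_cmul_distrib algebra_simps)
  show "euler (frag_of m) = of_nat (mdeg m) * frag_of m" by (simp add: euler_def c)
qed (simp_all add: euler_def frag_extend_diff frag_extend_add)

lemma lookup_of_nat_mult: "lookup (of_nat k * f :: int_mpoly) m = int k * lookup f m"
  by (induction k) (simp_all add: algebra_simps lookup_add)

lemma lookup_euler: "lookup (euler f) m = int (mdeg m) * lookup f m"
  by (induction f rule: int_mpoly_induct)
    (simp_all add: euler_diff euler_mono lookup_of_nat_mult lookup_minus algebra_simps)

lemma euler_mult: "euler (f * g) = euler f * g + f * euler g"
proof (induction f rule: int_mpoly_induct)
  case (mono m)
  show ?case
  proof (induction g rule: int_mpoly_induct)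
    case (mono m')
    have "euler (frag_of m * frag_of m') = of_nat (mdeg m + mdeg m') * (frag_of m * frag_of m')"
      using euler_mono[of "m + m'"] by (simp only: frag_of_add mdeg_add)
    then show ?case by (simp add: euler_mono algebra_simps del: mult_single)
  qed (simp_all add: euler_diff right_diff_distrib algebra_simps)
qed (simp_all add: euler_diff left_diff_distrib algebra_simps)

lemma euler_X: "euler (X i) = X i"
  using euler_mono[of "single i 1"] by (simp add: X_frag)

lemma euler_one: "euler 1 = 0"
  using euler_mono[of 0] by simp

lemma mdeg_mono_xy:
  assumes "a + b = lookup m i + lookup m (i + 1)"
  shows "mdeg (mono_xy i m a b) = mdeg m"
proof -
  let ?A = "keys m \<union> keys (mono_xy i m a b) \<union> {i, i + 1}"
  have A: "finite ?A" "i \<in> ?A" "i + 1 \<in> ?A - {i}" by auto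
  have s: "(\<Sum>k\<in>?A. g k) = g i + (g (i + 1) + (\<Sum>k\<in>?A - {i} - {i + 1}. g k))" for g :: "nat \<Rightarrow> nat"
    using sum.remove[OF A(1,2), of g] sum.remove[of "?A - {i}" "i + 1" g] A by simp
  have "mdeg (mono_xy i m a b) = (\<Sum>k\<in>?A. lookup (mono_xy i m a b) k)"
    by (rule mdeg_superset) auto
  also have "\<dots> = a + (b + (\<Sum>k\<in>?A - {i} - {i + 1}. lookup m k))"
    unfolding s by (simp add: lookup_mono_xy)
  also have "\<dots> = (\<Sum>k\<in>?A. lookup m k)"
    unfolding s using assms by simp
  also have "\<dots> = mdeg m" by (rule mdeg_superset[symmetric]) auto
  finally show ?thesis .
qed

lemma dem_mon_cases:
  assumes "m' \<in> keys (dem_mon i m)"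
  defines "p \<equiv> lookup m i" and "q \<equiv> lookup m (i + 1)"
  obtains k where "m' = mono_xy i m k (p + q - k)" "p \<le> q \<and> p \<le> k \<and> k \<le> q \<or> q < p \<and> q < k \<and> k < p"
proof -
  have "\<exists>k. m' = mono_xy i m k (p + q - k) \<and> (p \<le> q \<and> p \<le> k \<and> k \<le> q \<or> q < p \<and> q < k \<and> k < p)"
  proof (cases "p \<le> q")
    case True
    then have "m' \<in> keys (\<Sum>k\<in>{p..<Suc q}. frag_of (mono_xy i m k (p + q - k)) :: int_mpoly)"
      using assms(1) unfolding dem_mon_def Let_def p_def q_def by simp
    then show ?thesis using subsetD[OF keys_sum] True by fastforce
  next
    case False
    then have "m' \<in> keys (\<Sum>k\<in>{Suc q..<p}. frag_of (mono_xy i m k (p + q - k)) :: int_mpoly)"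
      using assms(1) unfolding dem_mon_def Let_def p_def q_def by simp
    then show ?thesis using subsetD[OF keys_sum] False by fastforce
  qed
  then show ?thesis using that by blast
qed

lemma dem_mon_mdeg: "m' \<in> keys (dem_mon i m) \<Longrightarrow> mdeg m' = mdeg m"
  by (erule dem_mon_cases) (auto intro!: mdeg_mono_xy)

lemma homogeneous_euler:
  assumes "\<And>m. m \<in> keys f \<Longrightarrow> mdeg m = d"
  shows "euler f = of_nat d * f"
proof (rule poly_mapping_eqI)
  fix m
  show "lookup (euler f) m = lookup (of_nat d * f) m"
    unfolding lookup_euler lookup_of_nat_mult using assms[of m] by (cases "m \<in> keys f") (auto simp: in_keys_iff)
qed

lemma dem_of_nat_mult: "dem i (of_nat k * f) = of_nat k * dem i f"
  by (rule dem_invariant_mult[OF swap_of_nat])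

lemma dem_euler: "dem i (euler f) = euler (dem i f)"
proof (induction f rule: int_mpoly_induct)
  case (mono m)
  have "euler (dem i (frag_of m)) = of_nat (mdeg m) * dem i (frag_of m)"
    by (rule homogeneous_euler) (simp add: dem_def dem_mon_mdeg)
  then show ?case by (simp add: euler_mono dem_of_nat_mult)
qed (simp_all add: euler_diff dem_diff)

lemma lookup_dem: "lookup (dem i f) m =
  (\<Sum>m'\<in>keys f. lookup f m' * lookup (dem_mon i m') m)"
  by (simp add: dem_def frag_extend_def lookup_sum)

section \<open>Grothendieck polynomials in the variables \<open>1 - x\<^sub>i\<close>\<close>

inductive gpoly :: "nat \<Rightarrow> (nat \<Rightarrow> nat) \<Rightarrow> int_mpoly \<Rightarrow> bool" for n where
  longest: "gpoly n (longest_perm n) (\<Prod>i\<in>{1..n}. (1 - X i) ^ (n - i))"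
| descent: "gpoly n w f \<Longrightarrow> i \<in> {1..<n} \<Longrightarrow> w (i + 1) < w i \<Longrightarrow> gpoly n (w \<circ> adj i) (dem i f)"

lemma gpoly_permutes: "gpoly n w f \<Longrightarrow> w permutes {1..n}"
  by (induction rule: gpoly.induct) (rule longest_perm_permutes, rule permutes_comp_adj)

lemma divided_difference_eq:
  assumes "(X i - X (i + 1)) * g = f - swap_vars i f"
  shows "divided_difference i f = g"
  unfolding divided_difference_def
proof (rule the_equality)
  fix g' assume "(X i - X (i + 1)) * g' = f - swap_vars i f"
  then have "(X i - X (i + 1)) * g' = (X i - X (i + 1)) * g" using assms by simp
  then show "g' = g" using X_diff_nonzero[of i "i + 1"] by (simp only: mult_cancel_left) simp
qed fact

text \<open>The substitution turns the factor \<open>1 - X (i + 1)\<close> of the numerator into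
  \<open>X (i + 1)\<close> and the denominator \<open>X i - X (i + 1)\<close> into its
  negative.\<close>

lemma complement_isobaric: "complement (isobaric_difference i f) = dem i (complement f)"
proof -
  have "(X i - X (i + 1)) * complement (dem i (complement f)) = f - X (i + 1) * f - swap_vars i (f - X (i + 1) * f)"
    using arg_cong[OF dem_eq[of i "complement f"], of complement]
    by (simp add: complement_mult complement_diff complement_X complement_swap swap_mult swap_diff algebra_simps)
  then have "isobaric_difference i f = complement (dem i (complement f))"
    unfolding isobaric_difference_def by (rule divided_difference_eq)
  then show ?thesis by simp
qed

lemma grothendieck_gpoly: "grothendieck n w f \<Longrightarrow> gpoly n w (complement f)"
proof (induction rule: grothendieck.induct)
  case longest
  have "complement (\<Prod>i\<in>{1..n}. X i ^ (n - i)) = (\<Prod>i\<in>{1..n}. (1 - X i) ^ (n - i))"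
    by (simp add: poly_hom.prod[OF complement_hom] poly_hom.power[OF complement_hom] complement_X)
  then show ?case using gpoly.longest by simp
next
  case (descent w f i)
  have "w i \<noteq> w (i + 1)" using inj_eq[OF permutes_inj[OF gpoly_permutes[OF descent.IH]], of i "i + 1"] by simp
  moreover have "\<not> w i < w (i + 1)" using perm_length_ascent[of i n w] descent.hyps by auto
  ultimately have "w (i + 1) < w i" by simp
  then show ?case unfolding complement_isobaric using gpoly.descent descent by blast
qed

lemma gpoly_cases:
  assumes "gpoly n w f"
  shows "(w = longest_perm n \<and> f = (\<Prod>i\<in>{1..n}. (1 - X i) ^ (n - i))) \<or>
    (\<exists>i\<in>{1..<n}. w i < w (i + 1) \<and> (\<exists>g. gpoly n (w \<circ> adj i) g \<and> f = dem i g))"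
  using assms
proof (cases rule: gpoly.cases)
  case (descent w' g i)
  then have "w i < w (i + 1)" "gpoly n (w \<circ> adj i) g" by simp_all
  then show ?thesis using descent(2,4) by blast
qed simp

lemma gpoly_exists: "w permutes {1..n} \<Longrightarrow> \<exists>f. gpoly n w f"
proof (induction "n * n - perm_length n w" arbitrary: w rule: less_induct)
  case less
  show ?case
  proof (cases "w = longest_perm n")
    case True then show ?thesis using gpoly.longest by blast
  next
    case False
    then obtain i where i: "i \<in> {1..<n}" "w i < w (i + 1)" using exists_ascent less.prems by blast
    have "perm_length n (w \<circ> adj i) = perm_length n w + 1" using perm_length_ascent[of i n w] i by simp
    then have "n * n - perm_length n (w \<circ> adj i) < n * n - perm_length n w"
      using perm_length_le[of n "w \<circ> adj i"] by simp
    then obtain g where "gpoly n (w \<circ> adj i) g" using less.hyps permutes_comp_adj[OF less.prems i(1)] by blast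
    from gpoly.descent[OF this i(1)] i show ?thesis by auto
  qed
qed

lemma longest_no_ascent: "i \<in> {1..<n} \<Longrightarrow> longest_perm n (i + 1) < longest_perm n i"
  by (auto simp: longest_perm_def)

text \<open>Two last steps \<open>i \<noteq> j\<close> can be completed to the longest element of the parabolic subgroup they
  generate, where the commutation and braid relations apply.\<close>

lemma gpoly_unique: "gpoly n w f \<Longrightarrow> gpoly n w f' \<Longrightarrow> f = f'"
proof (induction "n * n - perm_length n w" arbitrary: w f f' rule: less_induct)
  case less
  have perm: "w permutes {1..n}" using less.prems gpoly_permutes by blast
  have IH: "g = g'" if "i \<in> {1..<n}" "w i < w (i + 1)" "gpoly n (w \<circ> adj i) g" "gpoly n (w \<circ> adj i) g'" for i g g'
  proof (rule less.hyps[OF _ that(3,4)])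
    have "perm_length n (w \<circ> adj i) = perm_length n w + 1" using perm_length_ascent[of i n w] that by simp
    then show "n * n - perm_length n (w \<circ> adj i) < n * n - perm_length n w"
      using perm_length_le[of n "w \<circ> adj i"] by simp
  qed
  have far: "dem i g = dem j g'"
    if ij: "i \<in> {1..<n}" "w i < w (i + 1)" "gpoly n (w \<circ> adj i) g" "j \<in> {1..<n}" "w j < w (j + 1)" "gpoly n (w \<circ> adj j) g'" "i + 1 < j" for i j g g'
  proof -
    have c: "adj i \<circ> adj j = adj j \<circ> adj i" using ij by (auto simp: fun_eq_iff transpose_def)
    obtain x where x: "gpoly n (w \<circ> adj i \<circ> adj j) x"
      using gpoly_exists permutes_comp_adj[OF permutes_comp_adj[OF perm ij(1)] ij(4)] by blast
    have x': "gpoly n (w \<circ> adj j \<circ> adj i) x" using x c by (simp add: comp_assoc)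
    have "(w \<circ> adj i \<circ> adj j) (j + 1) < (w \<circ> adj i \<circ> adj j) j" using ij by (auto simp: transpose_def)
    from gpoly.descent[OF x ij(4) this, unfolded comp_transpose_twice] have 1: "g = dem j x"
      by (rule IH[OF ij(1-3)])
    have "(w \<circ> adj j \<circ> adj i) (i + 1) < (w \<circ> adj j \<circ> adj i) i" using ij by (auto simp: transpose_def)
    from gpoly.descent[OF x' ij(1) this, unfolded comp_transpose_twice] have 2: "g' = dem i x"
      by (rule IH[OF ij(4-6)])
    show ?thesis unfolding 1 2 using dem_commute[OF ij(7)] .
  qed
  have near: "dem i g = dem j g'"
    if ij: "i \<in> {1..<n}" "w i < w (i + 1)" "gpoly n (w \<circ> adj i) g" "j \<in> {1..<n}" "w j < w (j + 1)" "gpoly n (w \<circ> adj j) g'" "j = i + 1" for i j g g'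
  proof -
    have c: "adj i \<circ> adj j \<circ> adj i = adj j \<circ> adj i \<circ> adj j" using ij by (auto simp: fun_eq_iff transpose_def)
    let ?x = "w \<circ> adj i \<circ> adj j \<circ> adj i"
    have x2: "?x = w \<circ> adj j \<circ> adj i \<circ> adj j" using c by (simp add: comp_assoc)
    obtain x where x: "gpoly n ?x x"
      using gpoly_exists permutes_comp_adj[OF permutes_comp_adj[OF permutes_comp_adj[OF perm ij(1)] ij(4)] ij(1)] by blast
    have d: "w i < w (i + 1)" "w (i + 1) < w (i + 2)" using ij by auto
    have "?x (i + 1) < ?x i" using d ij(7) by (simp add: transpose_def)
    from gpoly.descent[OF x ij(1) this, unfolded comp_transpose_twice] have 1: "gpoly n (w \<circ> adj i \<circ> adj j) (dem i x)" .
    have "(w \<circ> adj i \<circ> adj j) (j + 1) < (w \<circ> adj i \<circ> adj j) j" using d ij(7) by (simp add: transpose_def)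
    from gpoly.descent[OF 1 ij(4) this, unfolded comp_transpose_twice] have g: "g = dem j (dem i x)"
      by (rule IH[OF ij(1-3)])
    have "?x (j + 1) < ?x j" using d ij(7) by (simp add: transpose_def)
    from gpoly.descent[OF x ij(4) this, unfolded x2 comp_transpose_twice] have 2: "gpoly n (w \<circ> adj j \<circ> adj i) (dem j x)" .
    have "(w \<circ> adj j \<circ> adj i) (i + 1) < (w \<circ> adj j \<circ> adj i) i" using d ij(7) by (simp add: transpose_def)
    from gpoly.descent[OF 2 ij(1) this, unfolded comp_transpose_twice] have g': "g' = dem i (dem j x)"
      by (rule IH[OF ij(4-6)])
    show ?thesis unfolding g g' ij(7) by (rule dem_braid)
  qed
  show ?case
  proof (cases "w = longest_perm n")
    case True
    then show ?thesis using gpoly_cases[OF less.prems(1)] gpoly_cases[OF less.prems(2)] longest_no_ascent[of _ n]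
      by (metis order_less_imp_not_less)
  next
    case False
    obtain i g where i: "i \<in> {1..<n}" "w i < w (i + 1)" "gpoly n (w \<circ> adj i) g" "f = dem i g"
      using gpoly_cases[OF less.prems(1)] False by blast
    obtain j g' where j: "j \<in> {1..<n}" "w j < w (j + 1)" "gpoly n (w \<circ> adj j) g'" "f' = dem j g'"
      using gpoly_cases[OF less.prems(2)] False by blast
    consider "i = j" | "i + 1 < j" | "j + 1 < i" | "j = i + 1" | "i = j + 1" by linarith
    then show ?thesis
    proof cases
      case 1 then show ?thesis using IH i j by blast
    next
      case 2 then show ?thesis using far[OF i(1-3) j(1-3)] i j by simp
    next
      case 3 then show ?thesis using far[OF j(1-3) i(1-3)] i j by simp
    next
      case 4 then show ?thesis using near[OF i(1-3) j(1-3)] i j by simp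
    next
      case 5 then show ?thesis using near[OF j(1-3) i(1-3)] i j by simp
    qed
  qed
qed

definition gp :: "nat \<Rightarrow> (nat \<Rightarrow> nat) \<Rightarrow> int_mpoly" where
  "gp n w = (SOME f. gpoly n w f)"

lemma gpoly_gp: "w permutes {1..n} \<Longrightarrow> gpoly n w (gp n w)"
  unfolding gp_def using gpoly_exists by (rule someI_ex)

lemma gp_eq: "gpoly n w f \<Longrightarrow> gp n w = f"
  using gpoly_unique gpoly_gp gpoly_permutes by blast

lemma gp_descent:
  assumes "w permutes {1..n}" "i \<in> {1..<n}" "w (i + 1) < w i"
  shows "gp n (w \<circ> adj i) = dem i (gp n w)"
  using gp_eq gpoly.descent[OF gpoly_gp] assms by blast

lemma gp_longest: "gp n (longest_perm n) = (\<Prod>i\<in>{1..n}. (1 - X i) ^ (n - i))"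
  by (rule gp_eq[OF gpoly.longest])

section \<open>The Euler operator and left multiplication\<close>

lemma euler_prod:
  "finite A \<Longrightarrow> euler (prod g A) = (\<Sum>a\<in>A. euler (g a) * prod g (A - {a}))"
proof (induction A rule: finite_induct)
  case (insert x A)
  have e: "prod g (insert x A - {a}) = g x * prod g (A - {a})" if "a \<in> A" for a
  proof -
    have "insert x A - {a} = insert x (A - {a})" using that insert.hyps by auto
    then show ?thesis using insert.hyps by simp
  qed
  have "euler (prod g (insert x A)) = euler (g x) * prod g A + g x * (\<Sum>a\<in>A. euler (g a) * prod g (A - {a}))"
    using insert by (simp add: euler_mult)
  also have "g x * (\<Sum>a\<in>A. euler (g a) * prod g (A - {a})) = (\<Sum>a\<in>A. euler (g a) * prod g (insert x A - {a}))"
    unfolding sum_distrib_left by (rule sum.cong) (simp_all add: e mult.left_commute)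
  finally show ?case using insert.hyps by simp
qed (simp add: euler_one)

text \<open>Here \<open>euler (1 - X i)\<close> is \<open>- X i\<close>, rewritten as
  \<open>(1 - X i) - 1\<close>. The lowered power is what produces the polynomials of shorter
  permutations.\<close>

lemma euler_power: "euler ((1 - X i) ^ Suc k) = of_nat (Suc k) * ((1 - X i) ^ Suc k - (1 - X i) ^ k)"
proof (induction k)
  case 0
  then show ?case by (simp add: euler_diff euler_one euler_X)
next
  case (Suc k)
  have "euler ((1 - X i) ^ Suc (Suc k)) = euler (1 - X i) * (1 - X i) ^ Suc k + (1 - X i) * euler ((1 - X i) ^ Suc k)"
    by (simp only: power_Suc[of _ "Suc k"] euler_mult)
  then show ?case unfolding Suc by (simp add: euler_diff euler_one euler_X algebra_simps)
qed

text \<open>The product is one factor \<open>1 - X i\<close> times a polynomial symmetric in the two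
  variables, so \<open>dem_linear_factor\<close> just deletes that factor.\<close>

lemma dem_prod:
  assumes i: "i \<in> {1..<n}" and c: "c i = c (i + 1) + 1"
  shows "dem i (\<Prod>j\<in>{1..n}. (1 - X j) ^ c j) = (\<Prod>j\<in>{1..n}. (1 - X j) ^ (c(i := c i - 1)) j)"
proof -
  let ?c = "c(i := c i - 1)"
  define s where "s = (\<Prod>j\<in>{1..n}. (1 - X j) ^ ?c j)"
  have mem: "i \<in> {1..n}" using i by simp
  have "(\<Prod>j\<in>{1..n}. (1 - X j) ^ c j) = (1 - X i) ^ c i * (\<Prod>j\<in>{1..n} - {i}. (1 - X j) ^ c j)"
    by (rule prod.remove) (use mem in auto)
  also have "(\<Prod>j\<in>{1..n} - {i}. (1 - X j) ^ c j) = (\<Prod>j\<in>{1..n} - {i}. (1 - X j) ^ ?c j)"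
    by (rule prod.cong) auto
  also have "(1 - X i) ^ c i = (1 - X i) ^ ?c i * (1 - X i)" using c by (simp add: mult.commute)
  finally have 1: "(\<Prod>j\<in>{1..n}. (1 - X j) ^ c j) = s * (1 - X i)"
    unfolding s_def prod.remove[OF finite_atLeastAtMost mem, of "\<lambda>j. (1 - X j) ^ ?c j"] by (simp only: ac_simps)
  have ca: "?c (adj i j) = ?c j" for j using c by (auto simp: transpose_def)
  have "swap_vars i s = (\<Prod>j\<in>{1..n}. (1 - X (adj i j)) ^ ?c j)"
    unfolding s_def by (simp add: poly_hom.prod[OF swap_hom] poly_hom.power[OF swap_hom] swap_diff swap_one swap_X del: fun_upd_apply)
  also have "\<dots> = (\<Prod>j\<in>{1..n}. (1 - X (adj i j)) ^ ?c (adj i j))" unfolding ca ..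
  also have "\<dots> = s" unfolding s_def
    by (rule prod.permute[OF adj_permutes[OF i], of "\<lambda>j. (1 - X j) ^ ?c j", unfolded comp_def, symmetric])
  finally show ?thesis unfolding 1 using dem_linear_factor s_def by simp
qed

definition left_descents :: "nat \<Rightarrow> (nat \<Rightarrow> nat) \<Rightarrow> nat set" where
  "left_descents n w = {k \<in> {1..<n}. inv w (k + 1) < inv w k}"

lemma finite_left_descents [simp]: "finite (left_descents n w)"
  by (simp add: left_descents_def)

lemma longest_perm_inv: "inv (longest_perm n) = longest_perm n"
proof (rule inv_unique_comp)
  show "longest_perm n \<circ> longest_perm n = id" by (auto simp: fun_eq_iff longest_perm_def)
qed (auto simp: fun_eq_iff longest_perm_def)

text \<open>By the Leibniz rule the factor with index \<open>j\<close> contributes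
  \<open>n - j\<close> times the product minus the product with exponent \<open>j\<close> lowered,
  and by \<open>dem_prod\<close> the latter belongs to a permutation one step below. The
  multiplicities \<open>n - j\<close> add up to the sum of all left descents.\<close>

lemma gp_euler_longest:
  "of_nat (\<Sum>k\<in>left_descents n (longest_perm n). k) * gp n (longest_perm n) - euler (gp n (longest_perm n)) =
    (\<Sum>k\<in>left_descents n (longest_perm n). of_nat k * gp n (adj k \<circ> longest_perm n))"
proof -
  let ?c = "\<lambda>j. n - j"
  define B where "B = (\<Prod>j\<in>{1..n}. (1 - X j) ^ (n - j))"
  define C where "C i = (\<Prod>j\<in>{1..n}. (1 - X j) ^ (?c(i := ?c i - 1)) j)" for i
  have L: "left_descents n (longest_perm n) = {1..<n}"
    unfolding left_descents_def longest_perm_inv using longest_no_ascent by auto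
  have rem: "B = (1 - X i) ^ (n - i) * (\<Prod>j\<in>{1..n} - {i}. (1 - X j) ^ (n - j))"
    "C i = (1 - X i) ^ (n - i - 1) * (\<Prod>j\<in>{1..n} - {i}. (1 - X j) ^ (n - j))" if "i \<in> {1..n}" for i
  proof -
    show "B = (1 - X i) ^ (n - i) * (\<Prod>j\<in>{1..n} - {i}. (1 - X j) ^ (n - j))"
      unfolding B_def by (rule prod.remove) (use that in auto)
    have "C i = (1 - X i) ^ (?c(i := ?c i - 1)) i * (\<Prod>j\<in>{1..n} - {i}. (1 - X j) ^ (?c(i := ?c i - 1)) j)"
      unfolding C_def by (rule prod.remove) (use that in auto)
    also have "(\<Prod>j\<in>{1..n} - {i}. (1 - X j) ^ (?c(i := ?c i - 1)) j) = (\<Prod>j\<in>{1..n} - {i}. (1 - X j) ^ (n - j))"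
      by (rule prod.cong) auto
    finally show "C i = (1 - X i) ^ (n - i - 1) * (\<Prod>j\<in>{1..n} - {i}. (1 - X j) ^ (n - j))" by simp
  qed
  have "euler B = (\<Sum>i\<in>{1..n}. euler ((1 - X i) ^ (n - i)) * (\<Prod>j\<in>{1..n} - {i}. (1 - X j) ^ (n - j)))"
    unfolding B_def by (rule euler_prod) simp
  also have "\<dots> = (\<Sum>i\<in>{1..n}. of_nat (n - i) * (B - C i))"
  proof (rule sum.cong)
    fix i assume i: "i \<in> {1..n}"
    show "euler ((1 - X i) ^ (n - i)) * (\<Prod>j\<in>{1..n} - {i}. (1 - X j) ^ (n - j)) = of_nat (n - i) * (B - C i)"
    proof (cases "n - i")
      case 0
      then show ?thesis by (simp add: euler_one)
    next
      case (Suc k)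
      then show ?thesis unfolding rem[OF i] Suc euler_power by (simp add: algebra_simps)
    qed
  qed simp
  also have "\<dots> = of_nat (\<Sum>i\<in>{1..n}. n - i) * B - (\<Sum>i\<in>{1..n}. of_nat (n - i) * C i)"
    by (simp only: right_diff_distrib sum_subtractf of_nat_sum sum_distrib_right)
  finally have E: "of_nat (\<Sum>i\<in>{1..n}. n - i) * B - euler B = (\<Sum>i\<in>{1..n}. of_nat (n - i) * C i)" by simp
  \<comment> \<open>The longest permutation turns the position \<open>n - k\<close> of a right
    factor into the value \<open>k\<close> of a left factor.\<close>
  have re: "(\<Sum>i\<in>{1..n}. f (n - i) i) = (\<Sum>k\<in>{1..<n}. f k (n - k))" if "\<And>i. f 0 i = 0" for f :: "nat \<Rightarrow> nat \<Rightarrow> 'a :: comm_monoid_add"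
  proof -
    have "(\<Sum>i\<in>{1..n}. f (n - i) i) = (\<Sum>i\<in>{1..<n}. f (n - i) i)"
      by (rule sum.mono_neutral_right) (use that in \<open>auto simp: not_less\<close>)
    also have "\<dots> = (\<Sum>k\<in>{1..<n}. f k (n - k))"
      by (rule sum.reindex_bij_witness[of _ "\<lambda>k. n - k" "\<lambda>i. n - i"]) auto
    finally show ?thesis .
  qed
  have s1: "(\<Sum>i\<in>{1..n}. n - i) = (\<Sum>k\<in>{1..<n}. k)" using re[of "\<lambda>a b. a"] by simp
  have s2: "(\<Sum>i\<in>{1..n}. of_nat (n - i) * C i) = (\<Sum>k\<in>{1..<n}. of_nat k * C (n - k))"
    using re[of "\<lambda>a b. of_nat a * C b"] by simp
  have "gp n (adj k \<circ> longest_perm n) = C (n - k)" if k: "k \<in> {1..<n}" for k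
  proof -
    have nk: "n - k \<in> {1..<n}" using k by auto
    have "adj k \<circ> longest_perm n = longest_perm n \<circ> adj (n - k)"
    proof
      fix x
      have v: "longest_perm n (n - k) = k + 1" "longest_perm n (n - k + 1) = k"
        using k by (auto simp: longest_perm_def)
      note inj = inj_eq[OF permutes_inj[OF longest_perm_permutes[of n]]]
      consider "x = n - k" | "x = n - k + 1" | "x \<noteq> n - k" "x \<noteq> n - k + 1" by blast
      then show "(adj k \<circ> longest_perm n) x = (longest_perm n \<circ> adj (n - k)) x"
      proof cases
        case 3
        then have "longest_perm n x \<noteq> k + 1" "longest_perm n x \<noteq> k"
          using inj[of x "n - k"] inj[of x "n - k + 1"] v by auto
        then show ?thesis using 3 by (simp add: transpose_apply_other)
      qed (use v in simp_all)
    qed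
    then have "gp n (adj k \<circ> longest_perm n) = dem (n - k) (gp n (longest_perm n))"
      using gp_descent[OF longest_perm_permutes nk longest_no_ascent[OF nk]] by simp
    also have "\<dots> = C (n - k)" unfolding gp_longest C_def by (rule dem_prod[OF nk]) (use k in auto)
    finally show ?thesis .
  qed
  then have "(\<Sum>k\<in>{1..<n}. of_nat k * gp n (adj k \<circ> longest_perm n)) = (\<Sum>k\<in>{1..<n}. of_nat k * C (n - k))"
    by (intro sum.cong) auto
  then show ?thesis unfolding L using E unfolding s1 s2 B_def[symmetric] gp_longest by simp
qed

text \<open>Since \<open>dem i\<close> commutes with \<open>euler\<close>, it can be applied to the
  recursion for \<open>w\<close>. It sends the summand of \<open>k\<close> to the one for
  \<open>w \<circ> adj i\<close>, except when \<open>adj k \<circ> w = w \<circ> adj i\<close>. Then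
  \<open>k\<close> ceases to be a left descent, and by idempotence its summand cancels the change of
  the coefficient.\<close>

lemma gpoly_euler:
  assumes "gpoly n w f"
  shows "of_nat (\<Sum>k\<in>left_descents n w. k) * gp n w - euler (gp n w) =
    (\<Sum>k\<in>left_descents n w. of_nat k * gp n (adj k \<circ> w))"
  using assms
proof (induction rule: gpoly.induct)
  case longest
  show ?case by (rule gp_euler_longest)
next
  case (descent w f i)
  let ?w = "w \<circ> adj i" and ?L = "left_descents n w" and ?L' = "left_descents n (w \<circ> adj i)"
  have perm: "w permutes {1..n}" using descent.hyps gpoly_permutes by blast
  have perm': "?w permutes {1..n}" using permutes_comp_adj[OF perm descent.hyps(2)] .
  have inv': "inv ?w x = adj i (inv w x)" for x
    using o_inv_distrib[OF permutes_bij[OF perm] bij_transpose] by (simp add: o_def)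
  have inj: "w x = w y \<longleftrightarrow> x = y" for x y using inj_eq[OF permutes_inj[OF perm]] .
  have winv: "w (inv w x) = x" "inv w (w x) = x" for x using permutes_inverses[OF perm] by auto
  have gpw': "gp n ?w = dem i (gp n w)" using gp_descent[OF perm descent.hyps(2,3)] .
  have L': "k \<in> ?L' \<longleftrightarrow> k \<in> ?L \<and> \<not> (w i = k + 1 \<and> w (i + 1) = k)" if k: "k \<in> {1..<n}" for k
  proof -
    let ?x = "inv w (k + 1)" and ?y = "inv w k"
    have ne: "?x \<noteq> ?y" using winv by (metis n_not_Suc_n Suc_eq_plus1)
    have n1: "\<not> (?y = i \<and> ?x = i + 1)"
    proof
      assume "?y = i \<and> ?x = i + 1"
      then have "w i = k" "w (i + 1) = k + 1" using winv(1)[of k] winv(1)[of "k + 1"] by auto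
      then show False using descent.hyps(3) by simp
    qed
    have "adj i ?x < adj i ?y \<longleftrightarrow> ?x < ?y \<and> \<not> (?x = i \<and> ?y = i + 1)"
    proof (cases "?x < ?y")
      case True
      show ?thesis
      proof (cases "?x = i \<and> ?y = i + 1")
        case True
        then show ?thesis by simp
      next
        case False
        then show ?thesis using adj_less[OF True False] True by simp
      qed
    next
      case False
      then have "?y < ?x" using ne by simp
      from adj_less[OF this n1] False show ?thesis by simp
    qed
    moreover have "?x = i \<and> ?y = i + 1 \<longleftrightarrow> w i = k + 1 \<and> w (i + 1) = k" using winv by metis
    ultimately show ?thesis using k unfolding left_descents_def inv' by auto
  qed
  have step: "dem i (gp n (adj k \<circ> w)) = gp n (adj k \<circ> ?w)"
    if k: "k \<in> ?L" and ns: "\<not> (w i = k + 1 \<and> w (i + 1) = k)" for k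
  proof -
    have kn: "k \<in> {1..<n}" using k by (simp add: left_descents_def)
    have "adj k (w (i + 1)) < adj k (w i)" using adj_less[OF descent.hyps(3)] ns by auto
    then have "(adj k \<circ> w) (i + 1) < (adj k \<circ> w) i" by simp
    from gp_descent[OF permutes_adj_comp[OF perm kn] descent.hyps(2) this]
    show ?thesis unfolding comp_assoc by (rule sym)
  qed
  have E: "of_nat (\<Sum>k\<in>?L. k) * gp n ?w - euler (gp n ?w) = (\<Sum>k\<in>?L. of_nat k * dem i (gp n (adj k \<circ> w)))"
    using arg_cong[OF descent.IH, of "dem i"] unfolding gpw' dem_diff dem_of_nat_mult dem_euler dem_sum .
  define g g' where "g k = dem i (gp n (adj k \<circ> w))" and "g' k = gp n (adj k \<circ> ?w)" for k
  define h where "h = gp n ?w"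
  have E': "of_nat (\<Sum>k\<in>?L. k) * h - euler h = (\<Sum>k\<in>?L. of_nat k * g k)" using E unfolding g_def h_def .
  have step': "g k = g' k" if "k \<in> ?L" "\<not> (w i = k + 1 \<and> w (i + 1) = k)" for k
    using step[OF that] unfolding g_def g'_def .
  have "of_nat (\<Sum>k\<in>?L'. k) * h - euler h = (\<Sum>k\<in>?L'. of_nat k * g' k)"
  proof (cases "w i = w (i + 1) + 1")
    case False
    then have ns: "\<not> (w i = k + 1 \<and> w (i + 1) = k)" for k by auto
    have "?L' = ?L" using L' ns by (auto simp: left_descents_def)
    moreover have "(\<Sum>k\<in>?L. of_nat k * g k) = (\<Sum>k\<in>?L. of_nat k * g' k)"
      by (rule sum.cong) (use step' ns in auto)
    ultimately show ?thesis using E' by simp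
  next
    case True
    define a where "a = w (i + 1)"
    have wa: "w i = a + 1" "w (i + 1) = a" using True by (simp_all add: a_def)
    have ia: "inv w (a + 1) = i" "inv w a = i + 1" using winv(2)[of i] winv(2)[of "i + 1"] unfolding wa by auto
    have "i \<in> {1..n}" "i + 1 \<in> {1..n}" using descent.hyps(2) by auto
    then have "w i \<in> {1..n}" "w (i + 1) \<in> {1..n}" using permutes_in_image[OF perm] by blast+
    then have "a \<in> {1..n}" "a + 1 \<in> {1..n}" unfolding wa by auto
    then have aL: "a \<in> ?L" using ia by (auto simp: left_descents_def)
    have anL: "a \<notin> ?L'" using L'[of a] wa aL by (auto simp: left_descents_def)
    have Leq: "?L = insert a ?L'" using L' aL wa by (auto simp: left_descents_def)
    have "adj a \<circ> w = ?w"
    proof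
      fix x
      show "(adj a \<circ> w) x = ?w x" using wa inj[of x i] inj[of x "i + 1"] by (auto simp: transpose_def)
    qed
    then have sp: "g a = h" unfolding g_def h_def by (simp only: gpw' dem_idem)
    have "(\<Sum>k\<in>?L'. of_nat k * g k) = (\<Sum>k\<in>?L'. of_nat k * g' k)"
    proof (rule sum.cong)
      fix k assume k: "k \<in> ?L'"
      then have "k \<in> ?L" "k \<noteq> a" using Leq anL by auto
      then show "of_nat k * g k = of_nat k * g' k" using step'[of k] wa by auto
    qed simp
    then have "of_nat (a + (\<Sum>k\<in>?L'. k)) * h - euler h = of_nat a * h + (\<Sum>k\<in>?L'. of_nat k * g' k)"
      using E' anL sp unfolding Leq by simp
    then show ?thesis by (simp add: algebra_simps)
  qed
  then show ?case unfolding h_def g'_def by (simp only: comp_def)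
qed

lemmas gp_euler = gpoly_euler[OF gpoly_gp]

section \<open>The Rajchgot code and longest increasing subsequences\<close>

definition lis :: "nat \<Rightarrow> (nat \<Rightarrow> nat) \<Rightarrow> nat \<Rightarrow> nat" where
  "lis n w i = Max {card A | A. A \<subseteq> {i..n} \<and> i \<in> A \<and> strict_mono_on A w}"

lemma lis_set:
  fixes w :: "nat \<Rightarrow> nat"
  assumes "i \<le> n"
  shows "finite {card A | A. A \<subseteq> {i..n} \<and> i \<in> A \<and> strict_mono_on A w}"
    "{card A | A. A \<subseteq> {i..n} \<and> i \<in> A \<and> strict_mono_on A w} \<noteq> {}"
proof -
  have "{card A | A. A \<subseteq> {i..n} \<and> i \<in> A \<and> strict_mono_on A w} \<subseteq> card ` Pow {i..n}" by auto
  then show "finite {card A | A. A \<subseteq> {i..n} \<and> i \<in> A \<and> strict_mono_on A w}" by (rule finite_subset) simp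
  have "strict_mono_on {i} w" by (auto simp: strict_mono_on_def)
  moreover have "{i} \<subseteq> {i..n}" using assms by auto
  ultimately show "{card A | A. A \<subseteq> {i..n} \<and> i \<in> A \<and> strict_mono_on A w} \<noteq> {}" by blast
qed

lemma lis_ge: "A \<subseteq> {i..n} \<Longrightarrow> i \<in> A \<Longrightarrow> strict_mono_on A w \<Longrightarrow> card A \<le> lis n w i"
  unfolding lis_def by (rule Max_ge[OF lis_set(1)]) auto

lemma lis_attained:
  assumes "i \<le> n"
  obtains A where "A \<subseteq> {i..n}" "i \<in> A" "strict_mono_on A w" "lis n w i = card A"
proof -
  have "lis n w i \<in> {card A | A. A \<subseteq> {i..n} \<and> i \<in> A \<and> strict_mono_on A w}"
    unfolding lis_def by (rule Max_in[OF lis_set[OF assms]])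
  then show ?thesis using that by blast
qed

lemma rajchgot_lis:
  assumes "i \<le> n"
  shows "rajchgot_code n w i + lis n w i = n + 1 - i"
proof (rule antisym)
  obtain A where A: "A \<subseteq> {i..n}" "i \<in> A" "strict_mono_on A w" "lis n w i = card A" using lis_attained assms by blast
  let ?S = "{card R | R. R \<subseteq> {i..n} \<and> i \<notin> R \<and> strict_mono_on ({i..n} - R) w}"
  have "?S \<subseteq> card ` Pow {i..n}" by auto
  then have fin: "finite ?S" by (rule finite_subset) simp
  have dd: "{i..n} - ({i..n} - A) = A" using A(1) by auto
  have in_S: "card ({i..n} - A) \<in> ?S"
    using A dd by (intro CollectI exI[of _ "{i..n} - A"]) auto
  have "rajchgot_code n w i \<le> card ({i..n} - A)" unfolding rajchgot_code_def by (rule Min_le[OF fin in_S])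
  also have "\<dots> = n + 1 - i - card A" using A(1) by (simp add: card_Diff_subset finite_subset[OF A(1)])
  finally show "rajchgot_code n w i + lis n w i \<le> n + 1 - i"
    using card_mono[OF _ A(1)] A(4) by simp
  have "Min ?S \<in> ?S" by (rule Min_in[OF fin]) (use in_S in blast)
  then obtain R where R: "R \<subseteq> {i..n}" "i \<notin> R" "strict_mono_on ({i..n} - R) w" "rajchgot_code n w i = card R"
    unfolding rajchgot_code_def by auto
  have "card ({i..n} - R) \<le> lis n w i" by (rule lis_ge) (use R assms in auto)
  then show "n + 1 - i \<le> rajchgot_code n w i + lis n w i"
    using R(1,4) by (simp add: card_Diff_subset finite_subset[OF R(1)])
qed

lemma lis_pos: "i \<le> n \<Longrightarrow> 1 \<le> lis n w i"
  using lis_ge[of "{i}" i n w] by (auto simp: strict_mono_on_def)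

lemma lis_step:
  assumes "i < j" "j \<le> n" "w i < w j"
  shows "lis n w j + 1 \<le> lis n w i"
proof -
  obtain A where A: "A \<subseteq> {j..n}" "j \<in> A" "strict_mono_on A w" "lis n w j = card A" using lis_attained assms by blast
  have fin: "finite A" using A(1) finite_subset by blast
  have ge: "w j \<le> w k" "j \<le> k" if "k \<in> A" for k
    using A that by (cases "j = k"; force simp: strict_mono_on_def)+
  have "strict_mono_on (insert i A) w"
    unfolding strict_mono_on_def
  proof (intro ballI allI impI)
    fix a b assume ab: "a \<in> insert i A \<and> b \<in> insert i A \<and> a < b"
    then show "w a < w b"
      using A(3) ge[of b] ge[of a] assms unfolding strict_mono_on_def by (cases "a = i"; cases "b = i") auto
  qed
  then have "card (insert i A) \<le> lis n w i" by (intro lis_ge) (use A(1) assms in auto)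
  moreover have "i \<notin> A" using ge(2) assms(1) by force
  ultimately show ?thesis using fin A(4) by simp
qed

lemma lis_next:
  assumes "i \<le> n" "lis n w i \<noteq> 1"
  obtains j where "i < j" "j \<le> n" "w i < w j" "lis n w i = lis n w j + 1"
proof -
  obtain A where A: "A \<subseteq> {i..n}" "i \<in> A" "strict_mono_on A w" "lis n w i = card A" using lis_attained assms by blast
  have fin: "finite A" using A(1) finite_subset by blast
  let ?B = "A - {i}"
  have "?B \<noteq> {}"
  proof
    assume "?B = {}"
    then have "A = {i}" using A(2) by auto
    then show False using A(4) assms(2) by simp
  qed
  then have j: "Min ?B \<in> ?B" using fin by (intro Min_in) auto
  let ?j = "Min ?B"
  have ij: "i < ?j" "?j \<le> n" using j A(1) by force+
  have w: "w i < w ?j" using A(2,3) j ij by (auto simp: strict_mono_on_def)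
  have "?B \<subseteq> {?j..n}"
  proof
    fix x assume x: "x \<in> ?B"
    then have "?j \<le> x" using fin by (intro Min_le) auto
    moreover have "x \<le> n" using x A(1) by auto
    ultimately show "x \<in> {?j..n}" by simp
  qed
  moreover have "strict_mono_on ?B w" using A(3) by (auto simp: strict_mono_on_def)
  ultimately have "card ?B \<le> lis n w ?j" using j by (intro lis_ge)
  moreover have "card ?B + 1 = card A" using card_Suc_Diff1[OF fin A(2)] by simp
  moreover have "lis n w ?j + 1 \<le> lis n w i" using lis_step ij w by blast
  ultimately show ?thesis using that[OF ij w] A(4) by simp
qed

text \<open>A longest increasing sequence is pushed forward element by element. The witness
  \<open>k\<close> need not be its next element but only has to start a long enough sequence, which
  permits a detour around a pair whose order \<open>f\<close> reverses.\<close>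

lemma lis_mono_map:
  fixes w u :: "nat \<Rightarrow> nat"
  assumes f: "\<And>j. j \<in> {1..n} \<Longrightarrow> f j \<in> {1..n}"
    and step: "\<And>j. j \<in> {1..n} \<Longrightarrow> lis n w j \<noteq> 1 \<Longrightarrow>
      \<exists>k. j < k \<and> k \<le> n \<and> lis n w j \<le> lis n w k + 1 \<and> f j < f k \<and> u (f j) < u (f k)"
    and j: "j \<in> {1..n}"
  shows "lis n w j \<le> lis n u (f j)"
  using j
proof (induction "n - j" arbitrary: j rule: less_induct)
  case less
  show ?case
  proof (cases "lis n w j = 1")
    case True
    then show ?thesis using lis_pos[of "f j" n u] f[OF less.prems] by simp
  next
    case False
    then obtain k where k: "j < k" "k \<le> n" "lis n w j \<le> lis n w k + 1" "f j < f k" "u (f j) < u (f k)"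
      using step[OF less.prems] by blast
    then have kn: "k \<in> {1..n}" "n - k < n - j" by auto
    have "lis n w k \<le> lis n u (f k)" using less.hyps[OF kn(2,1)] .
    moreover have "lis n u (f k) + 1 \<le> lis n u (f j)" using lis_step[of "f j" "f k" n u] k f[OF kn(1)] by simp
    ultimately show ?thesis using k(3) by simp
  qed
qed

definition raj :: "nat \<Rightarrow> (nat \<Rightarrow> nat) \<Rightarrow> nat" where
  "raj n w = (\<Sum>i\<in>{1..n}. rajchgot_code n w i)"

lemma left_descent_less:
  assumes w: "w permutes {1..n}" and k: "k \<in> left_descents n w" and lt: "w a < w b" "a < b"
  shows "adj k (w a) < adj k (w b)"
proof (rule adj_less[OF lt(1)])
  show "\<not> (w a = k \<and> w b = k + 1)"
  proof
    assume "w a = k \<and> w b = k + 1"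
    then have "inv w k = a" "inv w (k + 1) = b" using permutes_inverses(2)[OF w] by metis+
    then show False using k lt(2) by (simp add: left_descents_def)
  qed
qed

lemma lis_left_mono:
  assumes w: "w permutes {1..n}" and k: "k \<in> left_descents n w" and j: "j \<in> {1..n}"
  shows "lis n w j \<le> lis n (adj k \<circ> w) j"
proof (rule lis_mono_map[where f = "\<lambda>j. j", OF _ _ j])
  fix j assume j: "j \<in> {1..n}" "lis n w j \<noteq> 1"
  then have "j \<le> n" by simp
  from lis_next[OF this j(2)] obtain k' where k': "j < k'" "k' \<le> n" "w j < w k'" "lis n w j = lis n w k' + 1" .
  then show "\<exists>k'. j < k' \<and> k' \<le> n \<and> lis n w j \<le> lis n w k' + 1 \<and> j < k' \<and> (adj k \<circ> w) j < (adj k \<circ> w) k'"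
    using left_descent_less[OF w k k'(3,1)] by (intro exI[of _ k']) simp
qed

text \<open>The only pair of positions that becomes increasing is \<open>?p\<close> followed by
  \<open>?q\<close>. Since \<open>lis\<close> at \<open>?p\<close> already exceeds
  \<open>lis\<close> at \<open>?q\<close>, using this pair gains nothing.\<close>

lemma lis_left_eq:
  assumes w: "w permutes {1..n}" and k: "k \<in> left_descents n w" and j: "j \<in> {1..n}"
    and lt: "lis n w (inv w k) < lis n w (inv w (k + 1))"
  shows "lis n (adj k \<circ> w) j = lis n w j"
proof (rule antisym)
  show "lis n w j \<le> lis n (adj k \<circ> w) j" using lis_left_mono[OF w k j] .
  have winv: "w (inv w x) = x" "inv w (w x) = x" for x using permutes_inverses[OF w] by auto
  let ?u = "adj k \<circ> w" and ?p = "inv w (k + 1)" and ?q = "inv w k"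
  show "lis n ?u j \<le> lis n w j"
    using j
  proof (induction "n - j" arbitrary: j rule: less_induct)
    case less
    show ?case
    proof (cases "lis n ?u j = 1")
      case True
      then show ?thesis using lis_pos[of j n w] less.prems by simp
    next
      case False
      have "j \<le> n" using less.prems by simp
      from lis_next[OF this False] obtain i where i: "j < i" "i \<le> n" "?u j < ?u i" "lis n ?u j = lis n ?u i + 1" .
      then have "i \<in> {1..n}" "n - i < n - j" by auto
      then have IH: "lis n ?u i \<le> lis n w i" using less.hyps by blast
      show ?thesis
      proof (cases "w j < w i")
        case True
        then show ?thesis using lis_step[of j i n w] i IH by simp
      next
        case False
        then have "w j > w i \<or> j = i" using winv by (metis linorder_neqE_nat)
        then have gt: "w i < w j" using i(1) by simp
        have "w i = k \<and> w j = k + 1"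
        proof (rule ccontr)
          assume "\<not> (w i = k \<and> w j = k + 1)"
          from adj_less[OF gt this] i(3) show False by simp
        qed
        then have "i = ?q" "j = ?p" using winv by metis+
        then show ?thesis using lt i(4) IH by simp
      qed
    qed
  qed
qed

lemma raj_left_mono:
  assumes w: "w permutes {1..n}" and k: "k \<in> left_descents n w"
  shows "j \<in> {1..n} \<Longrightarrow> rajchgot_code n (adj k \<circ> w) j \<le> rajchgot_code n w j" "raj n (adj k \<circ> w) \<le> raj n w"
proof -
  show le: "rajchgot_code n (adj k \<circ> w) j \<le> rajchgot_code n w j" if "j \<in> {1..n}" for j
    using lis_left_mono[OF w k that] rajchgot_lis[of j n w] rajchgot_lis[of j n "adj k \<circ> w"] that by simp
  show "raj n (adj k \<circ> w) \<le> raj n w" unfolding raj_def by (rule sum_mono) (use le in auto)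
qed

text \<open>With \<open>des v\<close> the number of left descents from \<open>v\<close> on, the sum
  of the left descents is the sum of all \<open>des v\<close>. Along an increasing subsequence, each
  step from \<open>v\<close> to \<open>v'\<close> passes a value that is not a left descent; hence
  \<open>lis\<close> and \<open>des\<close> at \<open>v\<close> add up to at most
  \<open>n + 1 - v\<close>, and this is summed over \<open>v\<close>.\<close>

lemma maj_le_raj:
  assumes w: "w permutes {1..n}"
  shows "(\<Sum>k\<in>left_descents n w. k) \<le> raj n w"
proof -
  let ?L = "left_descents n w"
  let ?h = "\<lambda>v. lis n w (inv w v)"
  define des where "des v = card {k \<in> ?L. v \<le> k}" for v
  have winv: "w (inv w x) = x" "inv w (w x) = x" for x using permutes_inverses[OF w] by auto
  have vr: "inv w v \<in> {1..n}" if "v \<in> {1..n}" for v using permutes_in_image[OF permutes_inv[OF w]] that by blast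
  have des_split: "des v + 1 \<le> des v' + (v' - v)" if vv: "v < v'" "inv w v < inv w v'" "v \<in> {1..n}" "v' \<in> {1..n}" for v v'
  proof -
    \<comment> \<open>A run of left descents from \<open>v\<close> up to \<open>v'\<close> would
      place \<open>v'\<close> before \<open>v\<close> in the one-line notation.\<close>
    have "\<not> {v..<v'} \<subseteq> ?L"
    proof
      assume a: "{v..<v'} \<subseteq> ?L"
      have "v < x \<Longrightarrow> x \<le> v' \<Longrightarrow> inv w x < inv w v" for x
      proof (induction x)
        case (Suc x)
        then have "x \<in> ?L" using a by auto
        then have "inv w (Suc x) < inv w x" by (simp add: left_descents_def)
        then show ?case using Suc by (cases "v = x") auto
      qed simp
      from this[of v'] vv show False by simp
    qed
    then have "?L \<inter> {v..<v'} \<subset> {v..<v'}" by blast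
    from psubset_card_mono[OF _ this] have "card (?L \<inter> {v..<v'}) < v' - v" by simp
    moreover have "des v \<le> card (?L \<inter> {v..<v'}) + des v'"
    proof -
      have "{k \<in> ?L. v \<le> k} \<subseteq> (?L \<inter> {v..<v'}) \<union> {k \<in> ?L. v' \<le> k}" by auto
      then have "des v \<le> card ((?L \<inter> {v..<v'}) \<union> {k \<in> ?L. v' \<le> k})" unfolding des_def by (intro card_mono) auto
      also have "\<dots> \<le> card (?L \<inter> {v..<v'}) + des v'" unfolding des_def by (rule card_Un_le)
      finally show ?thesis .
    qed
    ultimately show ?thesis by simp
  qed
  have key: "v \<in> {1..n} \<Longrightarrow> ?h v + des v \<le> n + 1 - v" for v
  proof (induction "n - inv w v" arbitrary: v rule: less_induct)
    case less
    note v = vr[OF less.prems]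
    show ?case
    proof (cases "?h v = 1")
      case True
      have "{k \<in> ?L. v \<le> k} \<subseteq> {v..<n}" by (auto simp: left_descents_def)
      from card_mono[OF _ this] have "des v \<le> n - v" unfolding des_def by simp
      moreover have "v \<le> n" using less.prems by simp
      ultimately show ?thesis using True by linarith
    next
      case False
      have "inv w v \<le> n" using v by simp
      from lis_next[OF this False] obtain j where j: "inv w v < j" "j \<le> n" "v < w j" "?h v = lis n w j + 1"
        unfolding winv .
      let ?v = "w j"
      have r: "?v \<in> {1..n}" using permutes_in_image[OF w, of j] j v by auto
      have "n - inv w ?v < n - inv w v" using j unfolding winv by auto
      from less.hyps[OF this r] have "lis n w j + des ?v \<le> n + 1 - ?v" unfolding winv .
      moreover have "des v + 1 \<le> des ?v + (?v - v)" by (rule des_split) (use j less.prems r winv in auto)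
      ultimately show ?thesis using j(3,4) r by simp
    qed
  qed
  have "(\<Sum>k\<in>?L. k) = (\<Sum>k\<in>?L. \<Sum>v\<in>{1..n}. if v \<le> k then 1 else 0)"
  proof (rule sum.cong)
    fix k assume "k \<in> ?L"
    then have "{v \<in> {1..n}. v \<le> k} = {1..k}" by (auto simp: left_descents_def)
    then show "k = (\<Sum>v\<in>{1..n}. if v \<le> k then 1 else 0)" by (simp add: sum.inter_filter[symmetric])
  qed simp
  also have "\<dots> = (\<Sum>v\<in>{1..n}. des v)"
    unfolding des_def by (subst sum.swap) (simp add: sum.inter_filter[symmetric])
  finally have M: "(\<Sum>k\<in>?L. k) = (\<Sum>v\<in>{1..n}. des v)" .
  have H: "(\<Sum>v\<in>{1..n}. ?h v) = (\<Sum>j\<in>{1..n}. lis n w j)"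
    using sum.permute[OF permutes_inv[OF w], of "lis n w"] by (simp add: comp_def)
  have "(\<Sum>k\<in>?L. k) + (\<Sum>v\<in>{1..n}. ?h v) \<le> (\<Sum>v\<in>{1..n}. n + 1 - v)"
    unfolding M sum.distrib[symmetric] by (rule sum_mono) (use key in \<open>auto simp: add.commute\<close>)
  also have "\<dots> = (\<Sum>j\<in>{1..n}. rajchgot_code n w j + lis n w j)"
    by (rule sum.cong) (use rajchgot_lis in auto)
  also have "\<dots> = raj n w + (\<Sum>j\<in>{1..n}. lis n w j)" unfolding raj_def by (simp add: sum.distrib)
  finally show ?thesis unfolding H by simp
qed

lemma perm_length_left_descent:
  assumes w: "w permutes {1..n}" and k: "k \<in> left_descents n w"
  shows "perm_length n (adj k \<circ> w) + 1 = perm_length n w"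
proof -
  have winv: "w (inv w x) = x" "inv w (w x) = x" for x using permutes_inverses[OF w] by auto
  let ?I = "\<lambda>w. {(a, b). 1 \<le> a \<and> a < b \<and> b \<le> n \<and> (w b :: nat) < w a}"
  let ?p = "(inv w (k + 1), inv w k)"
  have fin: "finite (?I w)" for w by (rule finite_subset[of _ "{1..n} \<times> {1..n}"]) auto
  have kr: "k \<in> {1..n}" "k + 1 \<in> {1..n}" "inv w (k + 1) < inv w k" using k by (auto simp: left_descents_def)
  have "inv w (k + 1) \<in> {1..n}" "inv w k \<in> {1..n}"
    using permutes_in_image[OF permutes_inv[OF w]] kr by blast+
  then have p: "?p \<in> ?I w" using kr winv by auto
  have "(a, b) \<in> ?I (adj k \<circ> w) \<longleftrightarrow> (a, b) \<in> ?I w - {?p}" for a b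
  proof (cases "1 \<le> a \<and> a < b \<and> b \<le> n")
    case True
    have ne: "w a \<noteq> w b" using True inj_eq[OF permutes_inj[OF w], of a b] by simp
    have "adj k (w b) < adj k (w a) \<longleftrightarrow> w b < w a \<and> \<not> (w b = k \<and> w a = k + 1)"
    proof
      assume l: "adj k (w b) < adj k (w a)"
      then have "\<not> w a < w b" using left_descent_less[OF w k, of a b] True by auto
      then show "w b < w a \<and> \<not> (w b = k \<and> w a = k + 1)" using ne l by auto
    qed (use adj_less in blast)
    moreover have "w b = k \<and> w a = k + 1 \<longleftrightarrow> (a, b) = ?p"
      using winv(1)[of k] winv(1)[of "k + 1"] winv(2)[of a] winv(2)[of b] by auto
    ultimately show ?thesis using True by auto
  qed auto
  then have "?I (adj k \<circ> w) = ?I w - {?p}" by auto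
  then show ?thesis unfolding perm_length_inversions using card_Suc_Diff1[OF fin p] by simp
qed

section \<open>A lower bound for the degree\<close>

definition raj_mon :: "nat \<Rightarrow> (nat \<Rightarrow> nat) \<Rightarrow> mon" where
  "raj_mon n w = Poly_Mapping.Abs_poly_mapping (\<lambda>j. if j \<in> {1..n} then rajchgot_code n w j else 0)"

lemma lookup_raj_mon: "lookup (raj_mon n w) j = (if j \<in> {1..n} then rajchgot_code n w j else 0)"
proof -
  have "finite {j. (if j \<in> {1..n} then rajchgot_code n w j else 0) \<noteq> 0}"
    by (rule finite_subset[of _ "{1..n}"]) auto
  then show ?thesis unfolding raj_mon_def by (simp add: lookup_Abs_poly_mapping)
qed

lemma mdeg_raj_mon: "mdeg (raj_mon n w) = raj n w"
proof -
  have "mdeg (raj_mon n w) = (\<Sum>j\<in>{1..n}. lookup (raj_mon n w) j)"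
    by (rule mdeg_superset) (auto simp: in_keys_iff lookup_raj_mon split: if_splits)
  then show ?thesis by (simp add: lookup_raj_mon raj_def)
qed

text \<open>The factor on the left vanishes only in degree maj; in every other degree the
  coefficients are determined by those of shorter permutations.\<close>

lemma coeff_euler:
  assumes "w permutes {1..n}"
  shows "(int (\<Sum>k\<in>left_descents n w. k) - int (mdeg m)) * lookup (gp n w) m =
    (\<Sum>k\<in>left_descents n w. int k * lookup (gp n (adj k \<circ> w)) m)"
  using arg_cong[OF gp_euler[OF assms], of "\<lambda>f. lookup f m"]
  by (simp only: lookup_minus lookup_of_nat_mult lookup_euler lookup_sum left_diff_distrib)

lemma left_descent_permutes: "w permutes {1..n} \<Longrightarrow> k \<in> left_descents n w \<Longrightarrow> adj k \<circ> w permutes {1..n}"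
  by (rule permutes_adj_comp) (auto simp: left_descents_def)

text \<open>Left descents do not increase \<open>raj\<close>, so the right side of
  \<open>coeff_euler\<close> vanishes by induction. The factor on the left is nonzero since the
  degree exceeds \<open>raj\<close>, which by \<open>maj_le_raj\<close> bounds maj.\<close>

lemma gp_coeff_high:
  assumes "w permutes {1..n}" "raj n w < mdeg m"
  shows "lookup (gp n w) m = 0"
  using assms
proof (induction "perm_length n w" arbitrary: w rule: less_induct)
  case less
  have "lookup (gp n (adj k \<circ> w)) m = 0" if k: "k \<in> left_descents n w" for k
  proof (rule less.hyps)
    show "perm_length n (adj k \<circ> w) < perm_length n w" using perm_length_left_descent[OF less.prems(1) k] by simp
    show "adj k \<circ> w permutes {1..n}" using left_descent_permutes[OF less.prems(1) k] .
    show "raj n (adj k \<circ> w) < mdeg m" using raj_left_mono(2)[OF less.prems(1) k] less.prems(2) by simp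
  qed
  then have "(\<Sum>k\<in>left_descents n w. int k * lookup (gp n (adj k \<circ> w)) m) = 0"
    by (intro sum.neutral) auto
  then have "(int (\<Sum>k\<in>left_descents n w. k) - int (mdeg m)) * lookup (gp n w) m = 0"
    using coeff_euler[OF less.prems(1), of m] by simp
  moreover have "(\<Sum>k\<in>left_descents n w. k) < mdeg m" using maj_le_raj[OF less.prems(1)] less.prems(2) by simp
  then have "int (\<Sum>k\<in>left_descents n w. k) - int (mdeg m) \<noteq> 0" by linarith
  ultimately show ?case by (simp only: mult_eq_0_iff) simp
qed

section \<open>Permutations avoiding 132\<close>

definition avoids_132 :: "nat \<Rightarrow> (nat \<Rightarrow> nat) \<Rightarrow> bool" where
  "avoids_132 n w \<longleftrightarrow> \<not> (\<exists>a b c. 1 \<le> a \<and> a < b \<and> b < c \<and> c \<le> n \<and> w a < w c \<and> w c < w b)"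

text \<open>Without a 132 pattern starting at \<open>i\<close>, all later larger values increase, so
  an optimal removal deletes exactly the later smaller ones.\<close>

lemma avoids_132_code:
  assumes inj: "inj w" and av: "avoids_132 n w" and i: "i \<in> {1..n}"
  shows "rajchgot_code n w i = lehmer_code n w i"
proof -
  let ?G = "{j \<in> {i<..n}. w i < w j}" and ?S = "{j \<in> {i<..n}. w j < w i}"
  have iff: "w a = w b \<longleftrightarrow> a = b" for a b using inj_eq[OF inj] .
  have "strict_mono_on (insert i ?G) w"
    unfolding strict_mono_on_def
  proof (intro ballI allI impI)
    fix a b assume ab: "a \<in> insert i ?G \<and> b \<in> insert i ?G \<and> a < b"
    show "w a < w b"
    proof (cases "a = i")
      case True then show ?thesis using ab by auto
    next
      case False
      then have "1 \<le> i" "i < a" "a < b" "b \<le> n" "w i < w b" using ab i by auto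
      then have "\<not> w b < w a" using av unfolding avoids_132_def by blast
      then show ?thesis using iff[of a b] ab by auto
    qed
  qed
  then have "card (insert i ?G) \<le> lis n w i" using i by (intro lis_ge) auto
  moreover have "lis n w i \<le> card (insert i ?G)"
  proof -
    have "i \<le> n" using i by simp
    then obtain A where A: "A \<subseteq> {i..n}" "i \<in> A" "strict_mono_on A w" "lis n w i = card A" using lis_attained by blast
    have "A \<subseteq> insert i ?G"
    proof
      fix x assume x: "x \<in> A"
      show "x \<in> insert i ?G"
      proof (cases "x = i")
        case False
        then have "i < x" "x \<le> n" using A(1) x by force+
        then show ?thesis using A(2,3) x by (auto simp: strict_mono_on_def)
      qed simp
    qed
    then show ?thesis using card_mono[of "insert i ?G" A] A(4) by simp
  qed
  ultimately have l: "lis n w i = card ?G + 1" by simp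
  have "{i<..n} = ?G \<union> ?S" using iff by (auto simp: not_less_iff_gr_or_eq)
  then have "n - i = card (?G \<union> ?S)" by (metis card_greaterThanAtMost)
  also have "\<dots> = card ?G + card ?S" by (rule card_Un_disjoint) auto
  finally show ?thesis using rajchgot_lis[of i n w] l i unfolding lehmer_code_def by auto
qed

lemma lehmer_code_adj:
  assumes i: "i \<in> {1..<n}" and asc: "w i < w (i + 1)"
  shows "lehmer_code n (w \<circ> adj i) i = lehmer_code n w (i + 1) + 1"
    "lehmer_code n (w \<circ> adj i) (i + 1) = lehmer_code n w i"
    "j \<noteq> i \<Longrightarrow> j \<noteq> i + 1 \<Longrightarrow> lehmer_code n (w \<circ> adj i) j = lehmer_code n w j"
proof -
  have "{j \<in> {i<..n}. (w \<circ> adj i) j < (w \<circ> adj i) i} = insert (i + 1) {j \<in> {i + 1<..n}. w j < w (i + 1)}"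
    using i asc by (auto simp: transpose_def)
  then show "lehmer_code n (w \<circ> adj i) i = lehmer_code n w (i + 1) + 1" unfolding lehmer_code_def by simp
  have "{j \<in> {i + 1<..n}. (w \<circ> adj i) j < (w \<circ> adj i) (i + 1)} = {j \<in> {i<..n}. w j < w i}"
    using i asc by (auto simp: transpose_def)
  then show "lehmer_code n (w \<circ> adj i) (i + 1) = lehmer_code n w i" unfolding lehmer_code_def by simp
  assume j: "j \<noteq> i" "j \<noteq> i + 1"
  have r: "adj i x \<in> {j<..n} \<longleftrightarrow> x \<in> {j<..n}" for x using i j by (auto simp: transpose_def)
  have wj: "w (adj i j) = w j" using j by (simp add: transpose_apply_other)
  have "{x \<in> {j<..n}. w (adj i x) < w (adj i j)} = adj i ` {x \<in> {j<..n}. w x < w j}"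
  proof (intro equalityI subsetI)
    fix x assume "x \<in> {x \<in> {j<..n}. w (adj i x) < w (adj i j)}"
    then have "adj i x \<in> {x \<in> {j<..n}. w x < w j}" using r wj by auto
    then show "x \<in> adj i ` {x \<in> {j<..n}. w x < w j}" by (rule rev_image_eqI) simp
  next
    fix x assume "x \<in> adj i ` {x \<in> {j<..n}. w x < w j}"
    then obtain y where "x = adj i y" "y \<in> {j<..n}" "w y < w j" by auto
    then show "x \<in> {x \<in> {j<..n}. w (adj i x) < w (adj i j)}" using r[of y] wj by auto
  qed
  then have "card {x \<in> {j<..n}. w (adj i x) < w (adj i j)} = card {x \<in> {j<..n}. w x < w j}"
    by (simp only:) (rule card_image, simp)
  then show "lehmer_code n (w \<circ> adj i) j = lehmer_code n w j" unfolding lehmer_code_def by simp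
qed

lemma lehmer_code_longest: "i \<in> {1..n} \<Longrightarrow> lehmer_code n (longest_perm n) i = n - i"
proof -
  assume "i \<in> {1..n}"
  then have "{j \<in> {i<..n}. longest_perm n j < longest_perm n i} = {i<..n}" by (auto simp: longest_perm_def)
  then show ?thesis unfolding lehmer_code_def by simp
qed

text \<open>Induction downwards from the longest permutation. All values before the first ascent
  \<open>i\<close> exceed \<open>w i\<close>, so exchanging there creates no 132 pattern. No later
  value lies between \<open>w i\<close> and \<open>w (i + 1)\<close>, so both positions have the
  same Lehmer code and \<open>dem_prod\<close> applies.\<close>

lemma gp_avoids_132:
  assumes "w permutes {1..n}" "avoids_132 n w"
  shows "gp n w = (\<Prod>j\<in>{1..n}. (1 - X j) ^ lehmer_code n w j)"
  using assms
proof (induction "n * n - perm_length n w" arbitrary: w rule: less_induct)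
  case less
  note perm = less.prems(1) and av = less.prems(2)
  have inj: "w a = w b \<longleftrightarrow> a = b" for a b using inj_eq[OF permutes_inj[OF perm]] .
  show ?case
  proof (cases "w = longest_perm n")
    case True
    have "(\<Prod>j\<in>{1..n}. (1 - X j) ^ (n - j)) = (\<Prod>j\<in>{1..n}. (1 - X j) ^ lehmer_code n (longest_perm n) j)"
      by (rule prod.cong) (simp_all add: lehmer_code_longest)
    then show ?thesis unfolding True gp_longest .
  next
    case False
    then have ex: "\<exists>i. i \<in> {1..<n} \<and> w i < w (i + 1)" using exists_ascent[OF perm] by blast
    define i where "i = (LEAST i. i \<in> {1..<n} \<and> w i < w (i + 1))"
    have i: "i \<in> {1..<n}" "w i < w (i + 1)" using LeastI_ex[OF ex] unfolding i_def by blast+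
    have before: "w (j + 1) < w j" if j: "1 \<le> j" "j < i" for j
    proof -
      have "\<not> (j \<in> {1..<n} \<and> w j < w (j + 1))" using not_less_Least j(2) unfolding i_def by blast
      moreover have "j \<in> {1..<n}" using j i(1) by auto
      ultimately have "\<not> w j < w (j + 1)" by simp
      then show ?thesis using inj[of j "j + 1"] by simp
    qed
    have bigger: "1 \<le> a \<Longrightarrow> w i < w a" if "a < i" for a
      using that
    proof (induction rule: strict_inc_induct)
      case (base a)
      then show ?case using before[of a] by simp
    next
      case (step a)
      then show ?case using before[of a] by simp
    qed
    let ?w = "w \<circ> adj i"
    have av': "avoids_132 n ?w"
      unfolding avoids_132_def
    proof
      assume "\<exists>a b c. 1 \<le> a \<and> a < b \<and> b < c \<and> c \<le> n \<and> ?w a < ?w c \<and> ?w c < ?w b"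
      then obtain a b c where abc: "1 \<le> a" "a < b" "b < c" "c \<le> n" "w (adj i a) < w (adj i c)" "w (adj i c) < w (adj i b)" by auto
      have nab: "\<not> (a = i \<and> b = i + 1)" using abc i(2) by auto
      have nbc: "\<not> (b = i \<and> c = i + 1)"
      proof
        assume "b = i \<and> c = i + 1"
        then have "a < i" "w a < w i" using abc by (auto simp: transpose_apply_other)
        then show False using bigger[OF _ abc(1)] by simp
      qed
      have "1 \<le> adj i a" "adj i c \<le> n" using abc i(1) by (auto simp: transpose_def)
      then show False using av adj_less[OF abc(2) nab] adj_less[OF abc(3) nbc] abc(5,6)
        unfolding avoids_132_def by blast
    qed
    have pl: "perm_length n ?w = perm_length n w + 1" by (rule perm_length_ascent[OF i])
    then have "n * n - perm_length n ?w < n * n - perm_length n w" using perm_length_le[of n ?w] by simp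
    from less.hyps[OF this permutes_comp_adj[OF perm i(1)] av']
    have IH: "gp n ?w = (\<Prod>j\<in>{1..n}. (1 - X j) ^ lehmer_code n ?w j)" .
    have c: "lehmer_code n w i = lehmer_code n w (i + 1)"
    proof -
      have "{j \<in> {i<..n}. w j < w i} = {j \<in> {i + 1<..n}. w j < w (i + 1)}"
      proof (intro equalityI subsetI)
        fix j assume j: "j \<in> {j \<in> {i<..n}. w j < w i}"
        then have "j \<noteq> i + 1" using i(2) by auto
        then show "j \<in> {j \<in> {i + 1<..n}. w j < w (i + 1)}" using j i(2) by auto
      next
        fix j assume j: "j \<in> {j \<in> {i + 1<..n}. w j < w (i + 1)}"
        have "1 \<le> i" "i < i + 1" "i + 1 < j" "j \<le> n" using i j by auto
        then have "\<not> (w i < w j)" using av j unfolding avoids_132_def by blast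
        then show "j \<in> {j \<in> {i<..n}. w j < w i}" using inj[of i j] j by auto
      qed
      then show ?thesis unfolding lehmer_code_def by simp
    qed
    note la = lehmer_code_adj[where w = w, OF i]
    have "gp n w = gp n (?w \<circ> adj i)" by simp
    also have "\<dots> = dem i (gp n ?w)"
      by (rule gp_descent[OF permutes_comp_adj[OF perm i(1)] i(1)]) (use i(2) in simp)
    also have "\<dots> = (\<Prod>j\<in>{1..n}. (1 - X j) ^ ((lehmer_code n ?w)(i := lehmer_code n ?w i - 1)) j)"
      unfolding IH by (rule dem_prod[OF i(1)]) (use la c in simp)
    also have "\<dots> = (\<Prod>j\<in>{1..n}. (1 - X j) ^ lehmer_code n w j)"
    proof (rule prod.cong)
      fix j
      have "((lehmer_code n ?w)(i := lehmer_code n ?w i - 1)) j = lehmer_code n w j"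
        using la c by (cases "j = i"; cases "j = i + 1") auto
      then show "(1 - X j) ^ ((lehmer_code n ?w)(i := lehmer_code n ?w i - 1)) j = (1 - X j) ^ lehmer_code n w j" by simp
    qed simp
    finally show ?thesis .
  qed
qed

section \<open>Degrees under the substitution\<close>

lemma comp_mon_leading:
  "\<exists>g. comp_mon m = (-1) ^ mdeg m * frag_of m + g \<and> (\<forall>m'\<in>keys g. mdeg m' < mdeg m)"
proof (induction m rule: mon_induct)
  case zero
  show ?case by (intro exI[of _ 0]) (simp add: comp_mon_def)
next
  case (add m i)
  then obtain g where g: "comp_mon m = (-1) ^ mdeg m * frag_of m + g" "\<And>m'. m' \<in> keys g \<Longrightarrow> mdeg m' < mdeg m" by auto
  have s: "comp_mon (single i 1) = 1 - X i" by (simp add: comp_mon_def)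
  let ?h = "(-1) ^ mdeg m * frag_of m + (g - g * X i)"
  have "comp_mon (m + single i 1) = ((-1) ^ mdeg m * frag_of m + g) * (1 - X i)"
    unfolding comp_mon_add s g(1) ..
  also have "\<dots> = - ((-1) ^ mdeg m * (frag_of m * X i)) + ?h" by (simp add: algebra_simps)
  also have "- ((-1) ^ mdeg m * (frag_of m * X i)) = (-1) ^ mdeg (m + single i 1) * frag_of (m + single i 1)"
    by (simp add: mdeg_add frag_of_add X_frag del: mult_single)
  finally have 1: "comp_mon (m + single i 1) =
    (-1) ^ mdeg (m + single i 1) * frag_of (m + single i 1) + ?h" .
  have sg: "keys ((-1) ^ k * frag_of m :: int_mpoly) \<subseteq> {m}" for k
    by (cases "even k") auto
  have "mdeg m' < mdeg (m + single i 1)" if "m' \<in> keys ?h" for m'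
  proof -
    have "m' \<in> keys ((-1) ^ mdeg m * frag_of m :: int_mpoly) \<or> m' \<in> keys (g - g * X i)"
      using subsetD[OF keys_add that] by blast
    moreover have "m' \<in> keys g \<or> m' \<in> keys (g * X i)" if "m' \<in> keys (g - g * X i)"
      using subsetD[OF keys_diff that] by blast
    moreover have "mdeg m' < mdeg m + 1" if gX: "m' \<in> keys (g * X i)"
    proof -
      obtain a b where ab: "m' = a + b" "a \<in> keys g" "b \<in> keys (X i)"
        using subsetD[OF keys_mult gX] by blast
      then have "b = single i 1" by (simp add: X_frag)
      then show ?thesis using ab g(2)[OF ab(2)] by (simp add: mdeg_add)
    qed
    ultimately show ?thesis using sg[of "mdeg m"] g(2)[of m'] by (auto simp: mdeg_add)
  qed
  then show ?case using 1 by blast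
qed

lemma comp_mon_keys: "m' \<in> keys (comp_mon m) \<Longrightarrow> m' = m \<or> mdeg m' < mdeg m"
  and comp_mon_lookup: "lookup (comp_mon m) m = (-1) ^ mdeg m"
proof -
  obtain g where g: "comp_mon m = (-1) ^ mdeg m * frag_of m + g" "\<And>m'. m' \<in> keys g \<Longrightarrow> mdeg m' < mdeg m"
    using comp_mon_leading by blast
  have l: "lookup ((-1) ^ k * frag_of m :: int_mpoly) m' = (if m' = m then (-1) ^ k else 0)" for k m'
    by (cases "even k") auto
  have g0: "lookup g m = 0" using g(2)[of m] by (auto simp: in_keys_iff)
  show "lookup (comp_mon m) m = (-1) ^ mdeg m" unfolding g(1) by (simp only: lookup_add l g0) simp
  assume "m' \<in> keys (comp_mon m)"
  then have "m' = m \<or> m' \<in> keys g" unfolding g(1) in_keys_iff lookup_add l by (auto split: if_splits)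
  then show "m' = m \<or> mdeg m' < mdeg m" using g(2) by blast
qed

lemma total_degree_mdeg: "total_degree f = Max (insert 0 (mdeg ` keys f))"
  by (simp add: total_degree_def mdeg_def[abs_def])

lemma mdeg_le_total_degree: "m \<in> keys f \<Longrightarrow> mdeg m \<le> total_degree f"
  unfolding total_degree_mdeg by (intro Max_ge) auto

lemma mdeg_le_total_degree_complement:
  assumes "m \<in> keys (complement f)"
  shows "mdeg m \<le> total_degree f"
proof -
  obtain m' where m': "m' \<in> keys f" "m \<in> keys (comp_mon m')"
    using subsetD[OF keys_frag_extend assms[unfolded complement_def]] by blast
  then show ?thesis using comp_mon_keys[OF m'(2)] mdeg_le_total_degree[OF m'(1)] by auto
qed

section \<open>Extremal monomials of top degree\<close>

definition decreasing_lis :: "nat \<Rightarrow> (nat \<Rightarrow> nat) \<Rightarrow> bool" where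
  "decreasing_lis n w \<longleftrightarrow> (\<forall>u v. 1 \<le> u \<longrightarrow> u \<le> v \<longrightarrow> v \<le> n \<longrightarrow> lis n w (inv w v) \<le> lis n w (inv w u))"

text \<open>If \<open>lis\<close> grows from the value \<open>k\<close> to \<open>k + 1\<close>,
  then \<open>k + 1\<close> must stand to the left of \<open>k\<close>, by \<open>lis_step\<close>.
  For such a \<open>k\<close>, \<open>lis_left_eq\<close> shows that the Rajchgot code is kept, so
  the recursion has a summand of full degree.\<close>

lemma not_decreasing_lis:
  assumes w: "w permutes {1..n}" and nd: "\<not> decreasing_lis n w"
  obtains k where "k \<in> left_descents n w" "lis n w (inv w k) < lis n w (inv w (k + 1))"
proof -
  have winv: "w (inv w x) = x" "inv w (w x) = x" for x using permutes_inverses[OF w] by auto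
  have "\<exists>k\<in>{1..<n}. lis n w (inv w k) < lis n w (inv w (k + 1))"
  proof (rule ccontr)
    assume "\<not> (\<exists>k\<in>{1..<n}. lis n w (inv w k) < lis n w (inv w (k + 1)))"
    then have le: "lis n w (inv w (k + 1)) \<le> lis n w (inv w k)" if "1 \<le> k" "k < n" for k
      using that by (meson atLeastLessThan_iff not_le)
    have "u \<le> v \<Longrightarrow> 1 \<le> u \<Longrightarrow> v \<le> n \<Longrightarrow> lis n w (inv w v) \<le> lis n w (inv w u)" for u v
    proof (induction v rule: dec_induct)
      case (step v)
      then show ?case using le[of v] by simp
    qed simp
    then show False using nd unfolding decreasing_lis_def by blast
  qed
  then obtain k where k: "k \<in> {1..<n}" "lis n w (inv w k) < lis n w (inv w (k + 1))" by blast
  have "inv w (k + 1) < inv w k"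
  proof (rule ccontr)
    assume "\<not> inv w (k + 1) < inv w k"
    moreover have "inv w (k + 1) \<noteq> inv w k" using winv(1)[of k] winv(1)[of "k + 1"] by auto
    ultimately have "inv w k < inv w (k + 1)" by simp
    moreover have "k + 1 \<in> {1..n}" using k(1) by auto
    then have "inv w (k + 1) \<in> {1..n}" using permutes_in_image[OF permutes_inv[OF w]] by blast
    ultimately show False using lis_step[of "inv w k" "inv w (k + 1)" n w] k(2) winv by simp
  qed
  then show ?thesis using that[of k] k by (simp add: left_descents_def)
qed

text \<open>Shifted by \<open>(1, 2, \<dots>, n)\<close>, the exponents of all monomials of top degree lie in the convex hull
  of the permutations of the shifted Rajchgot code; the strictly convex \<open>energy\<close> is maximal only at
  these permutations. An operator \<open>dem i\<close> does not leave the hull, so extremal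
  coefficients can be followed without knowing the others.\<close>

definition energy :: "nat \<Rightarrow> mon \<Rightarrow> int" where
  "energy n m = (\<Sum>i\<in>{1..n}. (int (lookup m i) + int i)\<^sup>2)"

text \<open>With the sum of the two exponents fixed, the change is quadratic in \<open>k\<close>. It
  vanishes at \<open>k = p\<close>, where nothing changes, and at \<open>k = q + 1\<close>, where
  the shifted exponents \<open>p + i\<close> and \<open>q + i + 1\<close> are exchanged.\<close>

lemma energy_mono_xy:
  fixes m :: mon
  assumes i: "i \<in> {1..<n}"
  defines "p \<equiv> lookup m i" and "q \<equiv> lookup m (i + 1)"
  assumes s: "k + l = p + q"
  shows "energy n (mono_xy i m k l) - energy n m = 2 * ((int k - int p) * (int k - int q - 1))"
proof -
  have rem: "energy n m' = (int (lookup m' i) + int i)\<^sup>2 + ((int (lookup m' (i + 1)) + int (i + 1))\<^sup>2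
      + (\<Sum>j\<in>{1..n} - {i} - {i + 1}. (int (lookup m' j) + int j)\<^sup>2))" for m'
  proof -
    have "i \<in> {1..n}" "i + 1 \<in> {1..n} - {i}" using i by auto
    then show ?thesis unfolding energy_def
      by (simp only: sum.remove[of "{1..n}" i] sum.remove[of "{1..n} - {i}" "i + 1"] finite_atLeastAtMost finite_Diff)
  qed
  have "(\<Sum>j\<in>{1..n} - {i} - {i + 1}. (int (lookup (mono_xy i m k l) j) + int j)\<^sup>2)
     = (\<Sum>j\<in>{1..n} - {i} - {i + 1}. (int (lookup m j) + int j)\<^sup>2)"
    by (rule sum.cong) (auto simp: lookup_mono_xy)
  then have "energy n (mono_xy i m k l) - energy n m = (int k + int i)\<^sup>2 + (int l + int (i + 1))\<^sup>2 - (int p + int i)\<^sup>2 - (int q + int (i + 1))\<^sup>2"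
    unfolding rem p_def q_def by (simp add: lookup_mono_xy)
  moreover have "int l = int p + int q - int k" using s by linarith
  ultimately show ?thesis by (simp add: power2_eq_square algebra_simps)
qed

lemma energy_dem_mon:
  fixes m :: mon
  assumes i: "i \<in> {1..<n}" and m': "m' \<in> keys (dem_mon i m)"
  defines "p \<equiv> lookup m i" and "q \<equiv> lookup m (i + 1)"
  shows "energy n m' \<le> energy n m"
    "q < p \<Longrightarrow> m' \<noteq> mono_xy i m (q + 1) (p - 1) \<Longrightarrow> energy n m' < energy n m"
proof -
  obtain k where k: "m' = mono_xy i m k (p + q - k)" "p \<le> q \<and> p \<le> k \<and> k \<le> q \<or> q < p \<and> q < k \<and> k < p"
    using dem_mon_cases[OF m'] unfolding p_def q_def by blast
  then have "k \<le> p + q" by auto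
  then have e: "energy n m' - energy n m = 2 * ((int k - int p) * (int k - int q - 1))"
    unfolding k(1) using energy_mono_xy[OF i, of k "p + q - k" m] unfolding p_def q_def by simp
  have "(int k - int p) * (int k - int q - 1) \<le> 0"
    using k(2) by (auto simp: mult_le_0_iff)
  then show "energy n m' \<le> energy n m" using e by linarith
  assume lt: "q < p" and ne: "m' \<noteq> mono_xy i m (q + 1) (p - 1)"
  have "k \<noteq> q + 1" using ne k lt by auto
  then have "(int k - int p) * (int k - int q - 1) < 0" using k(2) lt by (auto simp: mult_less_0_iff)
  then show "energy n m' < energy n m" using e by linarith
qed

text \<open>The monomial with exchanged shifted exponents is the term \<open>k = q + 1\<close> of
  the subtracted sum. The value -1 matches the change of parity of the length.\<close>

lemma dem_mon_extremal_coeff: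
  assumes "lookup m (i + 1) + 1 < lookup m i"
  shows "lookup (dem_mon i m) (mono_xy i m (lookup m (i + 1) + 1) (lookup m i - 1)) = -1"
proof -
  define p q where "p = lookup m i" and "q = lookup m (i + 1)"
  have pq: "q + 1 < p" using assms by (simp add: p_def q_def)
  let ?t = "mono_xy i m (q + 1) (p - 1)"
  have eq: "?t = mono_xy i m k (p + q - k) \<longleftrightarrow> k = q + 1" if "k \<in> {Suc q..<p}" for k
  proof
    assume "?t = mono_xy i m k (p + q - k)"
    then have "lookup ?t i = lookup (mono_xy i m k (p + q - k)) i" by simp
    then show "k = q + 1" by (simp add: lookup_mono_xy)
  qed (use pq in simp)
  have "dem_mon i m = - (\<Sum>k\<in>{Suc q..<p}. frag_of (mono_xy i m k (p + q - k)))"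
    using pq unfolding dem_mon_def Let_def p_def q_def by simp
  then have "lookup (dem_mon i m) ?t = - (\<Sum>k\<in>{Suc q..<p}. if ?t = mono_xy i m k (p + q - k) then 1 else 0)"
    by (simp add: lookup_sum)
  also have "(\<Sum>k\<in>{Suc q..<p}. if ?t = mono_xy i m k (p + q - k) then 1 else (0::int)) = (\<Sum>k\<in>{Suc q..<p}. if k = q + 1 then 1 else 0)"
    by (rule sum.cong) (use eq in auto)
  also have "\<dots> = 1" using pq by simp
  finally show ?thesis unfolding p_def q_def .
qed

text \<open>The second clause makes the first one inductive: a strict maximum of
  \<open>energy\<close> ensures that no other monomial contributes to the coefficient after the next
  operator.\<close>

definition extremal :: "nat \<Rightarrow> (nat \<Rightarrow> nat) \<Rightarrow> bool" where
  "extremal n w \<longleftrightarrow> lookup (gp n w) (raj_mon n w) = (-1) ^ perm_length n w \<and>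
     (\<forall>m\<in>keys (gp n w). mdeg m = raj n w \<longrightarrow> m \<noteq> raj_mon n w \<longrightarrow> energy n m < energy n (raj_mon n w))"

lemma extremal_avoids_132:
  assumes w: "w permutes {1..n}" and av: "avoids_132 n w"
  shows "extremal n w"
proof -
  have rc: "rajchgot_code n w j = lehmer_code n w j" if "j \<in> {1..n}" for j
    using avoids_132_code[OF permutes_inj[OF w] av that] .
  have "comp_mon (raj_mon n w) = (\<Prod>j\<in>{1..n}. (1 - X j) ^ lookup (raj_mon n w) j)"
    by (rule comp_mon_superset) (auto simp: in_keys_iff lookup_raj_mon split: if_splits)
  also have "\<dots> = gp n w" unfolding gp_avoids_132[OF assms]
    by (rule prod.cong) (simp_all add: lookup_raj_mon rc)
  finally have g: "gp n w = comp_mon (raj_mon n w)" ..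
  have "raj n w = perm_length n w" unfolding raj_def perm_length_def by (rule sum.cong) (simp_all add: rc)
  then show ?thesis unfolding extremal_def g comp_mon_lookup mdeg_raj_mon
    using comp_mon_keys[of _ "raj_mon n w"] mdeg_raj_mon by fastforce
qed

text \<open>Take for \<open>i\<close> the last position before the 3 of the pattern whose value is
  below its 2; the next value is then above the 2.\<close>

lemma adjacent_132:
  assumes inj: "inj w" and nav: "\<not> avoids_132 n w"
  obtains i k where "i \<in> {1..<n}" "i + 1 < k" "k \<le> n" "w i < w k" "w k < w (i + 1)"
proof -
  obtain a b c where abc: "1 \<le> a" "a < b" "b < c" "c \<le> n" "w a < w c" "w c < w b"
    using nav unfolding avoids_132_def by blast
  let ?S = "{x. x < b \<and> w x < w c \<and> 1 \<le> x}"
  have fin: "finite ?S" by simp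
  have "a \<in> ?S" using abc by simp
  then have M: "Max ?S \<in> ?S" using fin by (intro Max_in) auto
  define i where "i = Max ?S"
  have i: "i < b" "w i < w c" "1 \<le> i" using M unfolding i_def by auto
  have "w c < w (i + 1)"
  proof (cases "i + 1 = b")
    case False
    have "i + 1 \<notin> ?S" using Max_ge[OF fin, of "i + 1"] unfolding i_def[symmetric] by auto
    then have "\<not> w (i + 1) < w c" using False i by auto
    moreover have "w (i + 1) \<noteq> w c" using inj_eq[OF inj, of "i + 1" c] i abc by auto
    ultimately show ?thesis by simp
  qed (use abc in simp)
  then show ?thesis using that[of i c] i abc by auto
qed

text \<open>By \<open>decreasing_lis\<close>, the pattern makes \<open>lis\<close> at
  \<open>i + 1\<close> smaller than at \<open>i\<close>. The exchange then merely moves these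
  lengths along with the values, so the shifted Rajchgot codes of \<open>w\<close> and
  \<open>w \<circ> adj i\<close> differ by exchanging two entries, and \<open>dem i\<close> leads
  from one extremal monomial to the other.\<close>

lemma extremal_step:
  assumes w: "w permutes {1..n}" and dec: "decreasing_lis n w"
    and i: "i \<in> {1..<n}" and k: "i + 1 < k" "k \<le> n" "w i < w k" "w k < w (i + 1)"
  shows "decreasing_lis n (w \<circ> adj i)" "extremal n (w \<circ> adj i) \<Longrightarrow> extremal n w"
proof -
  let ?w = "w \<circ> adj i"
  have winv: "w (inv w x) = x" "inv w (w x) = x" for x using permutes_inverses[OF w] by auto
  have w': "?w permutes {1..n}" using permutes_comp_adj[OF w i] .
  have asc: "w i < w (i + 1)" using k by simp
  have kr: "k \<in> {1..n}" "i + 1 \<in> {1..n}" "i \<in> {1..n}" using i k by auto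
  have wr: "w x \<in> {1..n}" if "x \<in> {1..n}" for x using permutes_in_image[OF w] that by blast
  have lik: "lis n w (i + 1) \<le> lis n w k"
    using dec wr[OF kr(1)] wr[OF kr(2)] k(4) unfolding decreasing_lis_def
    by (metis winv(2) atLeastAtMost_iff less_imp_le_nat)
  have lki: "lis n w k + 1 \<le> lis n w i" using lis_step[of i k n w] k by simp
  have ar: "adj i x \<in> {1..n}" if "x \<in> {1..n}" for x using that i by (auto simp: transpose_def)
  have le: "lis n w j \<le> lis n ?w (adj i j)" if j: "j \<in> {1..n}" for j
  proof (rule lis_mono_map[where f = "adj i", OF ar _ j])
    fix j assume j: "j \<in> {1..n}" "lis n w j \<noteq> 1"
    then have "j \<le> n" by simp
    from lis_next[OF this j(2)] obtain l where l: "j < l" "l \<le> n" "w j < w l" "lis n w j = lis n w l + 1" .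
    show "\<exists>l. j < l \<and> l \<le> n \<and> lis n w j \<le> lis n w l + 1 \<and> adj i j < adj i l \<and> ?w (adj i j) < ?w (adj i l)"
    \<comment> \<open>The step from \<open>i\<close> to \<open>i + 1\<close> is the only one
      destroyed by the exchange; the step from \<open>i\<close> to \<open>k\<close> replaces it
      without loss.\<close>
    proof (cases "j = i \<and> l = i + 1")
      case True
      then have "lis n w j \<le> lis n w k + 1" using l lik by simp
      moreover have "adj i k = k" using k(1) by (simp add: transpose_apply_other)
      ultimately show ?thesis using True k by (intro exI[of _ k]) simp
    next
      case False
      then show ?thesis using l adj_less[OF l(1) False] by (intro exI[of _ l]) simp
    qed
  qed
  have ge: "lis n ?w j \<le> lis n w (adj i j)" if j: "j \<in> {1..n}" for j
  proof (rule lis_mono_map[where f = "adj i", OF ar _ j])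
    fix j assume j: "j \<in> {1..n}" "lis n ?w j \<noteq> 1"
    then have "j \<le> n" by simp
    from lis_next[OF this j(2)] obtain l where l: "j < l" "l \<le> n" "?w j < ?w l" "lis n ?w j = lis n ?w l + 1" .
    have "\<not> (j = i \<and> l = i + 1)" using l(3) asc by auto
    from adj_less[OF l(1) this]
    show "\<exists>l. j < l \<and> l \<le> n \<and> lis n ?w j \<le> lis n ?w l + 1 \<and> adj i j < adj i l \<and> w (adj i j) < w (adj i l)"
      using l by (intro exI[of _ l]) simp
  qed
  have lis': "lis n ?w (adj i j) = lis n w j" if "j \<in> {1..n}" for j
    using le[OF that] ge[OF ar[OF that]] by simp
  have inv': "inv ?w x = adj i (inv w x)" for x
    using o_inv_distrib[OF permutes_bij[OF w] bij_transpose] by (simp add: o_def)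
  show "decreasing_lis n ?w"
    unfolding decreasing_lis_def
  proof (intro allI impI)
    fix u v :: nat assume uv: "1 \<le> u" "u \<le> v" "v \<le> n"
    then have "inv w u \<in> {1..n}" "inv w v \<in> {1..n}"
      using permutes_in_image[OF permutes_inv[OF w], of u] permutes_in_image[OF permutes_inv[OF w], of v] by auto
    then show "lis n ?w (inv ?w v) \<le> lis n ?w (inv ?w u)"
      unfolding inv' using lis' dec uv unfolding decreasing_lis_def by simp
  qed
  assume ext: "extremal n ?w"
  define p q where "p = rajchgot_code n ?w i" and "q = rajchgot_code n ?w (i + 1)"
  have l1: "lis n ?w i = lis n w (i + 1)" "lis n ?w (i + 1) = lis n w i"
    using lis'[OF kr(2)] lis'[OF kr(3)] by simp_all
  \<comment> \<open>The tail from \<open>i\<close> has one entry more than the tail from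
    \<open>i + 1\<close>. This is the origin of \<open>q + 1\<close> and \<open>p - 1\<close>, and
    of the shift in \<open>energy\<close>.\<close>
  have r1: "p + lis n w (i + 1) = n + 1 - i" "q + lis n w i = n - i"
    using rajchgot_lis[of i n ?w] rajchgot_lis[of "i + 1" n ?w] l1 i unfolding p_def q_def by simp_all
  have r2: "rajchgot_code n w i + lis n w i = n + 1 - i" "rajchgot_code n w (i + 1) + lis n w (i + 1) = n - i"
    using rajchgot_lis[of i n w] rajchgot_lis[of "i + 1" n w] i by simp_all
  have pq: "q + 1 < p" using r1 lik lki i by auto
  have ri: "rajchgot_code n w i = q + 1" "rajchgot_code n w (i + 1) = p - 1" using r1 r2 i by auto
  have ro: "rajchgot_code n ?w j = rajchgot_code n w j" if "j \<in> {1..n}" "j \<noteq> i" "j \<noteq> i + 1" for j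
    using rajchgot_lis[of j n w] rajchgot_lis[of j n ?w] lis'[OF that(1)] that by (simp add: transpose_apply_other)
  let ?A = "raj_mon n w" and ?B = "raj_mon n ?w"
  have Bp: "lookup ?B i = p" "lookup ?B (i + 1) = q"
    using kr by (simp_all add: lookup_raj_mon p_def q_def)
  have AB: "?A = mono_xy i ?B (q + 1) (p - 1)"
    by (rule poly_mapping_eqI) (use ri ro kr in \<open>auto simp: lookup_mono_xy lookup_raj_mon\<close>)
  have "mdeg ?A = mdeg ?B" unfolding AB by (rule mdeg_mono_xy) (use Bp pq in simp)
  then have rr: "raj n w = raj n ?w" by (simp add: mdeg_raj_mon)
  have eAB: "energy n ?A = energy n ?B"
    using energy_mono_xy[OF i, of "q + 1" "p - 1" ?B] Bp pq unfolding AB by simp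
  have gp: "gp n w = dem i (gp n ?w)"
    using gp_descent[OF w' i] asc by simp
  have lenp: "perm_length n ?w = perm_length n w + 1" by (rule perm_length_ascent[OF i asc])
  have lB: "lookup (gp n ?w) ?B = (-1) ^ perm_length n ?w" using ext by (simp add: extremal_def)
  have BK: "?B \<in> keys (gp n ?w)" using lB by (simp add: in_keys_iff)
  have small: "energy n m < energy n ?B" if "m \<in> keys (gp n ?w)" "mdeg m = raj n w" "m \<noteq> ?B" for m
    using ext that rr unfolding extremal_def by auto
  \<comment> \<open>\<open>dem_mon\<close> preserves the degree and never raises the energy, and
    \<open>?A\<close> has the energy of \<open>?B\<close>, the strict maximum in this
    degree.\<close>
  have zero: "lookup (dem_mon i m) ?A = 0" if "m \<in> keys (gp n ?w)" "m \<noteq> ?B" for m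
  proof (rule ccontr)
    assume "lookup (dem_mon i m) ?A \<noteq> 0"
    then have a: "?A \<in> keys (dem_mon i m)" by (simp add: in_keys_iff)
    have "mdeg m = raj n w" using dem_mon_mdeg[OF a] by (simp add: mdeg_raj_mon)
    then have "energy n m < energy n ?B" using small that by blast
    then show False using energy_dem_mon(1)[OF i a] eAB by simp
  qed
  have "lookup (gp n w) ?A =
    (\<Sum>m\<in>{?B}. lookup (gp n ?w) m * lookup (dem_mon i m) ?A)"
    unfolding gp lookup_dem by (rule sum.mono_neutral_right) (use BK zero in auto)
  also have "\<dots> = (-1) ^ perm_length n w"
    using dem_mon_extremal_coeff[of ?B i] Bp pq lB lenp AB by simp
  finally have lA: "lookup (gp n w) ?A = (-1) ^ perm_length n w" .
  have "energy n m < energy n ?A" if m: "m \<in> keys (gp n w)" "mdeg m = raj n w" "m \<noteq> ?A" for m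
  proof -
    have "m \<in> keys (frag_extend (dem_mon i) (gp n ?w))" using m(1) unfolding gp dem_def .
    from subsetD[OF keys_frag_extend this] obtain m'
      where m': "m' \<in> keys (gp n ?w)" "m \<in> keys (dem_mon i m')" by blast
    have d: "mdeg m' = raj n w" using dem_mon_mdeg[OF m'(2)] m(2) by simp
    show ?thesis
    proof (cases "m' = ?B")
      case True
      then show ?thesis using energy_dem_mon(2)[OF i m'(2)] Bp pq AB m(3) eAB by simp
    next
      case False
      then show ?thesis using energy_dem_mon(1)[OF i m'(2)] small[OF m'(1) d] eAB by simp
    qed
  qed
  then show "extremal n w" unfolding extremal_def using lA by blast
qed

lemma decreasing_lis_extremal:
  assumes "w permutes {1..n}" "decreasing_lis n w"
  shows "extremal n w"
  using assms
proof (induction "n * n - perm_length n w" arbitrary: w rule: less_induct)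
  case less
  show ?case
  proof (cases "avoids_132 n w")
    case True
    then show ?thesis using extremal_avoids_132 less.prems by blast
  next
    case False
    from adjacent_132[OF permutes_inj[OF less.prems(1)] this]
    obtain i k where ik: "i \<in> {1..<n}" "i + 1 < k" "k \<le> n" "w i < w k" "w k < w (i + 1)" .
    have "perm_length n (w \<circ> adj i) = perm_length n w + 1"
      by (rule perm_length_ascent) (use ik in auto)
    then have "n * n - perm_length n (w \<circ> adj i) < n * n - perm_length n w"
      using perm_length_le[of n "w \<circ> adj i"] by simp
    from less.hyps[OF this permutes_comp_adj[OF less.prems(1) ik(1)] extremal_step(1)[OF less.prems ik]]
    show ?thesis by (rule extremal_step(2)[OF less.prems ik])
  qed
qed

text \<open>Multiplied by the sign of \<open>w\<close>, each summand of \<open>coeff_euler\<close>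
  at this monomial is nonpositive, because a left descent changes the parity, and by
  \<open>lis_left_eq\<close> one is negative unless \<open>decreasing_lis\<close> holds. The factor
  on the left is nonpositive by \<open>maj_le_raj\<close>, which leaves only a positive
  value.\<close>

theorem gp_coeff_raj:
  assumes "w permutes {1..n}"
  shows "0 < (-1) ^ perm_length n w * lookup (gp n w) (raj_mon n w)"
  using assms
proof (induction "perm_length n w" arbitrary: w rule: less_induct)
  case less
  note w = less.prems
  let ?L = "left_descents n w" and ?m = "raj_mon n w"
  let ?s = "(-1) ^ perm_length n w :: int"
  show ?case
  proof (cases "decreasing_lis n w")
    case True
    then have "lookup (gp n w) ?m = ?s" using decreasing_lis_extremal[OF w] extremal_def by blast
    then show ?thesis by (simp flip: power_add)
  next
    case False
    obtain k0 where k0: "k0 \<in> ?L" "lis n w (inv w k0) < lis n w (inv w (k0 + 1))"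
      using not_decreasing_lis[OF w False] by blast
    have same: "raj_mon n (adj k \<circ> w) = ?m" if k: "k \<in> ?L" "raj n (adj k \<circ> w) = raj n w" for k
    proof -
      have "rajchgot_code n (adj k \<circ> w) j = rajchgot_code n w j" if j: "j \<in> {1..n}" for j
      proof (rule ccontr)
        assume "rajchgot_code n (adj k \<circ> w) j \<noteq> rajchgot_code n w j"
        then have "rajchgot_code n (adj k \<circ> w) j < rajchgot_code n w j" using raj_left_mono(1)[OF w k(1) j] by simp
        then have "raj n (adj k \<circ> w) < raj n w" unfolding raj_def
          by (intro sum_strict_mono_ex1) (use raj_left_mono(1)[OF w k(1)] j in auto)
        then show False using k(2) by simp
      qed
      then show ?thesis by (intro poly_mapping_eqI) (simp add: lookup_raj_mon)
    qed
    have sgn: "?s = - ((-1) ^ perm_length n (adj k \<circ> w))" if "k \<in> ?L" for k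
    proof -
      have "perm_length n w = Suc (perm_length n (adj k \<circ> w))" using perm_length_left_descent[OF w that] by simp
      then show ?thesis by simp
    qed
    have summand: "?s * lookup (gp n (adj k \<circ> w)) ?m \<le> 0 \<and>
      (raj n (adj k \<circ> w) = raj n w \<longrightarrow> ?s * lookup (gp n (adj k \<circ> w)) ?m < 0)" if k: "k \<in> ?L" for k
    proof (cases "raj n (adj k \<circ> w) = raj n w")
      case True
      have "perm_length n (adj k \<circ> w) < perm_length n w" using perm_length_left_descent[OF w k] by simp
      from less.hyps[OF this left_descent_permutes[OF w k]]
      have "0 < (-1) ^ perm_length n (adj k \<circ> w) * lookup (gp n (adj k \<circ> w)) ?m"
        unfolding same[OF k True] .
      then show ?thesis unfolding sgn[OF k] by simp
    next
      case False
      then have "raj n (adj k \<circ> w) < mdeg ?m" using raj_left_mono(2)[OF w k] by (simp add: mdeg_raj_mon)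
      then have "lookup (gp n (adj k \<circ> w)) ?m = 0"
        by (rule gp_coeff_high[OF left_descent_permutes[OF w k]])
      then show ?thesis using False by simp
    qed
    have r0: "raj n (adj k0 \<circ> w) = raj n w"
    proof -
      have "rajchgot_code n (adj k0 \<circ> w) j = rajchgot_code n w j" if "j \<in> {1..n}" for j
        using lis_left_eq[OF w k0(1) that k0(2)] rajchgot_lis[of j n w] rajchgot_lis[of j n "adj k0 \<circ> w"] that by simp
      then show ?thesis unfolding raj_def by simp
    qed
    have "(\<Sum>k\<in>?L. int k * (?s * lookup (gp n (adj k \<circ> w)) ?m)) < (\<Sum>k\<in>?L. 0)"
    proof (rule sum_strict_mono_ex1)
      show "\<forall>k\<in>?L. int k * (?s * lookup (gp n (adj k \<circ> w)) ?m) \<le> 0"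
        using summand by (auto simp: mult_le_0_iff)
      have "0 < k0" using k0(1) by (simp add: left_descents_def)
      then show "\<exists>k\<in>?L. int k * (?s * lookup (gp n (adj k \<circ> w)) ?m) < 0"
        using summand[OF k0(1)] r0 k0(1) by (intro bexI[of _ k0]) (auto simp: mult_less_0_iff)
    qed simp
    also have "(\<Sum>k\<in>?L. int k * (?s * lookup (gp n (adj k \<circ> w)) ?m)) =
      ?s * (\<Sum>k\<in>?L. int k * lookup (gp n (adj k \<circ> w)) ?m)"
      by (simp add: sum_distrib_left mult.left_commute)
    also have "\<dots> = (int (\<Sum>k\<in>?L. k) - int (raj n w)) * (?s * lookup (gp n w) ?m)"
      unfolding coeff_euler[OF w, symmetric] mdeg_raj_mon by (simp only: ac_simps)
    finally have "(int (\<Sum>k\<in>?L. k) - int (raj n w)) * (?s * lookup (gp n w) ?m) < 0" by simp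
    moreover have "int (\<Sum>k\<in>?L. k) - int (raj n w) \<le> 0" using maj_le_raj[OF w] by linarith
    ultimately show ?thesis by (meson mult_nonpos_nonpos not_le)
  qed
qed

theorem raj_le_total_degree:
  assumes "grothendieck n w f"
  shows "raj n w \<le> total_degree f"
proof -
  have g: "gpoly n w (complement f)" using grothendieck_gpoly[OF assms] .
  have "lookup (complement f) (raj_mon n w) \<noteq> 0"
    using gp_coeff_raj[OF gpoly_permutes[OF g]] unfolding gp_eq[OF g] by auto
  then have "raj_mon n w \<in> keys (complement f)" by (simp add: in_keys_iff)
  from mdeg_le_total_degree_complement[OF this] show ?thesis by (simp add: mdeg_raj_mon)
qed

theorem theorem1p3:
  fixes n :: nat and w :: "nat \<Rightarrow> nat" and P :: "nat \<Rightarrow> nat \<Rightarrow> tile"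
  assumes "w permutes {1..n}" and "vexillary n w" and "P \<in> Pipes n w"
  shows "(\<forall>i\<in>{1..n}. int (card (pipe_up_elbows n P i))
            \<le> int (rajchgot_code n w (inv w i)) - int (lehmer_code n w (inv w i)))
       \<and> (\<forall>G. grothendieck n w G \<and>
              card (blanks n P) + card (up_elbows n P) = total_degree G \<longrightarrow>
            (\<forall>i\<in>{1..n}. int (card (pipe_up_elbows n P i))
               = int (rajchgot_code n w (inv w i)) - int (lehmer_code n w (inv w i))))"
proof -
  interpret vex_bpd n P w
    by unfold_locales (use assms in \<open>auto simp: Pipes_def\<close>)
  let ?u = "\<lambda>i. card (pipe_up_elbows n P i)"
  let ?r = "\<lambda>i. rajchgot_code n w (inv w i)" and ?c = "\<lambda>i. lehmer_code n w (inv w i)"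
  have bound: "?u i + ?c i \<le> ?r i" if "i \<in> {1..n}" for i using up_elbows_bound[OF that] .
  have reindex: "(\<Sum>i\<in>{1..n}. f (inv w i)) = (\<Sum>i\<in>{1..n}. f i)" for f :: "nat \<Rightarrow> nat"
    using sum.permute[OF permutes_inv[OF assms(1)], of f] by (simp add: comp_def)
  have eq: "?u i + ?c i = ?r i" if G: "grothendieck n w G" "card (blanks n P) + card (up_elbows n P) = total_degree G"
    and i: "i \<in> {1..n}" for G i
  proof (rule ccontr)
    assume "?u i + ?c i \<noteq> ?r i"
    then have "?u i + ?c i < ?r i" using bound[OF i] by simp
    \<comment> \<open>A strict bound for one pipe would make the total number of blanks and
      up-elbows smaller than the sum of the Rajchgot code, hence smaller than the degree.\<close>
    then have "(\<Sum>i\<in>{1..n}. ?u i + ?c i) < (\<Sum>i\<in>{1..n}. ?r i)"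
      by (intro sum_strict_mono_ex1) (use bound i in auto)
    also have "\<dots> = raj n w" unfolding raj_def by (rule reindex)
    also have "\<dots> \<le> total_degree G" by (rule raj_le_total_degree[OF G(1)])
    also have "\<dots> = (\<Sum>i\<in>{1..n}. ?u i + ?c i)"
      unfolding G(2)[symmetric] card_blanks sum_pipe_up_elbows[symmetric] perm_length_def sum.distrib
      by (simp only: reindex add.commute)
    finally show False by simp
  qed
  show ?thesis
  proof (intro conjI ballI allI impI)
    fix i assume "i \<in> {1..n}"
    then show "int (?u i) \<le> int (?r i) - int (?c i)" using bound[of i] by linarith
  next
    fix G i
    assume "grothendieck n w G \<and> card (blanks n P) + card (up_elbows n P) = total_degree G" "i \<in> {1..n}"
    then show "int (?u i) = int (?r i) - int (?c i)" using eq[of G i] by linarith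
  qed
qed

end
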